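(* Let $\alpha\in(0,2)$, let $X=(x_{ij})$ be the $N\times n$ heavy-tailed random matrix described in the context, with tail exponent $\alpha$, and suppose that $x_{11}$ is symmetrically distributed. Let $\mathfrak b\in(0,1/2)$ be a constant and let $k=k(n)$ satisfy $k=O(n^{1-2\mathfrak b})$. Let $\mathfrak u^{(k)}$ be the unit right singular vector of $X$ corresponding to its $k$-th smallest singular value. Then for any $\delta\in(0,1)$ and $K>0$ there exists a constant $c>0$ (which may depend on $\alpha$ and $\delta$) such that, defining the (random) index set $$\hat I_k=\hat I_k(\mathfrak u^{(k)})=\Big\{i\in[n]:|\mathfrak u^{(k)}_i|>\sqrt{\tfrac{c\log n}{n}}\Big\},$$ we have $\|\mathfrak u^{(k)}_{\hat I_k}\|_2\ge\sqrt{1-\delta}$ with probability at least $1-O(n^{-K})$.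
   Context: Model: $\mathsf a>1$ is a constant, $N=\lceil \mathsf a n\rceil$, and $X=(x_{ij})$ is an $N\times n$ real random matrix with i.i.d. entries whose law does not depend on $n$ and satisfies, for some constants $\alpha,C_\ell,C_u,T_0>0$, $C_\ell t^{-\alpha}\le \mathbb P\{|x_{11}|>t\}\le C_u t^{-\alpha}$ for all $t\ge T_0$. "Symmetrically distributed" means $x_{11}$ and $-x_{11}$ have the same law. Notation: $[n]=\{1,\dots,n\}$; for $x\in\mathbb R^n$ and $I\subseteq[n]$, $x_I\in\mathbb R^{|I|}$ is obtained by deleting the components with indices in $I^c$; unit vectors are with respect to $\|\cdot\|_2$. The model ($\mathsf a$ and the law of $x_{11}$) is fixed and asymptotics are as $n\to\infty$; constants do not depend on $n$. *)

theory Defs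
  imports
    "HOL-Probability.Probability"
    "HOL-Library.Landau_Symbols"
    "Jordan_Normal_Form.Char_Poly"
begin

unbundle no vec_syntax

text \<open>
  The singular values, in increasing order and repeated according to multiplicity. They are indexed
  by the columns: a matrix with \<open>n\<close> columns and at least \<open>n\<close> rows has exactly \<open>n\<close> of them, some
  possibly zero.
\<close>

definition singular_values :: "real mat \<Rightarrow> real list" where
  "singular_values A =
     sorted_list_of_multiset (image_mset sqrt (proots (char_poly (transpose_mat A * A))))"

definition kth_smallest_singular_value :: "real mat \<Rightarrow> nat \<Rightarrow> real" where
  "kth_smallest_singular_value A k = singular_values A ! (k - 1)"

definition vec_l2_norm :: "real vec \<Rightarrow> real" where
  "vec_l2_norm v = L2_set (\<lambda>i. v $ i) {..<dim_vec v}"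

definition unit_right_singular_vector :: "real mat \<Rightarrow> real \<Rightarrow> real vec \<Rightarrow> bool" where
  "unit_right_singular_vector A s v \<longleftrightarrow>
     eigenvector (transpose_mat A * A) v (s\<^sup>2) \<and> vec_l2_norm v = 1"

text \<open>The Euclidean norm of \<open>v\<^sub>I\<close>, the vector of those components of \<open>v\<close> with index in \<open>I\<close>.\<close>

definition restricted_l2_norm :: "real vec \<Rightarrow> nat set \<Rightarrow> real" where
  "restricted_l2_norm v I = L2_set (\<lambda>i. v $ i) ({..<dim_vec v} \<inter> I)"

definition num_rows :: "real \<Rightarrow> nat \<Rightarrow> nat" where
  "num_rows a n = nat \<lceil>a * real n\<rceil>"

text \<open>Row and column indices, and vector components, start at 0 instead of 1.\<close>

definition random_matrix ::
  "real \<Rightarrow> (nat \<Rightarrow> nat \<Rightarrow> nat \<Rightarrow> 'w \<Rightarrow> real) \<Rightarrow> nat \<Rightarrow> 'w \<Rightarrow> real mat" where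
  "random_matrix a x n \<omega> = mat (num_rows a n) n (\<lambda>(i, j). x n i j \<omega>)"

text \<open>
  All entries of all the matrices have the law \<open>D\<close>. Matrices of different sizes may live on different
  probability spaces; nothing is assumed about their joint distribution.
\<close>

definition iid_entries ::
  "real \<Rightarrow> real measure \<Rightarrow> (nat \<Rightarrow> 'w measure) \<Rightarrow> (nat \<Rightarrow> nat \<Rightarrow> nat \<Rightarrow> 'w \<Rightarrow> real) \<Rightarrow> bool" where
  "iid_entries a D M x \<longleftrightarrow>
     (\<forall>n. prob_space (M n) \<and>
          prob_space.indep_vars (M n) (\<lambda>_. borel) (\<lambda>(i, j). x n i j) ({..<num_rows a n} \<times> {..<n}) \<and>
          (\<forall>i<num_rows a n. \<forall>j<n. distr (M n) borel (x n i j) = D))"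

definition heavy_tailed :: "real measure \<Rightarrow> real \<Rightarrow> real \<Rightarrow> real \<Rightarrow> real \<Rightarrow> bool" where
  "heavy_tailed D \<alpha> C\<^sub>l C\<^sub>u T\<^sub>0 \<longleftrightarrow>
     (\<forall>t\<ge>T\<^sub>0. C\<^sub>l * t powr (-\<alpha>) \<le> measure D {y. \<bar>y\<bar> > t} \<and>
              measure D {y. \<bar>y\<bar> > t} \<le> C\<^sub>u * t powr (-\<alpha>))"

definition symmetrically_distributed :: "real measure \<Rightarrow> bool" where
  "symmetrically_distributed D \<longleftrightarrow> distr D borel uminus = D"

definition large_components :: "real \<Rightarrow> nat \<Rightarrow> real vec \<Rightarrow> nat set" where
  "large_components c n u = {i. i < n \<and> \<bar>u $ i\<bar> > sqrt (c * ln (real n) / real n)}"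

text \<open>
  ``\<open>P n\<close> holds with probability at least \<open>1 - O(r n)\<close>''. The event \<open>P n\<close> itself need not be
  measurable; it is enough that it contains a measurable event of the required probability.
\<close>

definition holds_with_prob_one_minus_bigo ::
  "(nat \<Rightarrow> 'w measure) \<Rightarrow> (nat \<Rightarrow> 'w \<Rightarrow> bool) \<Rightarrow> (nat \<Rightarrow> real) \<Rightarrow> bool" where
  "holds_with_prob_one_minus_bigo M P r \<longleftrightarrow>
     (\<exists>E. (\<forall>n. E n \<in> sets (M n) \<and> (\<forall>\<omega>\<in>E n. P n \<omega>)) \<and>
          (\<lambda>n. 1 - measure (M n) (E n)) \<in> O(r))"

end

theory Submission
  imports Defs "Jordan_Normal_Form.Schur_Decomposition" "HOL-Real_Asymp.Real_Asymp"
begin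

text \<open>
  Write \<open>l = n / ln n\<close>. Both halves of the proof compare with the same threshold, a constant multiple
  of \<open>n * l powr (2 / \<alpha> - 1)\<close>: the square of the \<open>k\<close>-th smallest singular value is below it, and
  \<open>\<parallel>X u\<parallel>\<^sup>2\<close> is above it for all unit vectors \<open>u\<close> that carry mass \<open>\<delta>\<close> on coordinates of size at most
  \<open>\<kappa> = sqrt (c / l)\<close>. Since \<open>\<parallel>X u\<parallel>\<close> is the singular value when \<open>u\<close> is a right singular vector, such
  a vector cannot be one.

  \<^emph>\<open>Upper bound.\<close> A column has all its entries bounded by \<open>T = (A * l) powr (1 / \<alpha>)\<close> with probability
  at least \<open>n powr (-b)\<close> when \<open>A\<close> is large, so the number \<open>m\<close> of these columns exceeds \<open>2 * k\<close>. The
  truncated columns have squared norm \<open>O(T\<^sup>2 * ln n)\<close>. In an orthonormal eigenbasis of \<open>X\<^sup>T X\<close>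
  the trace over any \<open>m\<close> coordinates is at least \<open>m - k + 1\<close> times the \<open>k\<close>-th smallest eigenvalue
  (\<open>kth_smallest_singular_value_le_column_norms\<close>), so no operator norm has to be estimated
  (\<open>small_singular_value_event\<close>).

  \<^emph>\<open>Lower bound.\<close> Mass \<open>\<delta>\<close> on coordinates of size at most \<open>\<kappa>\<close> forces the sum of
  \<open>\<bar>u\<^sub>j\<bar> powr \<alpha>\<close> over them to be at least \<open>\<delta> * \<kappa> powr (\<alpha> - 2)\<close>. This sum is the \<open>\<alpha>\<close>-th power of the
  scale on which the heavy-tailed variable \<open>\<langle>x\<^sub>i, u\<rangle>\<close> is spread out. For small \<open>c\<close> the scale is
  at least \<open>\<Lambda>\<close> times the value \<open>r\<close> that the threshold allows in a typical row, with \<open>\<Lambda>\<close> as large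
  as desired. By smoothing with a Gaussian and the decay of the characteristic function, one row is
  that small with probability of order \<open>\<Lambda> powr (-(1 - \<theta>))\<close>, and all but \<open>\<theta> * N\<close> of the rows are with
  probability at most \<open>\<Lambda> powr (-(1 - \<theta>)\<^sup>2 * N)\<close> times the \<open>N\<close>-th power of a constant
  (\<open>few_large_rows_prob_le\<close>). The vectors are replaced by points of
  a lattice, of which about \<open>(C * \<Lambda>) ^ n\<close> are needed (\<open>card_lattice_points_le\<close>). Since
  \<open>N \<ge> a * n\<close> with \<open>a * (1 - \<theta>)\<^sup>2 > 1\<close>, the union bound succeeds once \<open>\<Lambda>\<close> is large
  (\<open>net_beats_small_ball\<close>). It is here that the matrix must be strictly taller than wide.

  The heavy tails make the operator norm of \<open>X\<close> too large for an ordinary net argument. The rounding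
  is therefore done adaptively: coordinate by coordinate the rounding direction is chosen such that
  the error is not increased by a cross term (\<open>greedy_rounding\<close>). The error is then controlled by a
  sum of truncated squares of entries, which is concentrated, and it is small in all but a small
  fraction of the rows (\<open>lattice_approximation\<close>).
\<close>

section \<open>Spectral bound for the small singular values\<close>

text \<open>
  Over the complex numbers there is a root of the characteristic polynomial. It is real because the
  quadratic form of a real symmetric matrix takes real values on complex vectors.
\<close>

lemma real_symmetric_has_eigenvalue:
  fixes A :: "real mat"
  assumes A: "A \<in> carrier_mat n n" and sym: "transpose_mat A = A" and n: "n > 0"
  shows "\<exists>e. eigenvalue A e"
proof -
  define C where "C = map_mat complex_of_real A"
  have C: "C \<in> carrier_mat n n" using A by (simp add: C_def)
  obtain as where as: "char_poly C = (\<Prod>a\<leftarrow>as. [:- a, 1:])" "length as = n"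
    using char_poly_factorized[OF C] by blast
  then have "as \<noteq> []" using n by auto
  then have "poly (char_poly C) (hd as) = 0"
    unfolding as(1) by (cases as) auto
  then have root: "eigenvalue C (hd as)" using eigenvalue_root_char_poly[OF C] by simp
  define z where "z = hd as"
  obtain v where "eigenvector C v z" using root unfolding eigenvalue_def z_def by blast
  then have v: "v \<in> carrier_vec n" "v \<noteq> 0\<^sub>v n" "C *\<^sub>v v = z \<cdot>\<^sub>v v"
    using C unfolding eigenvector_def by auto
  have ev: "(\<Sum>j<n. of_real (A $$ (i,j)) * v $ j) = z * v $ i" if "i < n" for i
  proof -
    have "(C *\<^sub>v v) $ i = (\<Sum>j<n. of_real (A $$ (i,j)) * v $ j)"
      using that v(1) A by (simp add: C_def scalar_prod_def lessThan_atLeast0)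
    then show ?thesis using v that by simp
  qed
  have A_sym: "A $$ (i,j) = A $$ (j,i)" if "i < n" "j < n" for i j
    using sym A that by (metis carrier_matD index_transpose_mat(1))
  define S where "S = (\<Sum>i<n. \<Sum>j<n. of_real (A $$ (i,j)) * v $ j * cnj (v $ i))"
  have "S = (\<Sum>i<n. (\<Sum>j<n. of_real (A $$ (i,j)) * v $ j) * cnj (v $ i))"
    unfolding S_def by (simp add: sum_distrib_right)
  also have "\<dots> = (\<Sum>i<n. z * (v $ i * cnj (v $ i)))"
    by (intro sum.cong) (auto simp: ev simp flip: mult.assoc)
  also have "\<dots> = z * of_real (\<Sum>i<n. (cmod (v $ i))\<^sup>2)"
    unfolding sum_distrib_left of_real_sum
    by (intro sum.cong) (auto simp: complex_mult_cnj cmod_power2)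
  finally have S1: "S = z * of_real (\<Sum>i<n. (cmod (v $ i))\<^sup>2)" .
  \<comment> \<open>Exchanging the summation indices shows that the form is real.\<close>
  have "cnj S = (\<Sum>i<n. \<Sum>j<n. of_real (A $$ (i,j)) * cnj (v $ j) * v $ i)"
    unfolding S_def by simp
  also have "\<dots> = (\<Sum>j<n. \<Sum>i<n. of_real (A $$ (i,j)) * cnj (v $ j) * v $ i)"
    by (rule sum.swap)
  also have "\<dots> = S"
    unfolding S_def by (intro sum.cong refl) (auto simp: A_sym algebra_simps)
  finally have S2: "cnj S = S" .
  obtain i where i: "i < n" "v $ i \<noteq> 0"
    using v by (metis carrier_vecD eq_vecI index_zero_vec)
  define c where "c = (\<Sum>i<n. (cmod (v $ i))\<^sup>2)"
  have "c > 0"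
    unfolding c_def by (rule sum_pos2[of _ i]) (use i in auto)
  moreover have "cnj z * of_real c = z * of_real c"
    using S2 S1 unfolding c_def[symmetric] by (metis complex_cnj_complex_of_real complex_cnj_mult)
  ultimately have "cnj z = z" by simp
  then obtain e where e: "z = complex_of_real e"
    by (metis Reals_cases Reals_cnj_iff)
  have of_real_hom: "comm_ring_hom complex_of_real" by unfold_locales auto
  have "poly (char_poly C) z = 0" using root eigenvalue_root_char_poly[OF C] z_def by simp
  also have "char_poly C = map_poly complex_of_real (char_poly A)"
    unfolding C_def by (rule comm_ring_hom.char_poly_hom[OF of_real_hom A])
  finally have "poly (char_poly A) e = 0" unfolding e by simp
  then show ?thesis using eigenvalue_root_char_poly[OF A] by blast
qed

text \<open>
  Gram--Schmidt applied to a completed basis produces orthogonal columns; they only have to be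
  normalized.
\<close>

lemma unit_vector_extends_to_orthogonal_mat:
  fixes v :: "real vec"
  assumes v: "v \<in> carrier_vec n" "v \<noteq> 0\<^sub>v n"
  shows "\<exists>W c. W \<in> carrier_mat n n \<and> transpose_mat W * W = 1\<^sub>m n \<and> col W 0 = c \<cdot>\<^sub>v v"
proof -
  have n: "n > 0" using v by (cases n) auto
  interpret cof_vec_space n "TYPE(real)" .
  define b where "b = basis_completion v"
  define ws where "ws = gram_schmidt n b"
  from basis_completion[OF v, folded b_def]
  have span_b: "span (set b) = carrier_vec n" and dist_b: "distinct b" 
    and indep: "\<not> lin_dep (set b)" and b: "set b \<subseteq> carrier_vec n" and hdb: "hd b = v" 
    and len_b: "length b = n" by auto
  from hdb len_b n obtain vs where bv: "b = v # vs" by (cases b, auto)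
  from gram_schmidt_result[OF b dist_b indep refl, folded ws_def]
  have ws: "set ws \<subseteq> carrier_vec n" "corthogonal ws" "length ws = n" 
    by (auto simp: len_b)
  from gram_schmidt_hd[OF v(1), of vs, folded bv] have hdws: "hd ws = v" unfolding ws_def .
  define u where "u w = (1 / sqrt (w \<bullet> w)) \<cdot>\<^sub>v w" for w :: "real vec"
  define W where "W = mat_of_cols n (map u ws)"
  have W: "W \<in> carrier_mat n n" using ws by (auto simp: W_def)
  have car: "ws ! i \<in> carrier_vec n" if "i < n" for i using ws that by auto
  have orth: "ws ! i \<bullet> ws ! j = 0 \<longleftrightarrow> i \<noteq> j" if "i < n" "j < n" for i j
    using corthogonalD[OF ws(2), of i j] that ws(3) by (simp add: conjugate_vec_def)
  have colW: "col W i = u (ws ! i)" if "i < n" for i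
    using that ws(3) car[OF that] by (simp add: W_def u_def)
  have dotp: "u (ws ! i) \<bullet> u (ws ! j) = (if i = j then 1 else 0)" if "i < n" "j < n" for i j
  proof -
    have "u (ws ! i) \<bullet> u (ws ! j)
        = 1 / sqrt (ws ! i \<bullet> ws ! i) * (1 / sqrt (ws ! j \<bullet> ws ! j)) * (ws ! i \<bullet> ws ! j)"
      using scalar_prod_smult_distrib[OF smult_carrier_vec[THEN iffD2, OF car[OF that(1)]] car[OF that(2)]]
        smult_scalar_prod_distrib[OF car[OF that(1)] car[OF that(2)]]
      by (simp add: u_def)
    moreover have "ws ! i \<bullet> ws ! i > 0"
    proof -
      have "ws ! i \<bullet> ws ! i \<ge> 0" unfolding scalar_prod_def by (intro sum_nonneg) auto
      then show ?thesis using orth[of i i] that by auto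
    qed
    ultimately show ?thesis using orth[OF that] by auto
  qed
  have "transpose_mat W * W = 1\<^sub>m n"
    using W by (intro eq_matI) (auto simp: colW dotp)
  moreover have "col W 0 = (1 / sqrt (v \<bullet> v)) \<cdot>\<^sub>v v"
    using colW[OF n] hdws ws(3) n by (auto simp: u_def hd_conv_nth)
  ultimately show ?thesis using W by blast
qed

text \<open>
  Induction on the dimension: conjugating with an orthogonal matrix whose first column is an
  eigenvector splits off a \<open>1 \<times> 1\<close> block, and symmetry makes the off-diagonal blocks vanish.
\<close>

lemma real_symmetric_diagonalisation:
  fixes A :: "real mat"
  assumes "A \<in> carrier_mat n n" and "transpose_mat A = A"
  shows "\<exists>P d. P \<in> carrier_mat n n \<and> transpose_mat P * P = 1\<^sub>m n \<and>
     transpose_mat P * A * P = mat n n (\<lambda>(i,j). if i = j then d i else 0)"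
  using assms
proof (induction n arbitrary: A)
  case 0
  then show ?case by (intro exI[of _ A] exI[of _ "\<lambda>_. 0"]) auto
next
  case (Suc m)
  let ?n = "Suc m"
  obtain e v where "eigenvector A v e"
    using real_symmetric_has_eigenvalue[OF Suc.prems] unfolding eigenvalue_def by auto
  then have v: "v \<in> carrier_vec ?n" "v \<noteq> 0\<^sub>v ?n" "A *\<^sub>v v = e \<cdot>\<^sub>v v"
    using Suc.prems unfolding eigenvector_def by auto
  obtain W c where W: "W \<in> carrier_mat ?n ?n" "transpose_mat W * W = 1\<^sub>m ?n"
      "col W 0 = c \<cdot>\<^sub>v v"
    using unit_vector_extends_to_orthogonal_mat[OF v(1,2)] by blast
  note A = Suc.prems(1)
  define B where "B = transpose_mat W * A * W"
  have B: "B \<in> carrier_mat ?n ?n" using W A by (auto simp: B_def)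
  have Bsym: "transpose_mat B = B"
    unfolding B_def using W A Suc.prems(2)
    by (simp add: transpose_mult[of _ ?n ?n _ ?n])
  have B_col: "B $$ (i,0) = (if i = 0 then e else 0)" if "i < ?n" for i
  proof -
    have "B = transpose_mat W * (A * W)"
      using W A by (simp add: B_def assoc_mult_mat[of _ ?n ?n _ ?n _ ?n])
    then have "B $$ (i,0) = col W i \<bullet> col (A * W) 0"
      using W(1) A that by simp
    also have "col (A * W) 0 = A *\<^sub>v col W 0" using col_mult2[OF A W(1)] by simp
    also have "A *\<^sub>v col W 0 = e \<cdot>\<^sub>v col W 0"
      unfolding W(3) using A v by (subst mult_mat_vec[of _ ?n ?n]) (auto simp: smult_smult_assoc mult.commute)
    also have "col W i \<bullet> (e \<cdot>\<^sub>v col W 0) = e * (transpose_mat W * W) $$ (i, 0)"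
      using W(1) that by simp
    finally show ?thesis unfolding W(2) using that by simp
  qed
  have B_row: "B $$ (0,i) = (if i = 0 then e else 0)" if "i < ?n" for i
    using B_col[OF that] Bsym B that by (metis carrier_matD index_transpose_mat(1) zero_less_Suc)
  define C where "C = mat m m (\<lambda>(i,j). B $$ (Suc i, Suc j))"
  have C: "C \<in> carrier_mat m m" by (simp add: C_def)
  have "transpose_mat C = C"
    using Bsym B by (intro eq_matI) (auto simp: C_def, metis Suc_less_eq carrier_matD index_transpose_mat(1))
  from Suc.IH[OF C this] obtain Q d where Q: "Q \<in> carrier_mat m m" "transpose_mat Q * Q = 1\<^sub>m m"
     "transpose_mat Q * C * Q = mat m m (\<lambda>(i,j). if i = j then d i else 0)" by blast
  define E where "E = mat 1 1 (\<lambda>_. e)"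
  have E: "E \<in> carrier_mat 1 1" by (simp add: E_def)
  have Bblock: "B = four_block_mat E (0\<^sub>m 1 m) (0\<^sub>m m 1) C"
    using B C E by (intro eq_matI) (auto simp: E_def C_def B_row B_col)
  define R where "R = four_block_mat (1\<^sub>m 1) (0\<^sub>m 1 m) (0\<^sub>m m 1) Q"
  have R: "R \<in> carrier_mat ?n ?n" using Q by (auto simp: R_def)
  have RT: "transpose_mat R = four_block_mat (1\<^sub>m 1) (0\<^sub>m 1 m) (0\<^sub>m m 1) (transpose_mat Q)"
    unfolding R_def using Q by (subst transpose_four_block_mat[of _ 1 1 _ m _ m]) auto
  have blk: "four_block_mat F (0\<^sub>m 1 m) (0\<^sub>m m 1) G * four_block_mat H (0\<^sub>m 1 m) (0\<^sub>m m 1) K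
      = four_block_mat (F * H) (0\<^sub>m 1 m) (0\<^sub>m m 1) (G * K)"
    if "F \<in> carrier_mat 1 1" "G \<in> carrier_mat m m" "H \<in> carrier_mat 1 1" "K \<in> carrier_mat m m"
    for F G H K :: "real mat"
    using that by (subst mult_four_block_mat[of F 1 1 _ m _ m G H 1 _ m _ K]) simp_all
  have QT: "transpose_mat Q \<in> carrier_mat m m" using Q by simp
  have RR: "transpose_mat R * R = 1\<^sub>m ?n"
    unfolding RT unfolding R_def using Q QT
    by (subst blk) (auto intro!: eq_matI)
  have RBR: "transpose_mat R * B * R
      = four_block_mat E (0\<^sub>m 1 m) (0\<^sub>m m 1) (transpose_mat Q * C * Q)"
  proof -
    have 1: "transpose_mat R * B
        = four_block_mat (1\<^sub>m 1 * E) (0\<^sub>m 1 m) (0\<^sub>m m 1) (transpose_mat Q * C)"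
      unfolding RT Bblock by (rule blk[OF _ QT E C]) simp
    have "transpose_mat R * B * R
        = four_block_mat (1\<^sub>m 1 * E * 1\<^sub>m 1) (0\<^sub>m 1 m) (0\<^sub>m m 1) (transpose_mat Q * C * Q)"
      unfolding 1 unfolding R_def by (rule blk) (use E QT C Q(1) in auto)
    then show ?thesis unfolding left_mult_one_mat[OF E] right_mult_one_mat[OF E] .
  qed
  define d' where "d' i = (case i of 0 \<Rightarrow> e | Suc j \<Rightarrow> d j)" for i
  have diag: "transpose_mat R * B * R = mat ?n ?n (\<lambda>(i,j). if i = j then d' i else 0)"
    unfolding RBR Q(3)
    by (intro eq_matI) (auto simp: E_def d'_def split: nat.splits)
  have WR: "W * R \<in> carrier_mat ?n ?n" using W R by auto
  have T: "transpose_mat (W * R) = transpose_mat R * transpose_mat W"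
    using W R by (simp add: transpose_mult[of _ ?n ?n _ ?n])
  have "transpose_mat (W * R) * (W * R) = transpose_mat R * (transpose_mat W * W) * R"
    unfolding T using W(1) R
    by (simp add: assoc_mult_mat[of _ ?n ?n _ ?n _ ?n])
  then have 1: "transpose_mat (W * R) * (W * R) = 1\<^sub>m ?n"
    unfolding W(2) using RR R by (simp)
  have 2: "transpose_mat (W * R) * A * (W * R) = transpose_mat R * B * R"
    unfolding T B_def using W(1) R A
    by (simp add: assoc_mult_mat[of _ ?n ?n _ ?n _ ?n])
  show ?case
    by (intro exI[of _ "W * R"] exI[of _ d'] conjI WR 1) (simp only: 2 diag)
qed

text \<open>
  The diagonalization in coordinates. The squares \<open>(w j l)\<^sup>2\<close> form a doubly stochastic matrix, so
  each diagonal entry is a convex combination of the eigenvalues. This is the form in which the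
  spectral theorem is used.
\<close>

lemma real_symmetric_spectral_weights:
  fixes A :: "real mat"
  assumes A: "A \<in> carrier_mat n n" and sym: "transpose_mat A = A"
  shows "\<exists>d w. char_poly A = (\<Prod>l\<leftarrow>[0..<n]. [:- d l, 1:]) \<and>
     (\<forall>j<n. A $$ (j,j) = (\<Sum>l<n. (w j l)\<^sup>2 * d l)) \<and>
     (\<forall>j<n. (\<Sum>l<n. (w j l)\<^sup>2) = 1) \<and> (\<forall>l<n. (\<Sum>j<n. (w j l)\<^sup>2) = 1) \<and>
     (\<forall>l<n. d l = (\<Sum>i<n. \<Sum>j<n. w i l * A $$ (i,j) * w j l))"
proof -
  obtain P d where P: "P \<in> carrier_mat n n" "transpose_mat P * P = 1\<^sub>m n"
     "transpose_mat P * A * P = mat n n (\<lambda>(i,j). if i = j then d i else 0)"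
    using real_symmetric_diagonalisation[OF assms] by blast
  define D where "D = mat n n (\<lambda>(i,j). if i = j then d i else 0)"
  have D: "D \<in> carrier_mat n n" by (simp add: D_def)
  have PT: "transpose_mat P \<in> carrier_mat n n" using P by simp
  have P2: "P * transpose_mat P = 1\<^sub>m n"
    using mat_mult_left_right_inverse[OF PT P(1) P(2)] .
  have PDP: "A = P * D * transpose_mat P"
  proof -
    have "P * D * transpose_mat P = (P * transpose_mat P) * A * (P * transpose_mat P)"
      unfolding D_def P(3)[symmetric] using P(1) A
      by (simp add: assoc_mult_mat[of _ n n _ n _ n])
    then show ?thesis unfolding P2 using A by simp
  qed
  define w where "w j l = P $$ (j,l)" for j l
  have "similar_mat A D"
    unfolding similar_mat_def
    by (intro exI, rule similar_mat_witI[OF P2 P(2) PDP A D P(1) PT])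
  then have "char_poly A = char_poly D" by (rule char_poly_similar)
  also have "\<dots> = (\<Prod>a\<leftarrow>diag_mat D. [:- a, 1:])"
    by (rule char_poly_upper_triangular[OF D]) (auto simp: D_def upper_triangular_def)
  also have "diag_mat D = map d [0..<n]"
    by (auto simp: diag_mat_def D_def)
  finally have 1: "char_poly A = (\<Prod>l\<leftarrow>[0..<n]. [:- d l, 1:])" by (simp add: comp_def)
  have 2: "A $$ (j,j) = (\<Sum>l<n. (w j l)\<^sup>2 * d l)" if "j < n" for j
  proof -
    have PD: "(P * D) $$ (j,l) = w j l * d l" if "l < n" for l
    proof -
      have "(P * D) $$ (j,l) = (\<Sum>i<n. P $$ (j,i) * (if i = l then d i else 0))"
        using \<open>j < n\<close> that P(1) D by (simp add: scalar_prod_def D_def lessThan_atLeast0)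
      also have "\<dots> = (\<Sum>i<n. if i = l then P $$ (j,i) * d i else 0)"
        by (intro sum.cong) auto
      also have "\<dots> = w j l * d l" using that by (simp add: w_def)
      finally show ?thesis .
    qed
    have F: "P * D \<in> carrier_mat n n" using P(1) D by simp
    have "(F * transpose_mat P) $$ (j,j) = (\<Sum>l<n. F $$ (j,l) * P $$ (j,l))"
      if "F \<in> carrier_mat n n" for F
      using that \<open>j < n\<close> P(1) by (simp add: scalar_prod_def lessThan_atLeast0)
    from this[OF F] have "A $$ (j,j) = (\<Sum>l<n. (P * D) $$ (j,l) * P $$ (j,l))"
      unfolding PDP[symmetric] .
    also have "\<dots> = (\<Sum>l<n. (w j l)\<^sup>2 * d l)"
      by (intro sum.cong) (auto simp: PD w_def power2_eq_square)
    finally show ?thesis .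
  qed
  have 3: "(\<Sum>l<n. (w j l)\<^sup>2) = 1" if "j < n" for j
  proof -
    have "(\<Sum>l<n. (w j l)\<^sup>2) = (P * transpose_mat P) $$ (j,j)"
      using that P(1) by (simp add: scalar_prod_def w_def power2_eq_square lessThan_atLeast0)
    then show ?thesis unfolding P2 using that by simp
  qed
  have 4: "(\<Sum>j<n. (w j l)\<^sup>2) = 1" if "l < n" for l
  proof -
    have "(\<Sum>j<n. (w j l)\<^sup>2) = (transpose_mat P * P) $$ (l,l)"
      using that P(1) by (simp add: scalar_prod_def w_def power2_eq_square lessThan_atLeast0)
    then show ?thesis unfolding P(2) using that by simp
  qed
  have 5: "d l = (\<Sum>i<n. \<Sum>j<n. w i l * A $$ (i,j) * w j l)" if "l < n" for l
  proof -
    have F: "transpose_mat P * A \<in> carrier_mat n n" using P(1) A by simp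
    have *: "(F * P) $$ (l,l) = (\<Sum>j<n. F $$ (l,j) * P $$ (j,l))" if "F \<in> carrier_mat n n" for F
      using that \<open>l < n\<close> P(1) by (simp add: scalar_prod_def lessThan_atLeast0)
    have "d l = (transpose_mat P * A * P) $$ (l,l)" unfolding P(3) using that by simp
    also have "\<dots> = (\<Sum>j<n. (transpose_mat P * A) $$ (l,j) * P $$ (j,l))" by (rule *[OF F])
    also have "\<dots> = (\<Sum>j<n. (\<Sum>i<n. w i l * A $$ (i,j)) * w j l)"
      using that P(1) A by (simp add: scalar_prod_def w_def lessThan_atLeast0)
    also have "\<dots> = (\<Sum>i<n. \<Sum>j<n. w i l * A $$ (i,j) * w j l)"
      unfolding sum_distrib_right by (rule sum.swap)
    finally show ?thesis .
  qed
  show ?thesis using 1 2 3 4 5 by blast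
qed

lemma length_filter_less_nth_sorted:
  fixes xs :: "real list"
  assumes "sorted xs" "i < length xs"
  shows "length (filter (\<lambda>y. y < xs ! i) xs) \<le> i"
proof -
  have "filter (\<lambda>y. y < xs ! i) xs = filter (\<lambda>y. y < xs ! i) (take i xs) @ filter (\<lambda>y. y < xs ! i) (drop i xs)"
    by (metis append_take_drop_id filter_append)
  also have "filter (\<lambda>y. y < xs ! i) (drop i xs) = []"
  proof -
    have "\<not> y < xs ! i" if y: "y \<in> set (drop i xs)" for y
    proof -
      obtain m where "m < length (drop i xs)" "y = drop i xs ! m"
        using y by (metis in_set_conv_nth)
      then have "xs ! i \<le> y" using assms by (auto intro!: sorted_nth_mono)
      then show ?thesis by simp
    qed
    then show ?thesis by (auto simp: filter_empty_conv)
  qed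
  finally show ?thesis
    by (metis append_Nil2 length_filter_le length_take min.cobounded2 min.coboundedI2 order_trans)
qed

text \<open>
  Summing the diagonal of \<open>X\<^sup>T X\<close> over \<open>S\<close> gives each eigenvalue a weight in \<open>[0, 1]\<close>, with total
  weight \<open>card S\<close>. At most \<open>k - 1\<close> of the eigenvalues lie below the \<open>k\<close>-th smallest one, and they
  absorb at most \<open>k - 1\<close> of the weight.
\<close>

lemma kth_smallest_singular_value_le_column_norms:
  assumes X: "X \<in> carrier_mat N n" and k: "1 \<le> k" "k \<le> n" and S: "S \<subseteq> {..<n}" and kS: "k \<le> card S"
  shows "(kth_smallest_singular_value X k)\<^sup>2 * real (card S - k + 1)
      \<le> (\<Sum>j\<in>S. \<Sum>i<N. (X $$ (i,j))\<^sup>2)"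
proof -
  define A where "A = transpose_mat X * X"
  have A: "A \<in> carrier_mat n n" using X by (auto simp: A_def)
  have sym: "transpose_mat A = A"
    unfolding A_def using X by (simp add: transpose_mult[of _ n N _ n])
  have A_entry: "A $$ (i,j) = (\<Sum>r<N. X $$ (r,i) * X $$ (r,j))" if "i < n" "j < n" for i j
    using that X by (simp add: A_def scalar_prod_def lessThan_atLeast0)
  obtain d w where dw: "char_poly A = (\<Prod>l\<leftarrow>[0..<n]. [:- d l, 1:]) \<and>
     (\<forall>j<n. A $$ (j,j) = (\<Sum>l<n. (w j l)\<^sup>2 * d l)) \<and>
     (\<forall>j<n. (\<Sum>l<n. (w j l)\<^sup>2) = 1) \<and> (\<forall>l<n. (\<Sum>j<n. (w j l)\<^sup>2) = 1) \<and>
     (\<forall>l<n. d l = (\<Sum>i<n. \<Sum>j<n. w i l * A $$ (i,j) * w j l))"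
    using real_symmetric_spectral_weights[OF A sym] by blast
  then have cp: "char_poly A = (\<Prod>l\<leftarrow>[0..<n]. [:- d l, 1:])" by blast
  have Aw: "A $$ (j,j) = (\<Sum>l<n. (w j l)\<^sup>2 * d l)" and w1: "(\<Sum>l<n. (w j l)\<^sup>2) = 1"
    if "j < n" for j using dw that by blast+
  have w2: "(\<Sum>j<n. (w j l)\<^sup>2) = 1" and dl: "d l = (\<Sum>i<n. \<Sum>j<n. w i l * A $$ (i,j) * w j l)"
    if "l < n" for l using dw that by blast+
  have d0: "d l \<ge> 0" if "l < n" for l
  proof -
    have "d l = (\<Sum>i<n. \<Sum>j<n. \<Sum>r<N. (X $$ (r,i) * w i l) * (X $$ (r,j) * w j l))"
      unfolding dl[OF that]
    proof (intro sum.cong refl)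
      fix i j assume "i \<in> {..<n}" "j \<in> {..<n}"
      then have "w i l * A $$ (i, j) * w j l = (w i l * w j l) * (\<Sum>r<N. X $$ (r,i) * X $$ (r,j))"
        by (simp add: A_entry)
      also have "\<dots> = (\<Sum>r<N. (X $$ (r,i) * w i l) * (X $$ (r,j) * w j l))"
        unfolding sum_distrib_left by (intro sum.cong refl) (simp only: mult_ac)
      finally show "w i l * A $$ (i, j) * w j l = (\<Sum>r<N. (X $$ (r,i) * w i l) * (X $$ (r,j) * w j l))" .
    qed
    also have "\<dots> = (\<Sum>i<n. \<Sum>r<N. \<Sum>j<n. (X $$ (r,i) * w i l) * (X $$ (r,j) * w j l))"
      by (intro sum.cong refl sum.swap)
    also have "\<dots> = (\<Sum>r<N. \<Sum>i<n. \<Sum>j<n. (X $$ (r,i) * w i l) * (X $$ (r,j) * w j l))"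
      by (rule sum.swap)
    also have "\<dots> = (\<Sum>r<N. (\<Sum>i<n. X $$ (r,i) * w i l)\<^sup>2)"
      by (simp add: power2_eq_square sum_product)
    finally show ?thesis by (simp add: sum_nonneg)
  qed
  define s where "s = kth_smallest_singular_value X k"
  define L where "L = sort (map (\<lambda>l. sqrt (d l)) [0..<n])"
  have "proots (\<Prod>l\<leftarrow>xs. [:- d l, 1:]) = mset (map d xs)" for xs :: "nat list"
  proof (induction xs)
    case (Cons x xs)
    have "(\<Prod>l\<leftarrow>xs. [:- d l, 1:]) \<noteq> 0" by (auto simp: prod_list_zero_iff)
    then have "proots ([:- d x, 1:] * (\<Prod>l\<leftarrow>xs. [:- d l, 1:])) = {#d x#} + mset (map d xs)"
      using Cons by (subst proots_mult) auto
    then show ?case by (simp only: list.map prod_list.Cons mset.simps) simp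
  qed simp
  then have "proots (char_poly A) = mset (map d [0..<n])"
    unfolding cp by blast
  then have "singular_values X = L"
    unfolding singular_values_def A_def[symmetric] L_def
    by (simp add: comp_def image_mset.compositionality sorted_list_of_multiset_mset flip: mset_map)
  then have s: "s = L ! (k - 1)" by (simp add: s_def kth_smallest_singular_value_def)
  have lenL: "length L = n" by (simp add: L_def)
  have "L ! (k - 1) \<in> set L" using lenL k by (intro nth_mem) auto
  then have s0: "s \<ge> 0" unfolding s by (auto simp: L_def d0)
  define B where "B = {l\<in>{..<n}. sqrt (d l) < s}"
  have cardB: "card B \<le> k - 1"
  proof -
    have "length (filter (\<lambda>y. y < L ! (k-1)) L) \<le> k - 1"
      by (rule length_filter_less_nth_sorted) (use k lenL in \<open>auto simp: L_def\<close>)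
    moreover have "length (filter (\<lambda>y. y < s) L) = size (filter_mset (\<lambda>y. y < s) (mset L))"
      by (metis mset_filter size_mset)
    moreover have "mset L = image_mset (\<lambda>l. sqrt (d l)) (mset_set {..<n})"
      by (simp add: L_def lessThan_atLeast0)
    moreover have "size (filter_mset (\<lambda>y. y < s) (image_mset (\<lambda>l. sqrt (d l)) (mset_set {..<n}))) = card B"
      by (simp add: filter_mset_image_mset B_def)
    ultimately show ?thesis unfolding s by simp
  qed
  define v where "v l = (\<Sum>j\<in>S. (w j l)\<^sup>2)" for l
  have finS: "finite S" using S finite_subset by blast
  have v0: "v l \<ge> 0" for l by (simp add: v_def sum_nonneg)
  have v1: "v l \<le> 1" if "l < n" for l
    unfolding w2[OF that, symmetric] v_def using S by (intro sum_mono2) auto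
  have vsum: "(\<Sum>l<n. v l) = real (card S)"
  proof -
    have "(\<Sum>l<n. v l) = (\<Sum>j\<in>S. \<Sum>l<n. (w j l)\<^sup>2)" unfolding v_def by (rule sum.swap)
    also have "\<dots> = (\<Sum>j\<in>S. 1)" by (intro sum.cong refl w1) (use S in auto)
    finally show ?thesis by simp
  qed
  have BN: "B \<subseteq> {..<n}" by (auto simp: B_def)
  have "(\<Sum>l\<in>B. v l) \<le> (\<Sum>l\<in>B. 1)" using BN by (intro sum_mono v1) auto
  then have vB: "(\<Sum>l\<in>B. v l) \<le> real (k - 1)" using cardB by simp
  have "(\<Sum>l<n. v l) = (\<Sum>l\<in>{..<n}-B. v l) + (\<Sum>l\<in>B. v l)"
    by (rule sum.subset_diff[OF BN]) simp
  then have vC: "(\<Sum>l\<in>{..<n}-B. v l) \<ge> real (card S - k + 1)"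
    using vB vsum k kS by (simp add: of_nat_diff)
  have "s\<^sup>2 * real (card S - k + 1) \<le> s\<^sup>2 * (\<Sum>l\<in>{..<n}-B. v l)"
    using vC by (intro mult_left_mono) auto
  also have "\<dots> = (\<Sum>l\<in>{..<n}-B. s\<^sup>2 * v l)" by (simp add: sum_distrib_left)
  also have "\<dots> \<le> (\<Sum>l\<in>{..<n}-B. d l * v l)"
  proof (intro sum_mono mult_right_mono v0)
    fix l assume l: "l \<in> {..<n} - B"
    then have "s \<le> sqrt (d l)" by (auto simp: B_def)
    then have "s\<^sup>2 \<le> (sqrt (d l))\<^sup>2" using s0 by (intro power_mono) auto
    then show "s\<^sup>2 \<le> d l" using d0 l by auto
  qed
  also have "\<dots> \<le> (\<Sum>l<n. d l * v l)"
    by (intro sum_mono2) (auto intro!: mult_nonneg_nonneg d0 v0)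
  also have "\<dots> = (\<Sum>j\<in>S. \<Sum>l<n. (w j l)\<^sup>2 * d l)"
    unfolding v_def sum_distrib_left by (subst sum.swap) (simp add: mult.commute)
  also have "\<dots> = (\<Sum>j\<in>S. A $$ (j,j))"
    by (intro sum.cong refl Aw[symmetric]) (use S in auto)
  also have "\<dots> = (\<Sum>j\<in>S. \<Sum>i<N. (X $$ (i,j))\<^sup>2)"
    using S by (intro sum.cong refl) (auto simp: A_entry power2_eq_square)
  finally show ?thesis unfolding s_def .
qed

lemma unit_right_singular_vectorD:
  assumes X: "X \<in> carrier_mat N n" and u: "unit_right_singular_vector X s u"
  shows "dim_vec u = n" and "(\<Sum>j<n. (u $ j)\<^sup>2) = 1"
    and "(\<Sum>i<N. (\<Sum>j<n. X $$ (i,j) * u $ j)\<^sup>2) = s\<^sup>2"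
proof -
  have ev: "eigenvector (transpose_mat X * X) u (s\<^sup>2)" and norm: "vec_l2_norm u = 1"
    using u by (auto simp: unit_right_singular_vector_def)
  then have u: "u \<in> carrier_vec n" and eq: "(transpose_mat X * X) *\<^sub>v u = s\<^sup>2 \<cdot>\<^sub>v u"
    using X by (auto simp: eigenvector_def)
  show dim: "dim_vec u = n" using u by simp
  have "(vec_l2_norm u)\<^sup>2 = (\<Sum>j<n. (u $ j)\<^sup>2)"
    by (simp add: vec_l2_norm_def L2_set_def dim sum_nonneg)
  then show nn: "(\<Sum>j<n. (u $ j)\<^sup>2) = 1" using norm by simp
  have "u \<bullet> ((transpose_mat X * X) *\<^sub>v u) = u \<bullet> (transpose_mat X *\<^sub>v (X *\<^sub>v u))"
    using X u by (simp add: assoc_mult_mat_vec[of _ n N _ n])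
  also have "\<dots> = (X *\<^sub>v u) \<bullet> (X *\<^sub>v u)"
    using transpose_vec_mult_scalar[OF X u, of "X *\<^sub>v u"] X u
    by (metis comm_scalar_prod mult_mat_vec_carrier transpose_carrier_mat)
  also have "\<dots> = (\<Sum>i<N. (\<Sum>j<n. X $$ (i,j) * u $ j)\<^sup>2)"
    using X u by (simp add: scalar_prod_def power2_eq_square lessThan_atLeast0)
  finally have "(\<Sum>i<N. (\<Sum>j<n. X $$ (i,j) * u $ j)\<^sup>2) = u \<bullet> (s\<^sup>2 \<cdot>\<^sub>v u)" unfolding eq by simp
  also have "\<dots> = s\<^sup>2 * (\<Sum>j<n. (u $ j)\<^sup>2)"
    using u by (simp add: scalar_prod_def power2_eq_square lessThan_atLeast0 sum_distrib_left mult_ac)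
  finally show "(\<Sum>i<N. (\<Sum>j<n. X $$ (i,j) * u $ j)\<^sup>2) = s\<^sup>2" using nn by simp
qed

section \<open>Rounding to a lattice and counting lattice points\<close>

text \<open>
  The rounding error of each coordinate may be given either sign by rounding down or up. Choosing
  the sign against the error vector accumulated so far makes the cross term nonpositive, so that the
  squared errors only add up, as they would for independent random rounding.
\<close>

lemma greedy_rounding:
  fixes y :: "nat \<Rightarrow> nat \<Rightarrow> real" and w :: "nat \<Rightarrow> real"
  assumes h: "h > 0"
  shows "\<exists>q :: nat \<Rightarrow> int. (\<forall>j<n. \<bar>w j - h * q j\<bar> \<le> h) \<and>
    (\<Sum>i<N. (\<Sum>j<n. y i j * (w j - h * q j))\<^sup>2) \<le> h\<^sup>2 * (\<Sum>i<N. \<Sum>j<n. (y i j)\<^sup>2)"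
proof (induction n)
  case 0
  then show ?case by simp
next
  case (Suc n)
  then obtain q :: "nat \<Rightarrow> int" where q: "\<forall>j<n. \<bar>w j - h * q j\<bar> \<le> h"
    "(\<Sum>i<N. (\<Sum>j<n. y i j * (w j - h * q j))\<^sup>2) \<le> h\<^sup>2 * (\<Sum>i<N. \<Sum>j<n. (y i j)\<^sup>2)"
    by (elim exE conjE)
  define p where "p i = (\<Sum>j<n. y i j * (w j - h * q j))" for i
  define c where "c = (\<Sum>i<N. p i * y i n)"
  define f where "f = \<lfloor>w n / h\<rfloor>"
  have f: "h * real_of_int f \<le> w n" "w n \<le> h * (real_of_int f + 1)"
    using floor_divide_lower[OF h, of "w n"] floor_divide_upper[OF h, of "w n"]
    by (simp_all add: f_def mult.commute)
  define z where "z = (if c \<le> 0 then f else f + 1)"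
  define v where "v = w n - h * z"
  have v: "\<bar>v\<bar> \<le> h"
    using f h by (auto simp: v_def z_def abs_le_iff algebra_simps)
  have cv: "c * v \<le> 0"
  proof (cases "c \<le> 0")
    case True
    then show ?thesis using f(1) by (simp add: v_def z_def mult_nonpos_nonneg)
  next
    case False
    then show ?thesis using f(2) by (simp add: v_def z_def mult_nonneg_nonpos)
  qed
  let ?q = "q(n := z)"
  have eq: "(\<Sum>j<Suc n. y i j * (w j - h * ?q j)) = p i + y i n * v" for i
    by (simp add: p_def v_def)
  have "(\<Sum>i<N. (\<Sum>j<Suc n. y i j * (w j - h * ?q j))\<^sup>2) = (\<Sum>i<N. (p i + y i n * v)\<^sup>2)"
    by (simp only: eq)
  also have "\<dots> = (\<Sum>i<N. (p i)\<^sup>2) + 2 * (c * v) + v\<^sup>2 * (\<Sum>i<N. (y i n)\<^sup>2)"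
    by (simp add: c_def power2_sum power_mult_distrib sum.distrib sum_distrib_left sum_distrib_right mult_ac)
  also have "\<dots> \<le> h\<^sup>2 * (\<Sum>i<N. \<Sum>j<n. (y i j)\<^sup>2) + h\<^sup>2 * (\<Sum>i<N. (y i n)\<^sup>2)"
  proof -
    have "v\<^sup>2 \<le> h\<^sup>2" using v h by (metis abs_le_square_iff abs_of_pos)
    then have "v\<^sup>2 * (\<Sum>i<N. (y i n)\<^sup>2) \<le> h\<^sup>2 * (\<Sum>i<N. (y i n)\<^sup>2)"
      by (intro mult_right_mono) (auto intro: sum_nonneg)
    then show ?thesis using q(2) cv unfolding p_def by linarith
  qed
  also have "\<dots> = h\<^sup>2 * (\<Sum>i<N. \<Sum>j<Suc n. (y i j)\<^sup>2)"
    by (simp add: sum.distrib distrib_left)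
  finally show ?case
    using q(1) v by (intro exI[of _ ?q]) (auto simp: less_Suc_eq v_def)
qed

text \<open>
  Chebyshev's inequality for the counting measure.
\<close>

lemma card_exceeding_le:
  fixes f :: "'a \<Rightarrow> real"
  assumes "finite I" "r > 0"
  shows "real (card {i\<in>I. \<bar>f i\<bar> > r}) * r\<^sup>2 \<le> (\<Sum>i\<in>I. (f i)\<^sup>2)"
proof -
  have "real (card {i\<in>I. \<bar>f i\<bar> > r}) * r\<^sup>2 = (\<Sum>i\<in>{i\<in>I. \<bar>f i\<bar> > r}. r\<^sup>2)" by simp
  also have "\<dots> \<le> (\<Sum>i\<in>{i\<in>I. \<bar>f i\<bar> > r}. (f i)\<^sup>2)"
    using assms(2) by (intro sum_mono) (auto simp flip: abs_le_square_iff)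
  also have "\<dots> \<le> (\<Sum>i\<in>I. (f i)\<^sup>2)" using assms(1) by (intro sum_mono2) auto
  finally show ?thesis .
qed

text \<open>
  A row is large after the rounding only if it was large before (at most \<open>R\<close> rows), contains an entry
  exceeding \<open>T\<close>, or has a large rounding error in its truncated entries (at most \<open>S\<close> rows each). The
  mesh \<open>r / T\<close> is tied to the truncation so that the single quantity \<open>S\<close> controls the last two.
\<close>

lemma lattice_approximation:
  fixes X :: "nat \<Rightarrow> nat \<Rightarrow> real" and w :: "nat \<Rightarrow> real"
  assumes r: "r > 0" and T: "T > 0"
    and S: "(\<Sum>i<N. \<Sum>j<n. min 1 ((X i j / T)\<^sup>2)) \<le> S"
    and R: "(\<Sum>i<N. (\<Sum>j<n. X i j * w j)\<^sup>2) \<le> R * r\<^sup>2"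
  shows "\<exists>q :: nat \<Rightarrow> int. (\<forall>j<n. \<bar>w j - r / T * q j\<bar> \<le> r / T) \<and>
    real (card {i\<in>{..<N}. \<bar>\<Sum>j<n. X i j * (r / T * q j)\<bar> > 2 * r}) \<le> R + 2 * S"
proof -
  define y where "y i j = (if \<bar>X i j\<bar> \<le> T then X i j else 0)" for i j
  define h where "h = r / T"
  have h: "h > 0" using r T by (simp add: h_def)
  obtain q :: "nat \<Rightarrow> int" where q: "\<forall>j<n. \<bar>w j - h * q j\<bar> \<le> h"
    "(\<Sum>i<N. (\<Sum>j<n. y i j * (w j - h * q j))\<^sup>2) \<le> h\<^sup>2 * (\<Sum>i<N. \<Sum>j<n. (y i j)\<^sup>2)"
    using greedy_rounding[OF h, of n w y N] by (elim exE conjE)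
  define A where "A = {i\<in>{..<N}. \<bar>\<Sum>j<n. X i j * w j\<bar> > r}"
  define B where "B = {i\<in>{..<N}. \<exists>j<n. \<bar>X i j\<bar> > T}"
  define C where "C = {i\<in>{..<N}. \<bar>\<Sum>j<n. y i j * (w j - h * q j)\<bar> > r}"
  have "real (card A) * r\<^sup>2 \<le> R * r\<^sup>2"
    unfolding A_def by (rule order_trans[OF card_exceeding_le R]) (use r in auto)
  then have cA: "real (card A) \<le> R" using r by simp
  have "real (card B) = (\<Sum>i\<in>B. 1)" by simp
  also have "\<dots> \<le> (\<Sum>i\<in>B. \<Sum>j<n. min 1 ((X i j / T)\<^sup>2))"
  proof (intro sum_mono)
    fix i assume "i \<in> B"
    then obtain j where j: "j < n" "\<bar>X i j\<bar> > T" by (auto simp: B_def)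
    then have "1 \<le> \<bar>X i j / T\<bar>" using T by (simp add: field_simps)
    then have "1 \<le> (X i j / T)\<^sup>2" using abs_le_square_iff[of 1 "X i j / T"] by simp
    then have "1 = min 1 ((X i j / T)\<^sup>2)" by simp
    also have "\<dots> \<le> (\<Sum>j<n. min 1 ((X i j / T)\<^sup>2))"
      using j by (intro member_le_sum) auto
    finally show "1 \<le> (\<Sum>j<n. min 1 ((X i j / T)\<^sup>2))" .
  qed
  also have "\<dots> \<le> (\<Sum>i<N. \<Sum>j<n. min 1 ((X i j / T)\<^sup>2))"
    by (intro sum_mono2) (auto simp: B_def intro!: sum_nonneg)
  finally have cB: "real (card B) \<le> S" using S by simp
  have "real (card C) * r\<^sup>2 \<le> (\<Sum>i<N. (\<Sum>j<n. y i j * (w j - h * q j))\<^sup>2)"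
    unfolding C_def by (rule card_exceeding_le) (use r in auto)
  also have "\<dots> \<le> h\<^sup>2 * (\<Sum>i<N. \<Sum>j<n. (y i j)\<^sup>2)" by (rule q(2))
  also have "\<dots> = r\<^sup>2 * (\<Sum>i<N. \<Sum>j<n. (y i j / T)\<^sup>2)"
    by (simp add: h_def power_divide flip: sum_divide_distrib)
  also have "\<dots> \<le> r\<^sup>2 * (\<Sum>i<N. \<Sum>j<n. min 1 ((X i j / T)\<^sup>2))"
  proof (intro mult_left_mono sum_mono)
    fix i j
    show "(y i j / T)\<^sup>2 \<le> min 1 ((X i j / T)\<^sup>2)"
      using T abs_le_square_iff[of "X i j / T" 1] by (auto simp: y_def)
  qed auto
  also have "\<dots> \<le> r\<^sup>2 * S" by (intro mult_left_mono S) simp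
  finally have "real (card C) * r\<^sup>2 \<le> S * r\<^sup>2" by (simp add: mult.commute)
  then have cC: "real (card C) \<le> S" using r by simp
  have sub: "{i\<in>{..<N}. \<bar>\<Sum>j<n. X i j * (h * q j)\<bar> > 2 * r} \<subseteq> A \<union> B \<union> C"
  proof (rule subsetI, rule ccontr)
    fix i assume i: "i \<in> {i\<in>{..<N}. \<bar>\<Sum>j<n. X i j * (h * q j)\<bar> > 2 * r}" "i \<notin> A \<union> B \<union> C"
    then have "\<bar>\<Sum>j<n. X i j * w j\<bar> \<le> r" "\<bar>\<Sum>j<n. y i j * (w j - h * q j)\<bar> \<le> r"
      "\<forall>j<n. \<bar>X i j\<bar> \<le> T"
      by (auto simp: A_def B_def C_def)
    moreover have "(\<Sum>j<n. X i j * (h * q j)) = (\<Sum>j<n. X i j * w j) - (\<Sum>j<n. y i j * (w j - h * q j))"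
      unfolding sum_subtractf[symmetric]
      by (intro sum.cong) (use \<open>\<forall>j<n. \<bar>X i j\<bar> \<le> T\<close> in \<open>auto simp: y_def algebra_simps\<close>)
    ultimately show False using i by auto
  qed
  have "card {i\<in>{..<N}. \<bar>\<Sum>j<n. X i j * (h * q j)\<bar> > 2 * r} \<le> card (A \<union> B \<union> C)"
    by (intro card_mono sub) (auto simp: A_def B_def C_def)
  also have "\<dots> \<le> card A + card B + card C"
    by (meson add_le_cancel_right card_Un_le le_trans)
  finally have "real (card {i\<in>{..<N}. \<bar>\<Sum>j<n. X i j * (h * q j)\<bar> > 2 * r}) \<le> R + 2 * S"
    using cA cB cC by linarith
  then show ?thesis using q(1) unfolding h_def by blast
qed

text \<open>
  Telescoping, from \<open>b\<^sup>2 + y\<^sup>2 \<ge> (b + y) * (b + y - 1) / 2\<close>.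
\<close>

lemma sum_inverse_quadratic_le:
  fixes b :: real
  assumes b: "b \<ge> 1"
  shows "(\<Sum>y\<in>{-int M..int M}. 1 / (1 + (real_of_int y / b)\<^sup>2)) \<le> 5 * b"
proof -
  let ?g = "\<lambda>y::int. 1 / (1 + (real_of_int y / b)\<^sup>2)"
  have pos: "(\<Sum>k=1..m. ?g (int k)) \<le> 2 * b\<^sup>2 * (1 / b - 1 / (b + real m))" for m
  proof (induction m)
    case (Suc m)
    have "?g (int (Suc m)) \<le> 2 * b\<^sup>2 * (1 / (b + real m) - 1 / (b + real (Suc m)))"
    proof -
      define y where "y = real (Suc m)"
      have y: "y \<ge> 1" by (simp add: y_def)
      have "?g (int (Suc m)) = b\<^sup>2 / (b\<^sup>2 + y\<^sup>2)"
        using b by (simp add: y_def field_simps power2_eq_square)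
      \<comment> \<open>The denominator is chosen for its partial fractions, which telescope.\<close>
      also have "\<dots> \<le> b\<^sup>2 / ((b + y) * (b + y - 1) / 2)"
      proof (rule divide_left_mono)
        have "0 \<le> (b - y)\<^sup>2" by simp
        then show "(b + y) * (b + y - 1) / 2 \<le> b\<^sup>2 + y\<^sup>2"
          using b y by (simp add: power2_eq_square algebra_simps)
        have "b\<^sup>2 + y\<^sup>2 > 0" using b by (simp add: add_pos_nonneg)
        then show "0 < (b\<^sup>2 + y\<^sup>2) * ((b + y) * (b + y - 1) / 2)"
          using b y by (intro mult_pos_pos) auto
      qed (use b in auto)
      also have "\<dots> = 2 * b\<^sup>2 * (1 / (b + y - 1) - 1 / (b + y))"
        using b y by (simp add: field_simps)
      finally show ?thesis by (simp add: y_def algebra_simps)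
    qed
    then show ?case using Suc by (simp add: algebra_simps)
  qed simp
  have "(\<Sum>y\<in>{-int M..int M}. ?g y) \<le> ?g 0 + 2 * (\<Sum>k=1..M. ?g (int k))"
  proof (induction M)
    case (Suc M)
    have "{-int (Suc M)..int (Suc M)} = insert (-int (Suc M)) (insert (int (Suc M)) {-int M..int M})"
      by auto
    then have "(\<Sum>y\<in>{-int (Suc M)..int (Suc M)}. ?g y)
        = ?g (-int (Suc M)) + (?g (int (Suc M)) + (\<Sum>y\<in>{-int M..int M}. ?g y))"
      by (simp del: of_nat_Suc)
    moreover have "?g (-int (Suc M)) = ?g (int (Suc M))" by (simp del: of_nat_Suc)
    ultimately show ?case using Suc by (simp del: of_nat_Suc)
  qed simp
  also have "\<dots> \<le> 1 + 2 * (2 * b\<^sup>2 * (1 / b))"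
  proof -
    have "2 * b\<^sup>2 * (1 / b - 1 / (b + real M)) \<le> 2 * b\<^sup>2 * (1 / b)"
      using b by (intro mult_left_mono) auto
    then show ?thesis using pos[of M] by simp
  qed
  also have "\<dots> \<le> 5 * b" using b by (simp add: power2_eq_square)
  finally show ?thesis .
qed

lemma one_plus_square_le_exp_powr:
  fixes z \<alpha> :: real
  assumes "0 < \<alpha>" "\<alpha> < 2" "z \<ge> 0"
  shows "1 + z\<^sup>2 \<le> exp (2 / \<alpha> * z powr \<alpha>)"
proof -
  have "1 + z\<^sup>2 \<le> (1 + z powr \<alpha>) powr (2 / \<alpha>)"
  proof -
    define t where "t = z powr \<alpha>"
    have t0: "t \<ge> 0" by (simp add: t_def)
    have "1 + t powr (2/\<alpha>) \<le> (1 + t) powr (2/\<alpha>)"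
    proof -
      define p where "p = 2/\<alpha>"
      have p: "p \<ge> 1" using assms by (simp add: p_def)
      have "(1 + t) powr p = (1 + t) * (1 + t) powr (p - 1)"
        using t0 by (simp add: powr_mult_base)
      also have "\<dots> = (1 + t) powr (p - 1) + t * (1 + t) powr (p - 1)" by (simp add: algebra_simps)
      also have "\<dots> \<ge> 1 + t * t powr (p - 1)"
        using t0 p by (intro add_mono mult_left_mono powr_mono2 ge_one_powr_ge_zero) auto
      also have "t * t powr (p - 1) = t powr p"
        using t0 by (simp add: powr_mult_base)
      finally show ?thesis by (simp add: p_def)
    qed
    moreover have "t powr (2/\<alpha>) = z\<^sup>2" using assms by (simp add: t_def powr_powr powr_numeral)
    ultimately show ?thesis by (simp add: t_def)
  qed
  also have "\<dots> \<le> exp (z powr \<alpha>) powr (2 / \<alpha>)"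
    using assms by (intro powr_mono2) (auto simp: add_nonneg_nonneg)
  also have "\<dots> = exp (2 / \<alpha> * z powr \<alpha>)" by (simp add: powr_def mult.commute)
  finally show ?thesis .
qed

text \<open>
  A point with \<open>(\<Sum>j<n. \<bar>q j\<bar> powr \<alpha>) \<le> B * n\<close> satisfies
  \<open>(\<Prod>j<n. 1 + (q j / B powr (1 / \<alpha>))\<^sup>2) \<le> exp (2 / \<alpha> * n)\<close>. Hence the points can be counted with the
  product weight of the reciprocal factors, whose sum over the lattice factorizes. The essential
  feature is the growth \<open>B powr (1 / \<alpha>)\<close> per coordinate, which becomes linear in \<open>\<Lambda>\<close>.
\<close>

lemma card_lattice_points_le:
  fixes \<alpha> B :: real and F :: "(nat \<Rightarrow> int) set" and n :: nat
  assumes \<alpha>: "0 < \<alpha>" "\<alpha> < 2" and B: "B \<ge> 1"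
  defines "F \<equiv> {q \<in> {..<n} \<rightarrow>\<^sub>E UNIV. (\<Sum>j<n. \<bar>real_of_int (q j)\<bar> powr \<alpha>) \<le> B * real n}"
  shows "finite F" and "real (card F) \<le> (5 * exp (2 / \<alpha>) * B powr (1 / \<alpha>)) ^ n"
proof -
  define b where "b = B powr (1 / \<alpha>)"
  have b: "b \<ge> 1" unfolding b_def using B \<alpha> by (intro ge_one_powr_ge_zero) auto
  have bB: "b powr \<alpha> = B" using \<alpha> B by (simp add: b_def powr_powr)
  define M where "M = nat \<lceil>(B * real n) powr (1 / \<alpha>)\<rceil>"
  have sub: "F \<subseteq> {..<n} \<rightarrow>\<^sub>E {-int M..int M}"
  proof
    fix q assume q: "q \<in> F"
    have "q j \<in> {-int M..int M}" if j: "j < n" for j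
    proof -
      have "\<bar>real_of_int (q j)\<bar> powr \<alpha> \<le> (\<Sum>j<n. \<bar>real_of_int (q j)\<bar> powr \<alpha>)"
        using j by (intro member_le_sum) auto
      also have "\<dots> \<le> B * real n" using q by (simp add: F_def)
      finally have "(\<bar>real_of_int (q j)\<bar> powr \<alpha>) powr (1/\<alpha>) \<le> (B * real n) powr (1/\<alpha>)"
        using \<alpha> by (intro powr_mono2) auto
      then have "\<bar>real_of_int (q j)\<bar> \<le> (B * real n) powr (1/\<alpha>)"
        using \<alpha> by (simp add: powr_powr)
      also have "\<dots> \<le> real M" unfolding M_def by (rule real_nat_ceiling_ge)
      finally show ?thesis by auto
    qed
    then show "q \<in> {..<n} \<rightarrow>\<^sub>E {-int M..int M}" using q by (auto simp: F_def PiE_iff)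
  qed
  have fin: "finite ({..<n} \<rightarrow>\<^sub>E {-int M..int M})" by (intro finite_PiE) auto
  show "finite F" using finite_subset[OF sub fin] .
  let ?g = "\<lambda>y::int. exp (2/\<alpha>) * (1 / (1 + (real_of_int y / b)\<^sup>2))"
  have g0: "?g y \<ge> 0" for y by (intro mult_nonneg_nonneg divide_nonneg_nonneg add_nonneg_nonneg) auto
  have "real (card F) = (\<Sum>q\<in>F. 1)" by simp
  also have "\<dots> \<le> (\<Sum>q\<in>F. \<Prod>j<n. ?g (q j))"
  proof (intro sum_mono)
    fix q assume q: "q \<in> F"
    have "(\<Prod>j<n. 1 + (real_of_int (q j) / b)\<^sup>2) \<le> (\<Prod>j<n. exp (2/\<alpha> * (\<bar>real_of_int (q j)\<bar> / b) powr \<alpha>))"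
    proof (intro prod_mono conjI)
      fix j
      show "1 + (real_of_int (q j) / b)\<^sup>2 \<le> exp (2/\<alpha> * (\<bar>real_of_int (q j)\<bar> / b) powr \<alpha>)"
        using one_plus_square_le_exp_powr[OF \<alpha>, of "\<bar>real_of_int (q j)\<bar> / b"] b
        by (simp add: power_divide)
    qed (auto intro: add_nonneg_nonneg)
    also have "\<dots> = exp (2/\<alpha> * ((\<Sum>j<n. \<bar>real_of_int (q j)\<bar> powr \<alpha>) / B))"
      using b by (simp add: powr_divide bB sum_divide_distrib sum_distrib_left flip: exp_sum)
    also have "\<dots> \<le> exp (2/\<alpha> * real n)"
      using q B \<alpha> by (auto simp: F_def field_simps)
    finally have le: "(\<Prod>j<n. 1 + (real_of_int (q j) / b)\<^sup>2) \<le> exp (2/\<alpha>) ^ n"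
      by (simp add: exp_of_nat_mult[symmetric] mult.commute)
    have pos: "(\<Prod>j<n. 1 + (real_of_int (q j) / b)\<^sup>2) > 0"
      by (intro prod_pos) (auto intro: add_pos_nonneg)
    have "(\<Prod>j<n. ?g (q j)) = exp (2/\<alpha>) ^ n / (\<Prod>j<n. 1 + (real_of_int (q j) / b)\<^sup>2)"
      by (simp add: prod_dividef)
    then show "1 \<le> (\<Prod>j<n. ?g (q j))" using le pos by simp
  qed
  also have "\<dots> \<le> (\<Sum>q\<in>{..<n} \<rightarrow>\<^sub>E {-int M..int M}. \<Prod>j<n. ?g (q j))"
    by (intro sum_mono2 fin sub prod_nonneg g0 ballI)
  also have "\<dots> = (\<Prod>j<n. \<Sum>y\<in>{-int M..int M}. ?g y)"
    by (rule prod_sum_PiE[symmetric]) auto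
  also have "\<dots> = (exp (2/\<alpha>) * (\<Sum>y\<in>{-int M..int M}. 1 / (1 + (real_of_int y / b)\<^sup>2))) ^ n"
    by (simp only: prod_constant card_lessThan sum_distrib_left)
  also have "\<dots> \<le> (exp (2/\<alpha>) * (5 * b)) ^ n"
    by (intro power_mono mult_left_mono sum_inverse_quadratic_le[OF b] mult_nonneg_nonneg sum_nonneg
        divide_nonneg_nonneg add_nonneg_nonneg) auto
  finally show "real (card F) \<le> (5 * exp (2 / \<alpha>) * B powr (1 / \<alpha>)) ^ n"
    by (simp add: b_def mult_ac)
qed

text \<open>
  The vector is first scaled down such that \<open>\<bar>w j\<bar> powr \<alpha>\<close> summed over the small coordinates equals
  \<open>8 * (\<Lambda> * r) powr \<alpha>\<close>. Scaling down does not increase \<open>\<parallel>X w\<parallel>\<close>, and it is what keeps the approximating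
  points in one fixed bounded region of the lattice. The large coordinates are harmless for the
  count: their \<open>\<alpha>\<close>-sum is at most \<open>\<kappa> powr (\<alpha> - 2)\<close>, which is comparable to that of the small ones.
  The relation between \<open>T\<close> and \<open>\<tau>\<close> says that the mesh contributes \<open>n * (r / T) powr \<alpha> = (\<tau> * r) powr \<alpha>\<close>,
  negligible against \<open>(\<Lambda> * r) powr \<alpha>\<close>.
\<close>

lemma delocalised_vector_has_lattice_approximation:
  fixes X :: "nat \<Rightarrow> nat \<Rightarrow> real" and u :: "nat \<Rightarrow> real"
  assumes \<alpha>: "0 < \<alpha>" "\<alpha> < 2" and pos: "r > 0" "T > 0" "\<kappa> > 0" "\<Lambda> \<ge> 1" "n > 0"
    and \<tau>: "0 < \<tau>" "\<tau> \<le> 1" "T powr \<alpha> = real n / \<tau> powr \<alpha>"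
    and h\<kappa>: "r / T \<le> \<kappa>"
    and u: "(\<Sum>j<n. (u j)\<^sup>2) = 1"
    and \<delta>: "0 < \<delta>" "\<delta> \<le> 1" "(\<Sum>j\<in>{j\<in>{..<n}. \<bar>u j\<bar> \<le> \<kappa>}. (u j)\<^sup>2) \<ge> \<delta>"
    and scale: "\<delta> * \<kappa> powr (\<alpha> - 2) \<ge> 8 * (\<Lambda> * r) powr \<alpha>"
    and S: "(\<Sum>i<N. \<Sum>j<n. min 1 ((X i j / T)\<^sup>2)) \<le> S"
    and R: "(\<Sum>i<N. (\<Sum>j<n. X i j * u j)\<^sup>2) \<le> R * r\<^sup>2"
    and B: "B = 68 * \<Lambda> powr \<alpha> / (\<delta> * \<tau> powr \<alpha>)"
  shows "\<exists>q :: nat \<Rightarrow> int. q \<in> {..<n} \<rightarrow>\<^sub>E UNIV \<and>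
    (\<Sum>j<n. \<bar>real_of_int (q j)\<bar> powr \<alpha>) \<le> B * real n \<and>
    (\<Lambda> * r) powr \<alpha> \<le> (\<Sum>j\<in>{j\<in>{..<n}. \<bar>r / T * q j\<bar> \<le> 2 * \<kappa>}. \<bar>r / T * q j\<bar> powr \<alpha>) \<and>
    real (card {i\<in>{..<N}. \<bar>\<Sum>j<n. X i j * (r / T * q j)\<bar> > 2 * r}) \<le> R + 2 * S"
proof -
  define h where "h = r / T"
  have h: "h > 0" using pos by (simp add: h_def)
  have h\<alpha>: "real n * h powr \<alpha> = (\<tau> * r) powr \<alpha>"
    using pos \<tau> by (simp add: h_def powr_divide powr_mult)
  define m where "m = 8 * (\<Lambda> * r) powr \<alpha>"
  have m: "m > 0" using pos by (simp add: m_def)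
  let ?Sm = "{j\<in>{..<n}. \<bar>u j\<bar> \<le> \<kappa>}"
  define p where "p = (\<Sum>j\<in>?Sm. \<bar>u j\<bar> powr \<alpha>)"
  have upow: "\<bar>t\<bar> powr \<alpha> = t\<^sup>2 * \<bar>t\<bar> powr (\<alpha> - 2)" for t :: real
  proof (cases "t = 0")
    case False
    then have sq: "t\<^sup>2 = \<bar>t\<bar> powr 2" by (simp add: powr_numeral)
    show ?thesis unfolding sq powr_add[symmetric] by simp
  qed simp
  have p\<delta>: "p \<ge> \<delta> * \<kappa> powr (\<alpha> - 2)"
  proof -
    have "\<delta> * \<kappa> powr (\<alpha> - 2) \<le> (\<Sum>j\<in>?Sm. (u j)\<^sup>2) * \<kappa> powr (\<alpha> - 2)"
      using \<delta>(3) by (intro mult_right_mono) auto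
    also have "\<dots> = (\<Sum>j\<in>?Sm. (u j)\<^sup>2 * \<kappa> powr (\<alpha> - 2))" by (simp add: sum_distrib_right)
    also have "\<dots> \<le> p" unfolding p_def
    proof (intro sum_mono)
      fix j assume j: "j \<in> ?Sm"
      show "(u j)\<^sup>2 * \<kappa> powr (\<alpha> - 2) \<le> \<bar>u j\<bar> powr \<alpha>"
      proof (cases "u j = 0")
        case False
        then have "\<kappa> powr (\<alpha> - 2) \<le> \<bar>u j\<bar> powr (\<alpha> - 2)"
          using j \<alpha> by (intro powr_mono2') auto
        then show ?thesis unfolding upow[of "u j"] by (intro mult_left_mono) auto
      qed simp
    qed
    finally show ?thesis .
  qed
  have p0: "p > 0" using p\<delta> \<delta>(1) pos by (smt (verit) mult_pos_pos powr_gt_zero)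
  have mp: "m \<le> p" using p\<delta> scale by (simp add: m_def)
  have big: "(\<Sum>j\<in>{..<n} - ?Sm. \<bar>u j\<bar> powr \<alpha>) \<le> p / \<delta>"
  proof -
    have "(\<Sum>j\<in>{..<n} - ?Sm. \<bar>u j\<bar> powr \<alpha>) \<le> (\<Sum>j\<in>{..<n} - ?Sm. (u j)\<^sup>2 * \<kappa> powr (\<alpha> - 2))"
      unfolding upow using pos \<alpha>
      by (intro sum_mono mult_left_mono powr_mono2') auto
    also have "\<dots> \<le> (\<Sum>j<n. (u j)\<^sup>2 * \<kappa> powr (\<alpha> - 2))"
      by (intro sum_mono2) auto
    also have "\<dots> = \<kappa> powr (\<alpha> - 2)" using u by (simp flip: sum_distrib_right)
    also have "\<dots> \<le> p / \<delta>" using p\<delta> \<delta>(1) by (simp add: field_simps)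
    finally show ?thesis .
  qed
  have all: "(\<Sum>j<n. \<bar>u j\<bar> powr \<alpha>) \<le> 2 * p / \<delta>"
  proof -
    have "(\<Sum>j<n. \<bar>u j\<bar> powr \<alpha>) = (\<Sum>j\<in>{..<n} - ?Sm. \<bar>u j\<bar> powr \<alpha>) + p"
      unfolding p_def by (rule sum.subset_diff) auto
    moreover have "p \<le> p / \<delta>" using p0 \<delta> by (simp add: field_simps)
    ultimately show ?thesis using big by simp
  qed
  \<comment> \<open>The scaling factor, at most 1 by the assumption on the scale.\<close>
  define \<mu> where "\<mu> = (m / p) powr (1 / \<alpha>)"
  have \<mu>: "\<mu> > 0" using m p0 by (simp add: \<mu>_def)
  have \<mu>1: "\<mu> \<le> 1" unfolding \<mu>_def using m p0 mp \<alpha> by (intro powr_le1) auto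
  have \<mu>\<alpha>: "\<mu> powr \<alpha> = m / p" using m p0 \<alpha> by (simp add: \<mu>_def powr_powr)
  define w where "w j = \<mu> * u j" for j
  have w\<alpha>: "\<bar>w j\<bar> powr \<alpha> = m / p * \<bar>u j\<bar> powr \<alpha>" for j
    using \<mu> by (simp add: w_def abs_mult powr_mult \<mu>\<alpha>)
  have wS: "(\<Sum>j\<in>?Sm. \<bar>w j\<bar> powr \<alpha>) = m"
  proof -
    have "(\<Sum>j\<in>?Sm. \<bar>w j\<bar> powr \<alpha>) = m / p * (\<Sum>j\<in>?Sm. \<bar>u j\<bar> powr \<alpha>)"
      unfolding w\<alpha> by (simp only: sum_distrib_left)
    then show ?thesis unfolding p_def[symmetric] using p0 by simp
  qed
  have wA: "(\<Sum>j<n. \<bar>w j\<bar> powr \<alpha>) \<le> 2 * m / \<delta>"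
  proof -
    have "(\<Sum>j<n. \<bar>w j\<bar> powr \<alpha>) = m / p * (\<Sum>j<n. \<bar>u j\<bar> powr \<alpha>)"
      unfolding w\<alpha> by (simp add: sum_distrib_left)
    also have "\<dots> \<le> m / p * (2 * p / \<delta>)" using m p0 by (intro mult_left_mono all) auto
    also have "\<dots> = 2 * m / \<delta>" using p0 by simp
    finally show ?thesis .
  qed
  have "(\<Sum>i<N. (\<Sum>j<n. X i j * w j)\<^sup>2) = \<mu>\<^sup>2 * (\<Sum>i<N. (\<Sum>j<n. X i j * u j)\<^sup>2)"
  proof -
    have eq: "(\<Sum>j<n. X i j * w j) = \<mu> * (\<Sum>j<n. X i j * u j)" for i
      unfolding sum_distrib_left by (intro sum.cong) (auto simp: w_def)
    show ?thesis unfolding eq power_mult_distrib by (rule sum_distrib_left[symmetric])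
  qed
  also have "\<dots> \<le> 1 * (\<Sum>i<N. (\<Sum>j<n. X i j * u j)\<^sup>2)"
    using \<mu> \<mu>1 by (intro mult_right_mono sum_nonneg) (auto simp: power_le_one)
  finally have Rw: "(\<Sum>i<N. (\<Sum>j<n. X i j * w j)\<^sup>2) \<le> R * r\<^sup>2" using R by simp
  obtain q0 :: "nat \<Rightarrow> int" where q0: "\<forall>j<n. \<bar>w j - r / T * q0 j\<bar> \<le> r / T"
    "real (card {i\<in>{..<N}. \<bar>\<Sum>j<n. X i j * (r / T * q0 j)\<bar> > 2 * r}) \<le> R + 2 * S"
    using lattice_approximation[OF pos(1,2) S Rw] by (elim exE conjE)
  define q where "q = restrict q0 {..<n}"
  have q: "q \<in> {..<n} \<rightarrow>\<^sub>E UNIV" by (simp add: q_def)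
  have wq: "\<bar>w j - h * q j\<bar> \<le> h" if "j < n" for j using q0(1) that by (simp add: q_def h_def)
  have bad: "real (card {i\<in>{..<N}. \<bar>\<Sum>j<n. X i j * (h * q j)\<bar> > 2 * r}) \<le> R + 2 * S"
  proof -
    have "(\<Sum>j<n. X i j * (h * q j)) = (\<Sum>j<n. X i j * (r / T * q0 j))" for i
      by (intro sum.cong) (auto simp: q_def h_def)
    then show ?thesis using q0(2) by simp
  qed
  have powr_add_le: "(s + t) powr \<alpha> \<le> 4 * s powr \<alpha> + 4 * t powr \<alpha>" if "s \<ge> 0" "t \<ge> 0" for s t :: real
  proof -
    have four: "2 powr \<alpha> \<le> 4" using powr_mono[of \<alpha> 2 2] \<alpha> by simp
    have "(s + t) powr \<alpha> \<le> (2 * max s t) powr \<alpha>"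
      using that \<alpha> by (intro powr_mono2) auto
    also have "\<dots> = 2 powr \<alpha> * max s t powr \<alpha>" using that by (simp add: powr_mult)
    also have "\<dots> \<le> 4 * max s t powr \<alpha>" by (intro mult_right_mono four) auto
    also have "\<dots> \<le> 4 * s powr \<alpha> + 4 * t powr \<alpha>" by (simp add: max_def)
    finally show ?thesis .
  qed
  have 1: "(\<Sum>j<n. \<bar>real_of_int (q j)\<bar> powr \<alpha>) \<le> B * real n"
  proof -
    have "h powr \<alpha> * (\<Sum>j<n. \<bar>real_of_int (q j)\<bar> powr \<alpha>) = (\<Sum>j<n. \<bar>h * q j\<bar> powr \<alpha>)"
      using h by (simp add: sum_distrib_left abs_mult powr_mult)
    also have "\<dots> \<le> (\<Sum>j<n. 4 * \<bar>w j\<bar> powr \<alpha> + 4 * h powr \<alpha>)"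
    proof (intro sum_mono)
      fix j assume "j \<in> {..<n}"
      then have "\<bar>h * q j\<bar> \<le> \<bar>w j\<bar> + h" using wq[of j] by auto
      then have "\<bar>h * q j\<bar> powr \<alpha> \<le> (\<bar>w j\<bar> + h) powr \<alpha>" using \<alpha> by (intro powr_mono2) auto
      also have "\<dots> \<le> 4 * \<bar>w j\<bar> powr \<alpha> + 4 * h powr \<alpha>" using h by (intro powr_add_le) auto
      finally show "\<bar>h * q j\<bar> powr \<alpha> \<le> 4 * \<bar>w j\<bar> powr \<alpha> + 4 * h powr \<alpha>" .
    qed
    also have "\<dots> = 4 * (\<Sum>j<n. \<bar>w j\<bar> powr \<alpha>) + 4 * (real n * h powr \<alpha>)"
      by (simp add: sum.distrib sum_distrib_left)
    also have "\<dots> \<le> 4 * (2 * m / \<delta>) + 4 * (real n * h powr \<alpha>)" using wA by simp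
    also have "\<dots> = 64 * (\<Lambda> powr \<alpha> / (\<delta> * \<tau> powr \<alpha>)) * (real n * h powr \<alpha>) + 4 * (real n * h powr \<alpha>)"
      unfolding h\<alpha> using pos \<tau> by (simp add: m_def powr_mult)
    also have "\<dots> \<le> 64 * (\<Lambda> powr \<alpha> / (\<delta> * \<tau> powr \<alpha>)) * (real n * h powr \<alpha>)
        + 4 * (\<Lambda> powr \<alpha> / (\<delta> * \<tau> powr \<alpha>)) * (real n * h powr \<alpha>)"
    proof -
      have "\<delta> * \<tau> powr \<alpha> \<le> 1 * 1" using \<delta> \<tau> \<alpha> by (intro mult_mono powr_le1) auto
      also have "1 * 1 \<le> \<Lambda> powr \<alpha>" using pos \<alpha> by (simp add: ge_one_powr_ge_zero)
      finally have "1 \<le> \<Lambda> powr \<alpha> / (\<delta> * \<tau> powr \<alpha>)" using \<delta> \<tau> by (simp add: field_simps)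
      then have "4 * 1 * (real n * h powr \<alpha>) \<le> 4 * (\<Lambda> powr \<alpha> / (\<delta> * \<tau> powr \<alpha>)) * (real n * h powr \<alpha>)"
        by (intro mult_right_mono mult_left_mono) auto
      then show ?thesis by linarith
    qed
    also have "\<dots> = h powr \<alpha> * (B * real n)" by (simp add: B field_simps)
    finally show ?thesis using h by simp
  qed
  have 2: "(\<Lambda> * r) powr \<alpha> \<le> (\<Sum>j\<in>{j\<in>{..<n}. \<bar>h * q j\<bar> \<le> 2 * \<kappa>}. \<bar>h * q j\<bar> powr \<alpha>)"
  proof -
    have "m \<le> (\<Sum>j\<in>?Sm. 4 * \<bar>h * q j\<bar> powr \<alpha> + 4 * h powr \<alpha>)"
      unfolding wS[symmetric]
    proof (intro sum_mono)
      fix j assume "j \<in> ?Sm"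
      then have "\<bar>w j\<bar> \<le> \<bar>h * q j\<bar> + h" using wq[of j] by auto
      then have "\<bar>w j\<bar> powr \<alpha> \<le> (\<bar>h * q j\<bar> + h) powr \<alpha>" using \<alpha> by (intro powr_mono2) auto
      also have "\<dots> \<le> 4 * \<bar>h * q j\<bar> powr \<alpha> + 4 * h powr \<alpha>" using h by (intro powr_add_le) auto
      finally show "\<bar>w j\<bar> powr \<alpha> \<le> 4 * \<bar>h * q j\<bar> powr \<alpha> + 4 * h powr \<alpha>" .
    qed
    also have "\<dots> \<le> 4 * (\<Sum>j\<in>?Sm. \<bar>h * q j\<bar> powr \<alpha>) + 4 * (real n * h powr \<alpha>)"
    proof -
      have "card ?Sm \<le> card {..<n}" by (intro card_mono) auto
      then have "real (card ?Sm) \<le> real n" by simp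
      then show ?thesis by (simp add: sum.distrib sum_distrib_left mult_right_mono)
    qed
    also have "real n * h powr \<alpha> \<le> (\<Lambda> * r) powr \<alpha>"
      unfolding h\<alpha> using \<tau> pos \<alpha> by (intro powr_mono2 mult_right_mono) auto
    finally have "(\<Lambda> * r) powr \<alpha> \<le> (\<Sum>j\<in>?Sm. \<bar>h * q j\<bar> powr \<alpha>)" by (simp add: m_def)
    also have "\<dots> \<le> (\<Sum>j\<in>{j\<in>{..<n}. \<bar>h * q j\<bar> \<le> 2 * \<kappa>}. \<bar>h * q j\<bar> powr \<alpha>)"
    proof (intro sum_mono2 subsetI)
      fix j assume j: "j \<in> ?Sm"
      have "\<bar>w j\<bar> \<le> 1 * \<bar>u j\<bar>" unfolding w_def abs_mult using \<mu> \<mu>1 by (intro mult_right_mono) auto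
      then have "\<bar>h * q j\<bar> \<le> \<kappa> + h" using wq[of j] j by auto
      then show "j \<in> {j\<in>{..<n}. \<bar>h * q j\<bar> \<le> 2 * \<kappa>}" using j h\<kappa> by (auto simp: h_def)
    qed auto
    finally show ?thesis .
  qed
  show ?thesis using q 1 2 bad unfolding h_def by blast
qed

section \<open>Exponential tail bounds\<close>

lemma (in prob_space) exponential_moment_tail:
  fixes Z :: "'i \<Rightarrow> 'a \<Rightarrow> real"
  assumes I: "finite I" and ind: "indep_vars (\<lambda>_. borel) Z I"
    and int: "\<And>i. i \<in> I \<Longrightarrow> integrable M (\<lambda>\<omega>. exp (Z i \<omega>))"
    and m: "\<And>i. i \<in> I \<Longrightarrow> expectation (\<lambda>\<omega>. exp (Z i \<omega>)) \<le> m"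
  shows "prob {\<omega>\<in>space M. (\<Sum>i\<in>I. Z i \<omega>) \<ge> x} \<le> m ^ card I * exp (- x)"
proof -
  have rv: "Z i \<in> borel_measurable M" if "i \<in> I" for i
    using ind that by (auto simp: indep_vars_def)
  have ind': "indep_vars (\<lambda>_. borel) (\<lambda>i \<omega>. exp (Z i \<omega>)) I"
    by (rule indep_vars_compose2[OF ind]) auto
  have intP: "integrable M (\<lambda>\<omega>. exp (\<Sum>i\<in>I. Z i \<omega>))"
    unfolding exp_sum[OF I] by (rule indep_vars_integrable[OF I ind' int])
  have "expectation (\<lambda>\<omega>. exp (\<Sum>i\<in>I. Z i \<omega>)) = (\<Prod>i\<in>I. expectation (\<lambda>\<omega>. exp (Z i \<omega>)))"
    unfolding exp_sum[OF I] by (rule indep_vars_lebesgue_integral[OF I ind' int])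
  also have "\<dots> \<le> (\<Prod>i\<in>I. m)" by (intro prod_mono conjI m) auto
  finally have E: "expectation (\<lambda>\<omega>. exp (\<Sum>i\<in>I. Z i \<omega>)) \<le> m ^ card I" by simp
  have [measurable]: "(\<lambda>\<omega>. \<Sum>i\<in>I. Z i \<omega>) \<in> borel_measurable M" by (intro borel_measurable_sum rv)
  have "prob {\<omega>\<in>space M. (\<Sum>i\<in>I. Z i \<omega>) \<ge> x} = prob {\<omega>\<in>space M. exp (\<Sum>i\<in>I. Z i \<omega>) \<ge> exp x}"
    by simp
  also have "\<dots> \<le> expectation (\<lambda>\<omega>. exp (\<Sum>i\<in>I. Z i \<omega>)) / exp x"
    by (rule integral_Markov_inequality_measure[OF intP, where A="space M"]) auto
  also have "\<dots> \<le> m ^ card I / exp x" by (intro divide_right_mono E) simp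
  finally show ?thesis by (simp add: exp_minus field_simps)
qed

lemma (in prob_space) sum_unit_interval_upper_tail:
  fixes Z :: "'i \<Rightarrow> 'a \<Rightarrow> real"
  assumes I: "finite I" and ind: "indep_vars (\<lambda>_. borel) Z I"
    and Z: "\<And>i \<omega>. i \<in> I \<Longrightarrow> 0 \<le> Z i \<omega> \<and> Z i \<omega> \<le> 1"
    and p: "\<And>i. i \<in> I \<Longrightarrow> expectation (Z i) \<le> p"
  shows "prob {\<omega>\<in>space M. (\<Sum>i\<in>I. Z i \<omega>) \<ge> x} \<le> exp (2 * p * card I - x)"
proof (cases "I = {}")
  case True
  then show ?thesis by (cases "x \<le> 0") (auto simp: prob_space)
next
  case False
  have rv[measurable]: "Z i \<in> borel_measurable M" if "i \<in> I" for i
    using ind that by (auto simp: indep_vars_def)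
  have intZ: "integrable M (Z i)" if "i \<in> I" for i
    by (rule integrable_const_bound[of _ 1]) (use Z rv that in auto)
  have "expectation (Z i) \<ge> 0" if "i \<in> I" for i using Z that by (intro Bochner_Integration.integral_nonneg) auto
  then have p0: "p \<ge> 0" using p False by (meson all_not_in_conv order_trans)
  have ez: "exp z \<le> 1 + 2 * z" if "0 \<le> z" "z \<le> 1" for z :: real
  proof -
    have "exp z \<le> 1 + z + z\<^sup>2" using that by (rule exp_bound)
    also have "z\<^sup>2 \<le> z" using that by (simp add: power2_eq_square mult_left_le)
    finally show ?thesis by simp
  qed
  have "prob {\<omega>\<in>space M. (\<Sum>i\<in>I. Z i \<omega>) \<ge> x} \<le> exp (2 * p) ^ card I * exp (- x)"
  proof (rule exponential_moment_tail[OF I ind])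
    fix i assume i: "i \<in> I"
    show int: "integrable M (\<lambda>\<omega>. exp (Z i \<omega>))"
      by (rule integrable_const_bound[of _ "exp 1"]) (use Z rv i in auto)
    have "expectation (\<lambda>\<omega>. exp (Z i \<omega>)) \<le> expectation (\<lambda>\<omega>. 1 + 2 * Z i \<omega>)"
      by (rule integral_mono) (use int intZ i Z ez in auto)
    also have "\<dots> = 1 + 2 * expectation (Z i)"
      using intZ[OF i] by (simp add: prob_space)
    also have "\<dots> \<le> 1 + 2 * p" using p[OF i] by simp
    also have "\<dots> \<le> exp (2 * p)" using p0 by (simp add: exp_ge_add_one_self add.commute)
    finally show "expectation (\<lambda>\<omega>. exp (Z i \<omega>)) \<le> exp (2 * p)" .
  qed
  also have "\<dots> = exp (2 * p * card I - x)"
    unfolding exp_of_nat_mult[symmetric] exp_add[symmetric] by (simp add: mult.commute)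
  finally show ?thesis .
qed

lemma (in prob_space) sum_unit_interval_lower_tail:
  fixes Z :: "'i \<Rightarrow> 'a \<Rightarrow> real"
  assumes I: "finite I" and ind: "indep_vars (\<lambda>_. borel) Z I"
    and Z: "\<And>i \<omega>. i \<in> I \<Longrightarrow> 0 \<le> Z i \<omega> \<and> Z i \<omega> \<le> 1"
    and p: "\<And>i. i \<in> I \<Longrightarrow> expectation (Z i) \<ge> p"
  shows "prob {\<omega>\<in>space M. (\<Sum>i\<in>I. Z i \<omega>) \<le> x} \<le> exp (x - p * card I / 2)"
proof -
  have rv[measurable]: "Z i \<in> borel_measurable M" if "i \<in> I" for i
    using ind that by (auto simp: indep_vars_def)
  have intZ: "integrable M (Z i)" if "i \<in> I" for i
    by (rule integrable_const_bound[of _ 1]) (use Z rv that in auto)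
  have ez: "exp (- z) \<le> 1 - z / 2" if "0 \<le> z" "z \<le> 1" for z :: real
  proof -
    have "(1 - z / 2) * (1 + z) \<ge> 1" using that by (simp add: field_simps mult_left_le)
    moreover have "1 + z \<le> exp z" by (rule exp_ge_add_one_self)
    ultimately have "(1 - z / 2) * exp z \<ge> 1"
      using that by (smt (verit) mult_left_mono field_sum_of_halves)
    then show ?thesis by (simp add: exp_minus field_simps)
  qed
  have ind': "indep_vars (\<lambda>_. borel) (\<lambda>i \<omega>. - Z i \<omega>) I"
    by (rule indep_vars_compose2[OF ind]) auto
  have "prob {\<omega>\<in>space M. (\<Sum>i\<in>I. Z i \<omega>) \<le> x} = prob {\<omega>\<in>space M. (\<Sum>i\<in>I. - Z i \<omega>) \<ge> - x}"
    by (simp add: sum_negf)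
  also have "\<dots> \<le> exp (- p / 2) ^ card I * exp (- (- x))"
  proof (rule exponential_moment_tail[OF I ind'])
    fix i assume i: "i \<in> I"
    show int: "integrable M (\<lambda>\<omega>. exp (- Z i \<omega>))"
      by (rule integrable_const_bound[of _ 1]) (use Z rv i in auto)
    have "expectation (\<lambda>\<omega>. exp (- Z i \<omega>)) \<le> expectation (\<lambda>\<omega>. 1 - Z i \<omega> / 2)"
      by (rule integral_mono) (use int intZ i Z ez in auto)
    also have "\<dots> = 1 - expectation (Z i) / 2"
      using intZ[OF i] by (simp add: prob_space)
    also have "\<dots> \<le> 1 + (- p / 2)" using p[OF i] by simp
    also have "\<dots> \<le> exp (- p / 2)" by (rule exp_ge_add_one_self)
    finally show "expectation (\<lambda>\<omega>. exp (- Z i \<omega>)) \<le> exp (- p / 2)" .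
  qed
  also have "\<dots> = exp (x - p * card I / 2)"
    unfolding exp_of_nat_mult[symmetric] exp_add[symmetric] by (simp add: mult.commute)
  finally show ?thesis .
qed

text \<open>
  The exponential moment of \<open>ln q\<close> times the number of exceedances; with this choice of the exponent
  the small and the large values contribute at most \<open>q\<close> each.
\<close>

lemma (in prob_space) few_large_values_prob_le:
  fixes Y :: "'i \<Rightarrow> 'a \<Rightarrow> real"
  assumes I: "finite I" and ind: "indep_vars (\<lambda>_. borel) Y I"
    and q: "0 < q" "q < 1" "\<And>i. i \<in> I \<Longrightarrow> prob {\<omega>\<in>space M. \<bar>Y i \<omega>\<bar> \<le> s} \<le> q"
  shows "prob {\<omega>\<in>space M. real (card {i\<in>I. \<bar>Y i \<omega>\<bar> > s}) \<le> x} \<le> (2 * q) ^ card I * q powr (- x)"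
proof -
  have rv[measurable]: "Y i \<in> borel_measurable M" if "i \<in> I" for i
    using ind that by (auto simp: indep_vars_def)
  define Z where "Z i \<omega> = ln q * indicator {y. \<bar>y\<bar> > s} (Y i \<omega>)" for i \<omega>
  have expZ: "exp (Z i \<omega>) = indicator {y. \<bar>y\<bar> \<le> s} (Y i \<omega>) + q * indicator {y. \<bar>y\<bar> > s} (Y i \<omega>)" for i \<omega>
    using q(1) by (auto simp: Z_def indicator_def)
  have ind': "indep_vars (\<lambda>_. borel) Z I"
    unfolding Z_def by (rule indep_vars_compose2[OF ind]) measurable
  have sumZ: "(\<Sum>i\<in>I. Z i \<omega>) = ln q * card {i\<in>I. \<bar>Y i \<omega>\<bar> > s}" for \<omega>
    using I by (simp add: Z_def sum_distrib_left[symmetric] indicator_def sum.If_cases Int_def conj_commute)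
  have lq: "ln q < 0" using q by simp
  have "prob {\<omega>\<in>space M. real (card {i\<in>I. \<bar>Y i \<omega>\<bar> > s}) \<le> x}
      = prob {\<omega>\<in>space M. (\<Sum>i\<in>I. Z i \<omega>) \<ge> ln q * x}"
    using lq by (simp add: sumZ)
  also have "\<dots> \<le> (2 * q) ^ card I * exp (- (ln q * x))"
  proof (rule exponential_moment_tail[OF I ind'])
    fix i assume i: "i \<in> I"
    note rv[OF i, measurable]
    have i1: "integrable M (\<lambda>\<omega>. indicator {y. \<bar>y\<bar> \<le> s} (Y i \<omega>) :: real)"
      by (rule integrable_const_bound[of _ 1]) (auto simp: indicator_def)
    have i2: "integrable M (\<lambda>\<omega>. q * indicator {y. \<bar>y\<bar> > s} (Y i \<omega>))"
      by (rule integrable_const_bound[of _ q]) (use q in \<open>auto simp: indicator_def\<close>)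
    show "integrable M (\<lambda>\<omega>. exp (Z i \<omega>))"
      unfolding expZ using i1 i2 by (rule Bochner_Integration.integrable_add)
    have "expectation (\<lambda>\<omega>. indicator {y. \<bar>y\<bar> \<le> s} (Y i \<omega>) :: real)
        = expectation (indicator {\<omega>\<in>space M. \<bar>Y i \<omega>\<bar> \<le> s})"
      by (intro Bochner_Integration.integral_cong) (auto simp: indicator_def)
    also have "\<dots> = prob {\<omega>\<in>space M. \<bar>Y i \<omega>\<bar> \<le> s}" by simp
    finally have e1: "expectation (\<lambda>\<omega>. indicator {y. \<bar>y\<bar> \<le> s} (Y i \<omega>) :: real) \<le> q"
      using q(3)[OF i] by simp
    have "expectation (\<lambda>\<omega>. q * indicator {y. \<bar>y\<bar> > s} (Y i \<omega>)) \<le> expectation (\<lambda>\<omega>. q)"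
      by (rule integral_mono[OF i2]) (use q in \<open>auto simp: indicator_def\<close>)
    then have e2: "expectation (\<lambda>\<omega>. q * indicator {y. \<bar>y\<bar> > s} (Y i \<omega>)) \<le> q"
      by (simp add: prob_space)
    show "expectation (\<lambda>\<omega>. exp (Z i \<omega>)) \<le> 2 * q"
      unfolding expZ Bochner_Integration.integral_add[OF i1 i2] using e1 e2 by simp
  qed
  also have "exp (- (ln q * x)) = q powr (- x)" using q by (simp add: powr_def mult.commute)
  finally show ?thesis .
qed

section \<open>Heavy-tailed laws\<close>

text \<open>
  Halving \<open>T\<close> costs the tail probability at \<open>T / 2\<close> and gains a factor \<open>1 / 4\<close> in the truncated moment.
  Since \<open>2 powr \<alpha> < 4\<close>, the bound is reproduced by this recursion.
\<close>

lemma heavy_tailed_truncated_second_moment: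
  assumes D: "real_distribution D" and ht: "heavy_tailed D \<alpha> Cl Cu T0"
    and \<alpha>: "0 < \<alpha>" "\<alpha> < 2" and pos: "Cu > 0" "T0 > 0"
  shows "\<exists>C>0. \<forall>T\<ge>T0. (\<integral>x. min 1 ((x / T)\<^sup>2) \<partial>D) \<le> C * T powr (-\<alpha>)"
proof -
  interpret D: real_distribution D by fact
  define f where "f T = (\<integral>x. min 1 ((x / T)\<^sup>2) \<partial>D)" for T
  have int: "integrable D (\<lambda>x. min 1 ((x / T)\<^sup>2))" for T
    by (rule D.integrable_const_bound[of _ 1]) auto
  have f1: "f T \<le> 1" for T
    unfolding f_def by (rule D.integral_le_const[OF int]) auto
  have two: "(2::real) powr \<alpha> < 4"
    using powr_less_mono[of \<alpha> 2 2] \<alpha> by simp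
  define C where "C = max ((2 * T0) powr \<alpha>) (Cu * 2 powr \<alpha> / (1 - 2 powr \<alpha> / 4))"
  have C: "(2 * T0) powr \<alpha> \<le> C" "Cu * 2 powr \<alpha> / (1 - 2 powr \<alpha> / 4) \<le> C"
    by (simp_all add: C_def)
  have C2: "Cu * 2 powr \<alpha> + C * (2 powr \<alpha> / 4) \<le> C"
    using C(2) two by (simp add: field_simps)
  have "C > 0" by (rule less_le_trans[OF _ C(1)]) (use pos in simp)
  have rec: "f T \<le> measure D {y. \<bar>y\<bar> > T / 2} + f (T / 2) / 4" if T: "T > 0" for T
  proof -
    have ind: "integrable D (indicator {y. \<bar>y\<bar> > T / 2} :: real \<Rightarrow> real)"
      by (rule D.integrable_const_bound[of _ 1]) (auto simp: indicator_def)
    have "f T \<le> (\<integral>x. indicator {y. \<bar>y\<bar> > T / 2} x + min 1 ((x / (T/2))\<^sup>2) / 4 \<partial>D)"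
      unfolding f_def
    proof (rule integral_mono[OF int])
      show "integrable D (\<lambda>x. indicator {y. \<bar>y\<bar> > T / 2} x + min 1 ((x / (T/2))\<^sup>2) / 4 :: real)"
        using ind int[of "T/2"] by (intro Bochner_Integration.integrable_add integrable_divide) auto
      fix x :: real
      show "min 1 ((x / T)\<^sup>2) \<le> indicator {y. \<bar>y\<bar> > T / 2} x + min 1 ((x / (T/2))\<^sup>2) / 4"
      proof (cases "\<bar>x\<bar> > T / 2")
        case True
        then have "indicator {y. \<bar>y\<bar> > T / 2} x = (1 :: real)" by simp
        moreover have "min 1 ((x / T)\<^sup>2) \<le> 1" "0 \<le> min 1 ((x / (T/2))\<^sup>2) / 4" by simp_all
        ultimately show ?thesis by linarith
      next
        case False
        then have "\<bar>x / (T/2)\<bar> \<le> 1" using T by (simp add: field_simps)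
        then have "(x / (T/2))\<^sup>2 \<le> 1" by (metis abs_le_square_iff abs_one power_one)
        then have "min 1 ((x / (T/2))\<^sup>2) = (x / (T/2))\<^sup>2" by simp
        moreover have "(x / (T/2))\<^sup>2 / 4 = (x / T)\<^sup>2" by (simp add: power_divide)
        moreover have "min 1 ((x / T)\<^sup>2) \<le> (x / T)\<^sup>2" by simp
        moreover have "indicator {y. \<bar>y\<bar> > T / 2} x \<ge> (0 :: real)" by simp
        ultimately show ?thesis by linarith
      qed
    qed
    also have "\<dots> = measure D {y. \<bar>y\<bar> > T / 2} + f (T / 2) / 4"
      using ind int[of "T/2"] unfolding f_def by simp
    finally show ?thesis .
  qed
  have "f T \<le> C * T powr (-\<alpha>)" if "T \<ge> T0" "T < 2 ^ n * (2 * T0)" for n T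
    using that
  proof (induction n arbitrary: T)
    case 0
    have "1 = (2 * T0) powr \<alpha> * (2 * T0) powr (-\<alpha>)" using pos by (simp add: powr_minus)
    also have "\<dots> \<le> C * T powr (-\<alpha>)"
      using C(1) 0 pos \<alpha> by (intro mult_mono powr_mono2') (auto intro: order_trans[OF powr_ge_zero])
    finally show ?case using f1[of T] by simp
  next
    case (Suc n)
    show ?case
    proof (cases "T < 2 * T0")
      case True
      have "1 = (2 * T0) powr \<alpha> * (2 * T0) powr (-\<alpha>)" using pos by (simp add: powr_minus)
      also have "\<dots> \<le> C * T powr (-\<alpha>)"
        using C(1) Suc.prems True pos \<alpha> by (intro mult_mono powr_mono2') (auto intro: order_trans[OF powr_ge_zero])
      finally show ?thesis using f1[of T] by simp
    next
      case False
      then have T: "T / 2 \<ge> T0" "T > 0" using pos by auto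
      have half: "(T / 2) powr (-\<alpha>) = 2 powr \<alpha> * T powr (-\<alpha>)"
        using T by (simp add: powr_divide powr_minus field_simps)
      have "f T \<le> measure D {y. \<bar>y\<bar> > T / 2} + f (T / 2) / 4" by (rule rec[OF T(2)])
      also have "\<dots> \<le> Cu * (T / 2) powr (-\<alpha>) + C * (T / 2) powr (-\<alpha>) / 4"
      proof (intro add_mono divide_right_mono)
        show "measure D {y. \<bar>y\<bar> > T / 2} \<le> Cu * (T / 2) powr (-\<alpha>)"
          using ht T(1) unfolding heavy_tailed_def by blast
        show "f (T / 2) \<le> C * (T / 2) powr (-\<alpha>)"
          using T Suc.prems by (intro Suc.IH) auto
      qed simp
      also have "\<dots> = (Cu * 2 powr \<alpha> + C * (2 powr \<alpha> / 4)) * T powr (-\<alpha>)"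
        unfolding half by (simp add: algebra_simps)
      also have "\<dots> \<le> C * T powr (-\<alpha>)" by (intro mult_right_mono C2) auto
      finally show ?thesis .
    qed
  qed
  note dyadic = this
  have "f T \<le> C * T powr (-\<alpha>)" if "T \<ge> T0" for T
  proof -
    obtain n where "T / (2 * T0) < 2 ^ n" using real_arch_pow[of 2 "T / (2 * T0)"] by auto
    then have "T < 2 ^ n * (2 * T0)" using pos by (simp add: field_simps)
    then show ?thesis by (rule dyadic[OF that])
  qed
  then show ?thesis using \<open>C > 0\<close> unfolding f_def by (intro exI[of _ C]) simp
qed

text \<open>
  By symmetry the characteristic function is the mean of \<open>cos (t * x)\<close>. The two-sided tail bound puts
  mass of order \<open>\<bar>t\<bar> powr \<alpha>\<close> on \<open>pi / (L * \<bar>t\<bar>) < \<bar>x\<bar> \<le> pi / \<bar>t\<bar>\<close> when \<open>L\<close> is large, and there the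
  cosine is bounded away from \<open>1\<close>. Continuity at \<open>0\<close> makes the function positive near \<open>0\<close>, so the
  bound passes to its modulus.
\<close>

lemma symmetric_heavy_tailed_char_decay:
  assumes D: "real_distribution D" and ht: "heavy_tailed D \<alpha> Cl Cu T0"
    and sym: "symmetrically_distributed D"
    and \<alpha>: "0 < \<alpha>" and pos: "Cl > 0" "Cu > 0" "T0 > 0"
  shows "\<exists>c t0. c > 0 \<and> t0 > 0 \<and> (\<forall>t. \<bar>t\<bar> \<le> t0 \<longrightarrow> cmod (char D t) \<le> exp (- c * \<bar>t\<bar> powr \<alpha>))"
proof -
  interpret D: real_distribution D by fact
  have intc: "integrable D (\<lambda>x. cos (t * x))" and ints: "integrable D (\<lambda>x. sin (t * x))" for t
    by (rule D.integrable_const_bound[of _ 1]; auto)+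
  have inte: "integrable D (\<lambda>x. iexp (t * x))" for t
    by (rule D.integrable_const_bound[of _ 1]) auto
  have "(\<integral>x. sin (t * x) \<partial>D) = (\<integral>x. sin (t * x) \<partial>distr D borel uminus)" for t
    using sym by (simp add: symmetrically_distributed_def)
  also have "(\<integral>x. sin (t * x) \<partial>distr D borel uminus) = - (\<integral>x. sin (t * x) \<partial>D)" for t
    by (subst integral_distr) auto
  finally have sin0: "(\<integral>x. sin (t * x) \<partial>D) = 0" for t by simp
  have Re: "Re (char D t) = (\<integral>x. cos (t * x) \<partial>D)" for t
    unfolding char_def using inte[of t] by (subst integral_Re[symmetric]) (auto simp: Re_exp)
  have Im: "Im (char D t) = 0" for t
    unfolding char_def using inte[of t] sin0[of t] by (subst integral_Im[symmetric]) (auto simp: Im_exp)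
  \<comment> \<open>With this ratio the lower tail bound at \<open>u / L\<close> is twice the upper tail bound at \<open>u\<close>.\<close>
  define L where "L = (2 * Cu / Cl) powr (1/\<alpha>)"
  have L\<alpha>: "Cl * L powr \<alpha> = 2 * Cu"
    using pos \<alpha> by (simp add: L_def powr_powr)
  have "Cl * T0 powr (-\<alpha>) \<le> Cu * T0 powr (-\<alpha>)"
    using ht unfolding heavy_tailed_def by (meson order_refl order_trans)
  then have "Cl \<le> Cu" using pos by simp
  then have L1: "L > 1" unfolding L_def using pos \<alpha> by (intro gr_one_powr) (auto simp: field_simps)
  define e where "e = 1 - cos (pi / L)"
  have e: "e > 0"
    using cos_monotone_0_pi[of 0 "pi / L"] L1 by (simp add: e_def field_simps)
  define c where "c = e * Cu * pi powr (-\<alpha>)"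
  have c: "c > 0" using e pos by (simp add: c_def)
  define t1 where "t1 = pi / (L * T0)"
  have t1: "t1 > 0" using L1 pos by (simp add: t1_def)
  have main: "Re (char D t) \<le> 1 - c * \<bar>t\<bar> powr \<alpha>" if t: "t \<noteq> 0" "\<bar>t\<bar> \<le> t1" for t
  proof -
    define u where "u = pi / \<bar>t\<bar>"
    have u: "u > 0" using t by (simp add: u_def)
    have uL: "u / L \<ge> T0"
      using t L1 pos by (simp add: u_def t1_def field_simps)
    moreover have "u / L \<le> u" using u L1 by (simp add: field_simps)
    ultimately have u2: "u \<ge> T0" by simp
    define A where "A = {x. u / L < \<bar>x\<bar> \<and> \<bar>x\<bar> \<le> u}"
    have [measurable]: "A \<in> sets borel" by (simp add: A_def)
    have "measure D A = measure D ({x. \<bar>x\<bar> > u / L} - {x. \<bar>x\<bar> > u})"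
      by (rule arg_cong[of _ _ "measure D"]) (auto simp: A_def)
    also have "\<dots> = measure D {x. \<bar>x\<bar> > u / L} - measure D {x. \<bar>x\<bar> > u}"
      by (rule D.finite_measure_Diff) (use \<open>u / L \<le> u\<close> in auto)
    also have "\<dots> \<ge> Cl * (u / L) powr (-\<alpha>) - Cu * u powr (-\<alpha>)"
      using ht uL u2 unfolding heavy_tailed_def by (intro diff_mono) auto
    also have "Cl * (u / L) powr (-\<alpha>) - Cu * u powr (-\<alpha>) = Cu * u powr (-\<alpha>)"
    proof -
      have "Cl * (u / L) powr (-\<alpha>) = (Cl * L powr \<alpha>) * u powr (-\<alpha>)"
        using u L1 by (simp add: powr_divide powr_minus field_simps)
      then show ?thesis unfolding L\<alpha> by simp
    qed
    finally have mA: "measure D A \<ge> Cu * u powr (-\<alpha>)" .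
    have intA: "integrable D (indicator A :: real \<Rightarrow> real)"
      by (rule D.integrable_const_bound[of _ 1]) (auto simp: indicator_def)
    have "(\<integral>x. cos (t * x) \<partial>D) \<le> (\<integral>x. 1 - e * indicator A x \<partial>D)"
    proof (rule integral_mono[OF intc])
      show "integrable D (\<lambda>x. 1 - e * indicator A x :: real)" using intA by auto
      fix x :: real
      show "cos (t * x) \<le> 1 - e * indicator A x"
      proof (cases "x \<in> A")
        case True
        then have "pi / L < \<bar>t * x\<bar>" "\<bar>t * x\<bar> \<le> pi"
          using t L1 by (auto simp: A_def u_def abs_mult field_simps)
        then have "cos \<bar>t * x\<bar> \<le> cos (pi / L)"
          using L1 by (intro cos_monotone_0_pi_le) auto
        then show ?thesis using True by (simp add: e_def cos_abs_real)
      qed simp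
    qed
    also have "\<dots> = 1 - e * measure D A"
      using intA D.prob_space by (simp del: D.prob_space D.space_eq_univ)
    also have "\<dots> \<le> 1 - e * (Cu * u powr (-\<alpha>))" using mA e by simp
    also have "e * (Cu * u powr (-\<alpha>)) = c * \<bar>t\<bar> powr \<alpha>"
      using t by (simp add: c_def u_def powr_divide powr_minus field_simps)
    finally show ?thesis by (simp add: Re)
  qed
  have "((\<lambda>t. Re (char D t)) \<longlongrightarrow> Re (char D 0)) (at 0)"
    using D.isCont_char[of 0] unfolding isCont_def by (rule tendsto_Re)
  then have "((\<lambda>t. Re (char D t)) \<longlongrightarrow> 1) (at 0)" by (simp add: D.char_zero)
  then have "eventually (\<lambda>t. Re (char D t) > 0) (at 0)" by (rule order_tendstoD) simp
  then obtain t2 where t2: "t2 > 0" "\<And>t. t \<noteq> 0 \<Longrightarrow> \<bar>t\<bar> < t2 \<Longrightarrow> Re (char D t) > 0"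
    unfolding eventually_at by (auto simp: dist_real_def)
  define t0 where "t0 = min t1 (t2 / 2)"
  have "cmod (char D t) \<le> exp (- c * \<bar>t\<bar> powr \<alpha>)" if t: "\<bar>t\<bar> \<le> t0" for t
  proof (cases "t = 0")
    case True
    then show ?thesis using D.cmod_char_le_1[of 0] \<alpha> by simp
  next
    case False
    have "Re (char D t) > 0" using t2 False t by (auto simp: t0_def)
    then have "cmod (char D t) = Re (char D t)" by (simp add: cmod_def Im)
    also have "\<dots> \<le> 1 + (- c * \<bar>t\<bar> powr \<alpha>)" using main[OF False] t by (simp add: t0_def)
    also have "\<dots> \<le> exp (- c * \<bar>t\<bar> powr \<alpha>)" by (rule exp_ge_add_one_self)
    finally show ?thesis .
  qed
  then show ?thesis using c t1 t2(1) by (intro exI[of _ c] exI[of _ t0]) (auto simp: t0_def)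
qed

section \<open>Small ball probabilities\<close>

text \<open>
  Fubini's theorem for the kernel \<open>iexp (t * x)\<close>.
\<close>

lemma integral_char_eq_integral_char:
  assumes "real_distribution M" "real_distribution N"
  shows "(\<integral>x. char N x \<partial>M) = (\<integral>t. char M t \<partial>N)"
proof -
  interpret M: real_distribution M by fact
  interpret N: real_distribution N by fact
  interpret P: pair_prob_space M N ..
  have sM: "sets M = sets borel" and sN: "sets N = sets borel" by simp_all
  have [measurable]: "(\<lambda>(x, t). iexp (t * x)) \<in> borel_measurable (M \<Otimes>\<^sub>M N)"
    by (subst measurable_cong_sets[OF sets_pair_measure_cong[OF sM sN] refl]) measurable
  have "integrable (M \<Otimes>\<^sub>M N) (\<lambda>(x, t). iexp (t * x))"
    by (rule P.integrable_const_bound[of _ 1]) auto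
  from P.Fubini_integral[OF this] show ?thesis
    unfolding char_def by (simp add: mult.commute)
qed

lemma std_normal_measure_interval_le:
  assumes "z \<ge> 0"
  shows "measure std_normal_distribution {-z..z} \<le> z"
proof -
  have d: "std_normal_density t \<le> 1/2" for t
  proof -
    have "2 * 2 \<le> 2 * pi" using pi_ge_two by simp
    then have "sqrt (2 * 2) \<le> sqrt (2 * pi)" by (rule real_sqrt_le_mono)
    then have s: "2 \<le> sqrt (2 * pi)" by simp
    have "exp (- t\<^sup>2 / 2) \<le> 1" by simp
    then have "1 / sqrt (2 * pi) * exp (- t\<^sup>2 / 2) \<le> 1 / 2 * 1"
      using s by (intro mult_mono) (auto simp: field_simps)
    then show ?thesis by (simp add: std_normal_density_def)
  qed
  have "emeasure std_normal_distribution {-z..z} = (\<integral>\<^sup>+t. ennreal (std_normal_density t) * indicator {-z..z} t \<partial>lborel)"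
    by (simp add: emeasure_density)
  also have "\<dots> \<le> (\<integral>\<^sup>+t. ennreal (1/2) * indicator {-z..z} t \<partial>lborel)"
    by (intro nn_integral_mono mult_right_mono ennreal_leI d) simp
  also have "\<dots> = ennreal (1/2) * ennreal (2 * z)"
    using assms by (simp add: nn_integral_cmult)
  also have "\<dots> = ennreal (1/2 * (2 * z))"
    by (subst ennreal_mult) (use assms in auto)
  also have "\<dots> = ennreal z" by simp
  finally show ?thesis
    using assms by (simp add: measure_def enn2real_leI)
qed

lemma std_normal_measure_tail_le:
  assumes "G > 0"
  shows "measure std_normal_distribution {t. \<bar>t\<bar> > G} \<le> 1 / G\<^sup>2"
proof -
  interpret real_distribution std_normal_distribution by (rule real_dist_normal_dist)
  have 1: "has_bochner_integral lborel (\<lambda>x. std_normal_density x * x ^ (2 * 1)) (fact (2 * 1) / (2 ^ 1 * fact 1))"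
    by (rule std_normal_moment_even)
  have int: "integrable std_normal_distribution (\<lambda>x. x\<^sup>2)"
    using 1[unfolded has_bochner_integral_iff] by (subst integrable_density) (auto simp: normal_density_nonneg)
  have "(\<integral>x. x\<^sup>2 \<partial>std_normal_distribution) = 1"
    using has_bochner_integral_integral_eq[OF 1] by (subst integral_density) auto
  moreover have "prob {t\<in>space std_normal_distribution. G\<^sup>2 \<le> t\<^sup>2} \<le> (\<integral>x. x\<^sup>2 \<partial>std_normal_distribution) / G\<^sup>2"
    by (rule integral_Markov_inequality_measure[OF int, where A="space std_normal_distribution"])
      (use assms in auto)
  moreover have "prob {t. \<bar>t\<bar> > G} \<le> prob {t\<in>space std_normal_distribution. G\<^sup>2 \<le> t\<^sup>2}"
    using assms by (intro finite_measure_mono) (auto simp: abs_le_square_iff[symmetric])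
  ultimately show ?thesis by simp
qed

text \<open>
  The indicator of the small ball is dominated by \<open>exp 2 * exp (- Z\<^sup>2 / 2)\<close>, whose mean is the integral of
  the characteristic function of \<open>Z\<close> against the standard normal law. On \<open>z < \<bar>t\<bar> \<le> G\<close> the factors with
  index in \<open>J\<close> have small arguments and together give \<open>exp (- c * (z * \<Lambda>) powr \<alpha>)\<close>; the rest of the line
  is estimated by its Gaussian measure. The cut at \<open>G\<close> is necessary because nothing is known about
  the characteristic function of the entries away from \<open>0\<close>.
\<close>

lemma (in prob_space) small_ball_linear_combination:
  fixes X :: "nat \<Rightarrow> 'a \<Rightarrow> real" and v :: "nat \<Rightarrow> real"
  assumes ind: "indep_vars (\<lambda>_. borel) X {..<n}"
    and law: "\<And>j. j < n \<Longrightarrow> distr M borel (X j) = D"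
    and decay: "\<And>t. \<bar>t\<bar> \<le> t0 \<Longrightarrow> cmod (char D t) \<le> exp (- c * \<bar>t\<bar> powr \<alpha>)"
    and D: "real_distribution D"
    and J: "J \<subseteq> {..<n}" "\<And>j. j \<in> J \<Longrightarrow> \<bar>v j\<bar> \<le> \<kappa>"
    and mass: "(\<Sum>j\<in>J. \<bar>v j\<bar> powr \<alpha>) \<ge> (\<Lambda> * r) powr \<alpha>"
    and pos: "c > 0" "\<alpha> > 0" "r > 0" "\<Lambda> > 0" "z > 0" "G > 0" "\<kappa> > 0"
    and G: "G * \<kappa> \<le> t0 * r"
  shows "prob {\<omega>\<in>space M. \<bar>\<Sum>j<n. X j \<omega> * v j\<bar> \<le> 2 * r}
      \<le> exp 2 * (z + exp (- c * (z * \<Lambda>) powr \<alpha>) + 1 / G\<^sup>2)"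
proof -
  interpret D: real_distribution D by fact
  interpret g: real_distribution std_normal_distribution by (rule real_dist_normal_dist)
  have rv: "X j \<in> borel_measurable M" if "j < n" for j
    using ind that by (auto simp: indep_vars_def)
  define Y where "Y j \<omega> = X j \<omega> * (v j / r)" for j \<omega>
  define Z where "Z \<omega> = (\<Sum>j<n. Y j \<omega>)" for \<omega>
  have rvY: "Y j \<in> borel_measurable M" if "j < n" for j
    unfolding Y_def using rv[OF that] by measurable
  have indY: "indep_vars (\<lambda>_. borel) Y {..<n}"
    unfolding Y_def by (rule indep_vars_compose2[OF ind]) auto
  have [measurable]: "Z \<in> borel_measurable M"
    unfolding Z_def by (intro borel_measurable_sum rvY) auto
  have distZ: "real_distribution (distr M borel Z)" by (rule real_distribution_distr) simp
  have charY: "char (distr M borel (Y j)) t = char D (t * v j / r)" if "j < n" for j t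
    unfolding law[OF that, symmetric] char_def
    using rv[OF that] rvY[OF that] by (simp add: integral_distr Y_def mult_ac)
  have charZ: "char (distr M borel Z) t = (\<Prod>j<n. char D (t * v j / r))" for t
  proof -
    have "char (distr M borel Z) t = (\<Prod>j<n. char (distr M borel (Y j)) t)"
      unfolding Z_def by (rule char_distr_sum[OF indY])
    then show ?thesis by (simp add: charY)
  qed
  have bound: "cmod (char (distr M borel Z) t)
      \<le> indicator {-z..z} t + exp (- c * (z * \<Lambda>) powr \<alpha>) + indicator {t. \<bar>t\<bar> > G} t" for t
  proof (cases "\<bar>t\<bar> \<le> z \<or> \<bar>t\<bar> > G")
    case True
    have "cmod (char (distr M borel Z) t) \<le> 1"
      using distZ by (rule real_distribution.cmod_char_le_1)
    moreover have "1 \<le> indicator {-z..z} t + (indicator {t. \<bar>t\<bar> > G} t :: real)"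
      using True by (auto simp: indicator_def)
    ultimately show ?thesis by (smt (verit) exp_gt_zero)
  next
    case False
    then have t: "\<bar>t\<bar> > z" "\<bar>t\<bar> \<le> G" by auto
    have "cmod (char (distr M borel Z) t) = (\<Prod>j<n. cmod (char D (t * v j / r)))"
      by (simp add: charZ prod_norm)
    also have "\<dots> \<le> (\<Prod>j<n. if j \<in> J then cmod (char D (t * v j / r)) else 1)"
      by (intro prod_mono) (auto simp: D.cmod_char_le_1)
    also have "\<dots> = (\<Prod>j\<in>J. cmod (char D (t * v j / r)))"
      using J(1) by (simp add: prod.If_cases Int_absorb1)
    also have "\<dots> \<le> (\<Prod>j\<in>J. exp (- c * \<bar>t * v j / r\<bar> powr \<alpha>))"
    proof (intro prod_mono conjI decay)
      fix j assume "j \<in> J"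
      then have "\<bar>t * v j\<bar> \<le> G * \<kappa>"
        unfolding abs_mult using t J(2) pos by (intro mult_mono) auto
      then show "\<bar>t * v j / r\<bar> \<le> t0" using G pos by (simp add: field_simps)
    qed auto
    also have "\<dots> = exp (- c * ((\<bar>t\<bar> / r) powr \<alpha> * (\<Sum>j\<in>J. \<bar>v j\<bar> powr \<alpha>)))"
    proof -
      have "\<bar>t * v j / r\<bar> powr \<alpha> = (\<bar>t\<bar> / r) powr \<alpha> * \<bar>v j\<bar> powr \<alpha>" for j
        using pos by (simp add: abs_mult powr_mult powr_divide)
      moreover have "finite J" using J(1) finite_subset by blast
      ultimately show ?thesis by (simp add: exp_sum[symmetric] sum_distrib_left sum_negf)
    qed
    also have "\<dots> \<le> exp (- c * (z * \<Lambda>) powr \<alpha>)"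
    proof -
      have "(z * \<Lambda>) powr \<alpha> = (z / r) powr \<alpha> * (\<Lambda> * r) powr \<alpha>"
        using pos by (simp add: powr_mult[symmetric])
      also have "\<dots> \<le> (\<bar>t\<bar> / r) powr \<alpha> * (\<Sum>j\<in>J. \<bar>v j\<bar> powr \<alpha>)"
        using t pos by (intro mult_mono mass powr_mono2 divide_right_mono) auto
      finally show ?thesis using pos by simp
    qed
    finally show ?thesis by (auto simp: indicator_def)
  qed
  have intexp: "integrable M (\<lambda>\<omega>. exp (- (Z \<omega>)\<^sup>2 / 2))"
    by (rule integrable_const_bound[of _ 1]) auto
  have i1: "integrable std_normal_distribution (indicator {-z..z} :: real \<Rightarrow> real)"
    and i2: "integrable std_normal_distribution (indicator {t. \<bar>t\<bar> > G} :: real \<Rightarrow> real)"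
    by (rule g.integrable_const_bound[of _ 1]; auto simp: indicator_def)+
  have intB: "integrable std_normal_distribution
      (\<lambda>t. indicator {-z..z} t + exp (- c * (z * \<Lambda>) powr \<alpha>) + indicator {t. \<bar>t\<bar> > G} t :: real)"
    using i1 i2 by (intro Bochner_Integration.integrable_add) auto
  have "complex_of_real (expectation (\<lambda>\<omega>. exp (- (Z \<omega>)\<^sup>2 / 2)))
      = (\<integral>x. char std_normal_distribution x \<partial>distr M borel Z)"
    by (subst integral_distr) (auto simp: char_std_normal_distribution intro!: integral_complex_of_real[symmetric])
  also have "\<dots> = (\<integral>t. char (distr M borel Z) t \<partial>std_normal_distribution)"
    by (rule integral_char_eq_integral_char[OF distZ g.real_distribution_axioms])
  finally have "expectation (\<lambda>\<omega>. exp (- (Z \<omega>)\<^sup>2 / 2))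
      \<le> cmod (\<integral>t. char (distr M borel Z) t \<partial>std_normal_distribution)"
    by (metis norm_of_real abs_ge_self)
  also have "\<dots> \<le> (\<integral>t. indicator {-z..z} t + exp (- c * (z * \<Lambda>) powr \<alpha>) + indicator {t. \<bar>t\<bar> > G} t
      \<partial>std_normal_distribution)"
    by (rule Bochner_Integration.integral_norm_bound_integral[OF _ intB bound])
      (rule g.integrable_const_bound[of _ 1], auto simp: real_distribution.cmod_char_le_1[OF distZ]
        real_distribution.char_measurable[OF distZ])
  also have "\<dots> = measure std_normal_distribution {-z..z} + exp (- c * (z * \<Lambda>) powr \<alpha>)
      + measure std_normal_distribution {t. \<bar>t\<bar> > G}"
    using i1 i2 g.prob_space by (simp del: g.prob_space g.space_eq_univ)
  also have "\<dots> \<le> z + exp (- c * (z * \<Lambda>) powr \<alpha>) + 1 / G\<^sup>2"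
    using std_normal_measure_interval_le[of z] std_normal_measure_tail_le[of G] pos by simp
  finally have E: "expectation (\<lambda>\<omega>. exp (- (Z \<omega>)\<^sup>2 / 2)) \<le> z + exp (- c * (z * \<Lambda>) powr \<alpha>) + 1 / G\<^sup>2" .
  have "prob {\<omega>\<in>space M. \<bar>\<Sum>j<n. X j \<omega> * v j\<bar> \<le> 2 * r}
      \<le> prob {\<omega>\<in>space M. exp (- 2) \<le> exp (- (Z \<omega>)\<^sup>2 / 2)}"
  proof (intro finite_measure_mono)
    show "{\<omega>\<in>space M. \<bar>\<Sum>j<n. X j \<omega> * v j\<bar> \<le> 2 * r} \<subseteq> {\<omega>\<in>space M. exp (- 2) \<le> exp (- (Z \<omega>)\<^sup>2 / 2)}"
    proof
      fix \<omega> assume \<omega>: "\<omega> \<in> {\<omega>\<in>space M. \<bar>\<Sum>j<n. X j \<omega> * v j\<bar> \<le> 2 * r}"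
      then have le: "\<bar>\<Sum>j<n. X j \<omega> * v j\<bar> \<le> 2 * r" by simp
      have "Z \<omega> = (\<Sum>j<n. X j \<omega> * v j) / r" by (simp add: Z_def Y_def sum_divide_distrib)
      then have "\<bar>Z \<omega>\<bar> = \<bar>\<Sum>j<n. X j \<omega> * v j\<bar> / r" using pos by simp
      then have "\<bar>Z \<omega>\<bar> \<le> 2" using le pos by (simp add: divide_le_eq)
      then have "(Z \<omega>)\<^sup>2 \<le> 2\<^sup>2" using abs_le_square_iff[of "Z \<omega>" 2] by simp
      then show "\<omega> \<in> {\<omega>\<in>space M. exp (- 2) \<le> exp (- (Z \<omega>)\<^sup>2 / 2)}" using \<omega> by simp
    qed
  qed simp
  also have "\<dots> \<le> expectation (\<lambda>\<omega>. exp (- (Z \<omega>)\<^sup>2 / 2)) / exp (- 2)"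
    by (rule integral_Markov_inequality_measure[OF intexp, where A="space M"]) auto
  also have "\<dots> = exp 2 * expectation (\<lambda>\<omega>. exp (- (Z \<omega>)\<^sup>2 / 2))"
    by (simp add: exp_minus field_simps)
  also have "\<dots> \<le> exp 2 * (z + exp (- c * (z * \<Lambda>) powr \<alpha>) + 1 / G\<^sup>2)"
    by (intro mult_left_mono E) simp
  finally show ?thesis .
qed

section \<open>Matrices with independent and identically distributed entries\<close>

text \<open>
  Each single variable is a block of its own for the grouping lemma.
\<close>

lemma (in prob_space) indep_vars_reindexed:
  assumes ind: "indep_vars (\<lambda>_. S) X (f ` J)" and inj: "inj_on f J"
  shows "indep_vars (\<lambda>_. S) (\<lambda>j. X (f j)) J"
proof -
  have "indep_vars (\<lambda>j. PiM {f j} (\<lambda>_. S)) (\<lambda>j \<omega>. restrict (\<lambda>i. X i \<omega>) {f j}) J"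
    by (rule indep_vars_restrict[OF ind]) (use inj in \<open>auto simp: disjoint_family_on_def inj_on_def\<close>)
  then have "indep_vars (\<lambda>_. S) (\<lambda>j \<omega>. restrict (\<lambda>i. X i \<omega>) {f j} (f j)) J"
    by (rule indep_vars_compose2[where Y = "\<lambda>j \<omega>. \<omega> (f j)"]) measurable
  then show ?thesis by simp
qed

locale iid_matrix = prob_space M for M :: "'w measure" +
  fixes X :: "nat \<Rightarrow> nat \<Rightarrow> 'w \<Rightarrow> real" and N n :: nat and D :: "real measure"
  assumes indep: "indep_vars (\<lambda>_. borel) (\<lambda>(i, j). X i j) ({..<N} \<times> {..<n})"
    and law: "\<And>i j. i < N \<Longrightarrow> j < n \<Longrightarrow> distr M borel (X i j) = D"
    and real_distribution_law: "real_distribution D"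
begin

sublocale D: real_distribution D by (rule real_distribution_law)

lemma entry_measurable: "i < N \<Longrightarrow> j < n \<Longrightarrow> X i j \<in> borel_measurable M"
  using indep unfolding indep_vars_def by (auto dest!: bspec[where x="(i,j)"])

lemma expectation_entry:
  assumes "i < N" "j < n" and [measurable]: "f \<in> borel_measurable borel"
  shows "expectation (\<lambda>\<omega>. f (X i j \<omega>) :: real) = (\<integral>x. f x \<partial>D)"
  unfolding law[OF assms(1,2), symmetric]
  using entry_measurable[OF assms(1,2)] by (subst integral_distr) auto

lemma indep_entries_subset:
  assumes "K \<subseteq> {..<N} \<times> {..<n}" and [measurable]: "f \<in> borel_measurable borel"
  shows "indep_vars (\<lambda>_. borel) (\<lambda>(i,j) \<omega>. f (X i j \<omega>) :: real) K"
proof -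
  have "indep_vars (\<lambda>_. borel) (\<lambda>p \<omega>. f ((case p of (i, j) \<Rightarrow> X i j) \<omega>)) K"
    by (rule indep_vars_compose2[OF indep_vars_subset[OF indep assms(1)]]) auto
  then show ?thesis by (simp add: case_prod_unfold)
qed

lemma truncated_square_sum_tail:
  assumes K: "K \<subseteq> {..<N} \<times> {..<n}" and p: "(\<integral>x. min 1 ((x / T)\<^sup>2) \<partial>D) \<le> p"
  shows "prob {\<omega>\<in>space M. (\<Sum>(i,j)\<in>K. min 1 ((X i j \<omega> / T)\<^sup>2)) \<ge> x} \<le> exp (2 * p * card K - x)"
proof -
  have fin: "finite K" using K finite_subset by blast
  have ind: "indep_vars (\<lambda>_. borel) (\<lambda>(i,j) \<omega>. min 1 ((X i j \<omega> / T)\<^sup>2)) K"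
    by (rule indep_entries_subset[OF K, where f="\<lambda>x. min 1 ((x / T)\<^sup>2)"]) measurable
  have eq: "(\<Sum>(i,j)\<in>K. min 1 ((X i j \<omega> / T)\<^sup>2)) = (\<Sum>k\<in>K. (case k of (i,j) \<Rightarrow> \<lambda>\<omega>. min 1 ((X i j \<omega> / T)\<^sup>2)) \<omega>)" for \<omega>
    by (simp add: case_prod_unfold)
  show ?thesis unfolding eq
  proof (rule sum_unit_interval_upper_tail[OF fin ind])
    fix k assume k: "k \<in> K"
    then have "fst k < N" "snd k < n" using K by auto
    then show "expectation (case k of (i, j) \<Rightarrow> \<lambda>\<omega>. min 1 ((X i j \<omega> / T)\<^sup>2)) \<le> p"
      using expectation_entry[of "fst k" "snd k" "\<lambda>x. min 1 ((x / T)\<^sup>2)"] p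
      by (simp add: case_prod_unfold)
  qed (auto split: prod.splits)
qed

text \<open>
  The events that a column is bounded are independent with equal probabilities; this is the lower
  tail of their number.
\<close>

lemma few_bounded_columns_prob_le:
  fixes x T :: real
  shows "prob {\<omega>\<in>space M. real (card {j\<in>{..<n}. \<forall>i<N. \<bar>X i j \<omega>\<bar> \<le> T}) \<le> x}
    \<le> exp (x - (measure D {y. \<bar>y\<bar> \<le> T}) ^ N * n / 2)"
proof -
  define Z where "Z j \<omega> = (\<Prod>i<N. indicator {y. \<bar>y\<bar> \<le> T} (X i j \<omega>) :: real)" for j \<omega>
  have Z: "Z j \<omega> = (if \<forall>i<N. \<bar>X i j \<omega>\<bar> \<le> T then 1 else 0)" for j \<omega>
    unfolding Z_def by (auto simp: indicator_def)
  have "indep_vars (\<lambda>j. PiM ({..<N} \<times> {j}) (\<lambda>_. borel))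
      (\<lambda>j \<omega>. restrict (\<lambda>p. (case p of (i, j) \<Rightarrow> X i j) \<omega>) ({..<N} \<times> {j})) {..<n}"
    by (rule indep_vars_restrict[OF indep]) (auto simp: disjoint_family_on_def)
  then have "indep_vars (\<lambda>_. borel) (\<lambda>j \<omega>. \<Prod>i<N. indicator {y. \<bar>y\<bar> \<le> T}
      (restrict (\<lambda>p. (case p of (i, j) \<Rightarrow> X i j) \<omega>) ({..<N} \<times> {j}) (i, j)) :: real) {..<n}"
    by (rule indep_vars_compose2[where Y = "\<lambda>j \<omega>. \<Prod>i<N. indicator {y. \<bar>y\<bar> \<le> T} (\<omega> (i, j))"]) measurable
  then have ind: "indep_vars (\<lambda>_. borel) Z {..<n}"
    by (simp add: Z_def[abs_def])
  have "prob {\<omega>\<in>space M. (\<Sum>j<n. Z j \<omega>) \<le> x} \<le> exp (x - (measure D {y. \<bar>y\<bar> \<le> T}) ^ N * card {..<n} / 2)"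
  proof (rule sum_unit_interval_lower_tail[OF _ ind])
    fix j assume j: "j \<in> {..<n}"
    have "expectation (Z j) = (\<Prod>i<N. expectation (\<lambda>\<omega>. indicator {y. \<bar>y\<bar> \<le> T} (X i j \<omega>)))"
      unfolding Z_def[abs_def]
    proof (rule indep_vars_lebesgue_integral)
      have "indep_vars (\<lambda>_. borel) (\<lambda>p \<omega>. indicator {y. \<bar>y\<bar> \<le> T} ((case p of (i, j) \<Rightarrow> X i j) \<omega>) :: real) ((\<lambda>i. (i, j)) ` {..<N})"
        by (rule indep_vars_compose2[OF indep_vars_subset[OF indep]]) (use j in auto)
      from indep_vars_reindexed[OF this] show "indep_vars (\<lambda>_. borel) (\<lambda>i \<omega>. indicator {y. \<bar>y\<bar> \<le> T} (X i j \<omega>) :: real) {..<N}"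
        by (simp add: inj_on_def)
      fix i assume "i \<in> {..<N}"
      then have [measurable]: "X i j \<in> borel_measurable M" using entry_measurable j by auto
      show "integrable M (\<lambda>\<omega>. indicator {y. \<bar>y\<bar> \<le> T} (X i j \<omega>) :: real)"
        by (rule integrable_const_bound[of _ 1]) (auto simp: indicator_def)
    qed simp
    also have "\<dots> = (\<Prod>i<N. measure D {y. \<bar>y\<bar> \<le> T})"
      using j by (intro prod.cong refl) (subst expectation_entry, auto)
    finally show "(measure D {y. \<bar>y\<bar> \<le> T}) ^ N \<le> expectation (Z j)" by simp
  qed (auto simp: Z)
  moreover have "(\<Sum>j<n. Z j \<omega>) = card {j\<in>{..<n}. \<forall>i<N. \<bar>X i j \<omega>\<bar> \<le> T}" for \<omega>
    by (simp add: Z sum.If_cases Int_def)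
  ultimately show ?thesis by simp
qed

lemma indep_row_combinations:
  "indep_vars (\<lambda>_. borel) (\<lambda>i \<omega>. \<Sum>j<n. X i j \<omega> * v j) {..<N}"
proof -
  have "indep_vars (\<lambda>i. PiM ({i} \<times> {..<n}) (\<lambda>_. borel))
      (\<lambda>i \<omega>. restrict (\<lambda>p. (case p of (i, j) \<Rightarrow> X i j) \<omega>) ({i} \<times> {..<n})) {..<N}"
    by (rule indep_vars_restrict[OF indep]) (auto simp: disjoint_family_on_def)
  then have "indep_vars (\<lambda>_. borel) (\<lambda>i \<omega>. \<Sum>j<n.
      restrict (\<lambda>p. (case p of (i, j) \<Rightarrow> X i j) \<omega>) ({i} \<times> {..<n}) (i, j) * v j) {..<N}"
    by (rule indep_vars_compose2[where Y = "\<lambda>i \<omega>. \<Sum>j<n. \<omega> (i, j) * v j"]) measurable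
  then show ?thesis by simp
qed

lemma indep_row:
  assumes "i < N"
  shows "indep_vars (\<lambda>_. borel) (X i) {..<n}"
proof -
  have "indep_vars (\<lambda>_. borel) (\<lambda>(i, j). X i j) ((\<lambda>j. (i, j)) ` {..<n})"
    by (rule indep_vars_subset[OF indep]) (use assms in auto)
  from indep_vars_reindexed[OF this] show ?thesis by (simp add: inj_on_def)
qed

lemma few_large_rows_prob_le:
  assumes decay: "\<And>t. \<bar>t\<bar> \<le> t0 \<Longrightarrow> cmod (char D t) \<le> exp (- c * \<bar>t\<bar> powr \<alpha>)"
    and J: "J \<subseteq> {..<n}" "\<And>j. j \<in> J \<Longrightarrow> \<bar>v j\<bar> \<le> \<kappa>"
    and mass: "(\<Sum>j\<in>J. \<bar>v j\<bar> powr \<alpha>) \<ge> (\<Lambda> * r) powr \<alpha>"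
    and pos: "c > 0" "\<alpha> > 0" "r > 0" "\<Lambda> > 0" "z > 0" "G > 0" "\<kappa> > 0"
    and G: "G * \<kappa> \<le> t0 * r"
    and q: "exp 2 * (z + exp (- c * (z * \<Lambda>) powr \<alpha>) + 1 / G\<^sup>2) \<le> q" "q < 1"
  shows "prob {\<omega>\<in>space M. real (card {i\<in>{..<N}. \<bar>\<Sum>j<n. X i j \<omega> * v j\<bar> > 2 * r}) \<le> x}
    \<le> (2 * q) ^ N * q powr (- x)"
proof -
  have q0: "q > 0"
    by (rule less_le_trans[OF _ q(1)]) (use pos in \<open>auto intro!: mult_pos_pos add_pos_nonneg\<close>)
  have "prob {\<omega>\<in>space M. real (card {i\<in>{..<N}. \<bar>\<Sum>j<n. X i j \<omega> * v j\<bar> > 2 * r}) \<le> x}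
      \<le> (2 * q) ^ card {..<N} * q powr (- x)"
  proof (rule few_large_values_prob_le[OF _ indep_row_combinations q0 q(2)])
    fix i assume "i \<in> {..<N}"
    then have i: "i < N" by simp
    show "prob {\<omega>\<in>space M. \<bar>\<Sum>j<n. X i j \<omega> * v j\<bar> \<le> 2 * r} \<le> q"
      by (rule order_trans[OF small_ball_linear_combination[OF indep_row[OF i] law[OF i] decay
            real_distribution_law J mass pos G] q(1)])
  qed simp
  then show ?thesis by simp
qed

end

context iid_matrix
begin

definition sample_matrix :: "'w \<Rightarrow> real mat" where
  "sample_matrix \<omega> = mat N n (\<lambda>(i, j). X i j \<omega>)"

text \<open>
  The union bound over the lattice points. The exceptional event consists of a large truncated sum of
  squares, or of a lattice point for which too few rows are large; both are measurable, although the
  conclusion quantifies over all vectors.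
\<close>

lemma delocalised_vectors_bound:
  fixes p R S :: real
  assumes decay: "\<And>t. \<bar>t\<bar> \<le> t0 \<Longrightarrow> cmod (char D t) \<le> exp (- c * \<bar>t\<bar> powr \<alpha>)"
    and \<alpha>: "0 < \<alpha>" "\<alpha> < 2" and pos: "r > 0" "T > 0" "\<kappa> > 0" "\<Lambda> \<ge> 1" "n > 0" "c > 0" "z > 0" "G > 0"
    and \<tau>: "0 < \<tau>" "\<tau> \<le> 1" "T powr \<alpha> = real n / \<tau> powr \<alpha>"
    and h\<kappa>: "r / T \<le> \<kappa>"
    and \<delta>: "0 < \<delta>" "\<delta> \<le> 1"
    and scale: "\<delta> * \<kappa> powr (\<alpha> - 2) \<ge> 8 * (\<Lambda> * r) powr \<alpha>"
    and G: "G * (2 * \<kappa>) \<le> t0 * r"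
    and q: "exp 2 * (z + exp (- c * (z * \<Lambda>) powr \<alpha>) + 1 / G\<^sup>2) \<le> q" "q < 1"
    and B: "B = 68 * \<Lambda> powr \<alpha> / (\<delta> * \<tau> powr \<alpha>)"
    and p: "(\<integral>x. min 1 ((x / T)\<^sup>2) \<partial>D) \<le> p"
  shows "\<exists>E\<in>events. (\<forall>\<omega>\<in>E. \<forall>u. (\<Sum>j<n. (u j)\<^sup>2) = 1 \<longrightarrow>
      (\<Sum>j\<in>{j\<in>{..<n}. \<bar>u j\<bar> \<le> \<kappa>}. (u j)\<^sup>2) \<ge> \<delta> \<longrightarrow>
      (\<Sum>i<N. (\<Sum>j<n. X i j \<omega> * u j)\<^sup>2) > R * r\<^sup>2) \<and>
    1 - prob E \<le> exp (2 * p * (N * n) - S)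
      + (5 * exp (2 / \<alpha>) * B powr (1 / \<alpha>)) ^ n * ((2 * q) ^ N * q powr (- (R + 2 * S)))"
proof -
  define F where "F = {q \<in> {..<n} \<rightarrow>\<^sub>E UNIV. (\<Sum>j<n. \<bar>real_of_int (q j)\<bar> powr \<alpha>) \<le> B * real n}"
  have B1: "B \<ge> 1"
  proof -
    have "\<delta> * \<tau> powr \<alpha> \<le> 1 * 1" using \<delta> \<tau> \<alpha> by (intro mult_mono powr_le1) auto
    also have "1 * 1 \<le> 68 * \<Lambda> powr \<alpha>" using pos \<alpha> ge_one_powr_ge_zero[of \<Lambda> \<alpha>] by simp
    finally show ?thesis using \<delta> \<tau> by (simp add: B field_simps)
  qed
  have finF: "finite F" and cardF: "real (card F) \<le> (5 * exp (2 / \<alpha>) * B powr (1 / \<alpha>)) ^ n"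
    unfolding F_def by (rule card_lattice_points_le[OF \<alpha> B1])+
  define J where "J q = {j\<in>{..<n}. \<bar>r / T * real_of_int (q j)\<bar> \<le> 2 * \<kappa>}" for q :: "nat \<Rightarrow> int"
  define F' where "F' = {q\<in>F. (\<Lambda> * r) powr \<alpha> \<le> (\<Sum>j\<in>J q. \<bar>r / T * q j\<bar> powr \<alpha>)}"
  have F': "finite F'" "card F' \<le> card F"
    using finF by (auto simp: F'_def intro: card_mono)
  define Sb where "Sb = {\<omega>\<in>space M. (\<Sum>(i,j)\<in>{..<N} \<times> {..<n}. min 1 ((X i j \<omega> / T)\<^sup>2)) \<ge> S}"
  define Qb where "Qb q = {\<omega>\<in>space M. real (card {i\<in>{..<N}. \<bar>\<Sum>j<n. X i j \<omega> * (r / T * real_of_int (q j))\<bar> > 2 * r})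
      \<le> R + 2 * S}" for q :: "nat \<Rightarrow> int"
  have mX: "X i j \<in> borel_measurable M" if "i < N" "j < n" for i j
    using entry_measurable[OF that] .
  have "(\<lambda>\<omega>. \<Sum>(i,j)\<in>{..<N} \<times> {..<n}. min 1 ((X i j \<omega> / T)\<^sup>2)) \<in> borel_measurable M"
    unfolding case_prod_unfold
  proof (intro borel_measurable_sum)
    fix k :: "nat \<times> nat" assume "k \<in> {..<N} \<times> {..<n}"
    then have [measurable]: "X (fst k) (snd k) \<in> borel_measurable M" by (intro mX) auto
    show "(\<lambda>\<omega>. min 1 ((X (fst k) (snd k) \<omega> / T)\<^sup>2)) \<in> borel_measurable M" by measurable
  qed
  then have Sb: "Sb \<in> events" unfolding Sb_def by measurable
  have Qb: "Qb q \<in> events" for q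
  proof -
    have row: "(\<lambda>\<omega>. \<Sum>j<n. X i j \<omega> * (r / T * real_of_int (q j))) \<in> borel_measurable M" if "i < N" for i
      using mX that by (intro borel_measurable_sum borel_measurable_times) auto
    have "(\<lambda>\<omega>. \<Sum>i<N. indicator {y. \<bar>y\<bar> > 2 * r} (\<Sum>j<n. X i j \<omega> * (r / T * real_of_int (q j))) :: real)
        \<in> borel_measurable M"
    proof (intro borel_measurable_sum)
      fix i assume "i \<in> {..<N}"
      then show "(\<lambda>\<omega>. indicator {y. \<bar>y\<bar> > 2 * r} (\<Sum>j<n. X i j \<omega> * (r / T * real_of_int (q j))) :: real)
          \<in> borel_measurable M"
        by (intro measurable_compose[OF row]) simp_all
    qed
    note meas = this
    have card_eq: "(\<Sum>i\<in>I. indicator {y. \<bar>y\<bar> > s} (f i) :: real) = real (card {i\<in>I. \<bar>f i\<bar> > s})"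
      if "finite I" for I :: "nat set" and f :: "nat \<Rightarrow> real" and s
      using that by (simp add: indicator_def sum.If_cases Int_def)
    from meas show ?thesis
      unfolding Qb_def card_eq[OF finite_lessThan] by (rule borel_measurable_iff_le[THEN iffD1, rule_format])
  qed
  define Bad where "Bad = Sb \<union> (\<Union>q\<in>F'. Qb q)"
  have Bad: "Bad \<in> events" unfolding Bad_def using Sb Qb F' by (intro sets.Un sets.finite_UN) auto
  have "prob Bad \<le> prob Sb + prob (\<Union>q\<in>F'. Qb q)"
    unfolding Bad_def using Sb Qb F' by (intro measure_Un_le sets.finite_UN) auto
  also have "prob (\<Union>q\<in>F'. Qb q) \<le> (\<Sum>q\<in>F'. prob (Qb q))"
    using Qb F' by (intro measure_UNION_le) auto
  also have "\<dots> \<le> (\<Sum>q'\<in>F'. (2 * q) ^ N * q powr (- (R + 2 * S)))"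
  proof (intro sum_mono)
    fix q' assume q': "q' \<in> F'"
    show "prob (Qb q') \<le> (2 * q) ^ N * q powr (- (R + 2 * S))"
      unfolding Qb_def
    proof (rule few_large_rows_prob_le[OF decay, where J = "J q'" and \<kappa> = "2 * \<kappa>" and \<Lambda> = \<Lambda> and z = z and G = G])
      show "(\<Lambda> * r) powr \<alpha> \<le> (\<Sum>j\<in>J q'. \<bar>r / T * real_of_int (q' j)\<bar> powr \<alpha>)"
        using q' by (simp add: F'_def)
    qed (use pos \<alpha> G q in \<open>auto simp: J_def\<close>)
  qed
  also have "\<dots> = real (card F') * ((2 * q) ^ N * q powr (- (R + 2 * S)))" by simp
  also have "\<dots> \<le> (5 * exp (2 / \<alpha>) * B powr (1 / \<alpha>)) ^ n * ((2 * q) ^ N * q powr (- (R + 2 * S)))"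
  proof (rule mult_right_mono)
    show "real (card F') \<le> (5 * exp (2 / \<alpha>) * B powr (1 / \<alpha>)) ^ n" using F' cardF by linarith
    have "q > 0" by (rule less_le_trans[OF _ q(1)]) (use pos in \<open>auto intro!: mult_pos_pos add_pos_nonneg\<close>)
    then show "0 \<le> (2 * q) ^ N * q powr (- (R + 2 * S))" by simp
  qed
  also have "prob Sb \<le> exp (2 * p * card ({..<N} \<times> {..<n}) - S)"
    unfolding Sb_def by (rule truncated_square_sum_tail[OF subset_refl p])
  finally have "prob Bad \<le> exp (2 * p * (N * n) - S)
      + (5 * exp (2 / \<alpha>) * B powr (1 / \<alpha>)) ^ n * ((2 * q) ^ N * q powr (- (R + 2 * S)))"
    by simp
  moreover have "prob (space M - Bad) = 1 - prob Bad" by (rule prob_compl[OF Bad])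
  moreover have "(\<Sum>i<N. (\<Sum>j<n. X i j \<omega> * u j)\<^sup>2) > R * r\<^sup>2"
    if \<omega>: "\<omega> \<in> space M - Bad" and u: "(\<Sum>j<n. (u j)\<^sup>2) = 1"
      "(\<Sum>j\<in>{j\<in>{..<n}. \<bar>u j\<bar> \<le> \<kappa>}. (u j)\<^sup>2) \<ge> \<delta>" for \<omega> u
  proof (rule ccontr)
    assume "\<not> ?thesis"
    then have R: "(\<Sum>i<N. (\<Sum>j<n. X i j \<omega> * u j)\<^sup>2) \<le> R * r\<^sup>2" by simp
    have S: "(\<Sum>i<N. \<Sum>j<n. min 1 ((X i j \<omega> / T)\<^sup>2)) \<le> S"
      using \<omega> by (auto simp: Bad_def Sb_def sum.cartesian_product)
    obtain q' :: "nat \<Rightarrow> int" where q': "q' \<in> {..<n} \<rightarrow>\<^sub>E UNIV"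
      "(\<Sum>j<n. \<bar>real_of_int (q' j)\<bar> powr \<alpha>) \<le> B * real n"
      "(\<Lambda> * r) powr \<alpha> \<le> (\<Sum>j\<in>{j\<in>{..<n}. \<bar>r / T * q' j\<bar> \<le> 2 * \<kappa>}. \<bar>r / T * q' j\<bar> powr \<alpha>)"
      "real (card {i\<in>{..<N}. \<bar>\<Sum>j<n. X i j \<omega> * (r / T * q' j)\<bar> > 2 * r}) \<le> R + 2 * S"
      using delocalised_vector_has_lattice_approximation[OF \<alpha> pos(1-5) \<tau> h\<kappa> u(1) \<delta> u(2) scale S R B]
      by (elim exE conjE)
    then have "q' \<in> F'" "\<omega> \<in> Qb q'" using \<omega> by (auto simp: F'_def F_def J_def Qb_def)
    then show False using \<omega> by (auto simp: Bad_def)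
  qed
  ultimately show ?thesis using Bad by (intro bexI[of _ "space M - Bad"]) auto
qed

text \<open>
  The bounded columns serve as the set of columns in the spectral bound. If there are \<open>m > 2 * k\<close> of
  them, then \<open>m - k + 1 \<ge> m / 2\<close>, and their number cancels.
\<close>

lemma kth_smallest_singular_value_bound:
  fixes p L T :: real
  assumes k: "1 \<le> k" "k \<le> n" and T: "T > 0"
    and p: "(\<integral>x. min 1 ((x / T)\<^sup>2) \<partial>D) \<le> p"
  shows "\<exists>E\<in>events. (\<forall>\<omega>\<in>E. (kth_smallest_singular_value (sample_matrix \<omega>) k)\<^sup>2 \<le> 2 * L * T\<^sup>2) \<and>
    1 - prob E \<le> n * exp (2 * p * N - L) + exp (2 * k - (measure D {y. \<bar>y\<bar> \<le> T}) ^ N * n / 2)"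
proof -
  have mX: "X i j \<in> borel_measurable M" if "i < N" "j < n" for i j
    using entry_measurable[OF that] .
  define Cb where "Cb j = {\<omega>\<in>space M. (\<Sum>(i,j)\<in>{..<N} \<times> {j}. min 1 ((X i j \<omega> / T)\<^sup>2)) \<ge> L}" for j
  define good where "good \<omega> = {j\<in>{..<n}. \<forall>i<N. \<bar>X i j \<omega>\<bar> \<le> T}" for \<omega>
  define Gb where "Gb = {\<omega>\<in>space M. real (card (good \<omega>)) \<le> 2 * real k}"
  have Cb: "Cb j \<in> events" if "j < n" for j
  proof -
    have "(\<lambda>\<omega>. \<Sum>(i,j)\<in>{..<N} \<times> {j}. min 1 ((X i j \<omega> / T)\<^sup>2)) \<in> borel_measurable M"
      unfolding case_prod_unfold
    proof (intro borel_measurable_sum)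
      fix k :: "nat \<times> nat" assume "k \<in> {..<N} \<times> {j}"
      then have [measurable]: "X (fst k) (snd k) \<in> borel_measurable M" using that by (intro mX) auto
      show "(\<lambda>\<omega>. min 1 ((X (fst k) (snd k) \<omega> / T)\<^sup>2)) \<in> borel_measurable M" by measurable
    qed
    then show ?thesis unfolding Cb_def by measurable
  qed
  have Gb: "Gb \<in> events"
  proof -
    have "(\<lambda>\<omega>. \<Sum>j<n. \<Prod>i<N. indicator {y. \<bar>y\<bar> \<le> T} (X i j \<omega>) :: real) \<in> borel_measurable M"
    proof (intro borel_measurable_sum borel_measurable_prod)
      fix i j assume "j \<in> {..<n}" "i \<in> {..<N}"
      then show "(\<lambda>\<omega>. indicator {y. \<bar>y\<bar> \<le> T} (X i j \<omega>) :: real) \<in> borel_measurable M"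
        by (intro measurable_compose[OF mX]) simp_all
    qed
    moreover have "(\<Sum>j<n. \<Prod>i<N. indicator {y. \<bar>y\<bar> \<le> T} (X i j \<omega>) :: real) = real (card (good \<omega>))" for \<omega>
    proof -
      have "(\<Prod>i<N. indicator {y. \<bar>y\<bar> \<le> T} (X i j \<omega>) :: real) = (if \<forall>i<N. \<bar>X i j \<omega>\<bar> \<le> T then 1 else 0)" for j
        by (auto simp: indicator_def)
      then show ?thesis by (simp add: good_def sum.If_cases Int_def)
    qed
    ultimately show ?thesis unfolding Gb_def by simp
  qed
  define Bad where "Bad = (\<Union>j<n. Cb j) \<union> Gb"
  have Bad: "Bad \<in> events" unfolding Bad_def using Cb Gb by (intro sets.Un sets.finite_UN) auto
  have "prob Bad \<le> prob (\<Union>j<n. Cb j) + prob Gb"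
    unfolding Bad_def using Cb Gb by (intro measure_Un_le sets.finite_UN) auto
  also have "prob (\<Union>j<n. Cb j) \<le> (\<Sum>j<n. prob (Cb j))"
    using Cb by (intro measure_UNION_le) auto
  also have "\<dots> \<le> (\<Sum>j<n. exp (2 * p * N - L))"
  proof (intro sum_mono)
    fix j assume "j \<in> {..<n}"
    then have "prob (Cb j) \<le> exp (2 * p * card ({..<N} \<times> {j}) - L)"
      unfolding Cb_def by (intro truncated_square_sum_tail p) auto
    then show "prob (Cb j) \<le> exp (2 * p * N - L)" by simp
  qed
  also have "prob Gb \<le> exp (2 * k - (measure D {y. \<bar>y\<bar> \<le> T}) ^ N * n / 2)"
    unfolding Gb_def good_def using few_bounded_columns_prob_le[of T "2 * real k"] by simp
  finally have "prob Bad \<le> n * exp (2 * p * N - L) + exp (2 * k - (measure D {y. \<bar>y\<bar> \<le> T}) ^ N * n / 2)"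
    by simp
  moreover have "prob (space M - Bad) = 1 - prob Bad" by (rule prob_compl[OF Bad])
  moreover have "(kth_smallest_singular_value (sample_matrix \<omega>) k)\<^sup>2 \<le> 2 * L * T\<^sup>2"
    if \<omega>: "\<omega> \<in> space M - Bad" for \<omega>
  proof -
    define s where "s = (kth_smallest_singular_value (sample_matrix \<omega>) k)\<^sup>2"
    define m where "m = card (good \<omega>)"
    have m: "2 * k < m" using \<omega> by (auto simp: Bad_def Gb_def m_def)
    have "s * real (m - k + 1) \<le> (\<Sum>j\<in>good \<omega>. \<Sum>i<N. (sample_matrix \<omega> $$ (i,j))\<^sup>2)"
      unfolding s_def m_def
      by (rule kth_smallest_singular_value_le_column_norms[where n=n])
        (use k m in \<open>auto simp: sample_matrix_def good_def m_def\<close>)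
    also have "\<dots> \<le> (\<Sum>j\<in>good \<omega>. T\<^sup>2 * L)"
    proof (intro sum_mono)
      fix j assume j: "j \<in> good \<omega>"
      have "(\<Sum>i<N. (sample_matrix \<omega> $$ (i,j))\<^sup>2) = T\<^sup>2 * (\<Sum>i<N. min 1 ((X i j \<omega> / T)\<^sup>2))"
        unfolding sum_distrib_left
      proof (intro sum.cong refl)
        fix i assume i: "i \<in> {..<N}"
        then have "\<bar>X i j \<omega> / T\<bar> \<le> 1" using j T by (auto simp: good_def)
        then have "(X i j \<omega> / T)\<^sup>2 \<le> 1" using abs_le_square_iff[of "X i j \<omega> / T" 1] by simp
        then show "(sample_matrix \<omega> $$ (i,j))\<^sup>2 = T\<^sup>2 * min 1 ((X i j \<omega> / T)\<^sup>2)"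
          using i j T by (simp add: sample_matrix_def good_def power_divide)
      qed
      also have "(\<Sum>i<N. min 1 ((X i j \<omega> / T)\<^sup>2)) = (\<Sum>(i,j)\<in>{..<N} \<times> {j}. min 1 ((X i j \<omega> / T)\<^sup>2))"
        by (simp add: sum.cartesian_product[symmetric])
      also have "\<dots> \<le> L" using \<omega> j by (force simp: Bad_def Cb_def good_def)
      finally show "(\<Sum>i<N. (sample_matrix \<omega> $$ (i,j))\<^sup>2) \<le> T\<^sup>2 * L" by (simp add: mult_left_mono)
    qed
    also have "\<dots> = real m * (T\<^sup>2 * L)" by (simp add: m_def)
    finally have 1: "s * real (m - k + 1) \<le> real m * (T\<^sup>2 * L)" .
    have "s * (real m / 2) \<le> s * real (m - k + 1)"
      using m by (intro mult_left_mono) (auto simp: s_def)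
    with 1 have "s * real m \<le> 2 * (real m * (T\<^sup>2 * L))" by linarith
    then have "real m * s \<le> real m * (2 * L * T\<^sup>2)" by (simp only: mult_ac)
    then show ?thesis using m unfolding s_def[symmetric] by simp
  qed
  ultimately show ?thesis using Bad by (intro bexI[of _ "space M - Bad"]) auto
qed

end

section \<open>Choice of the constants\<close>

text \<open>
  The net grows like \<open>\<Lambda> ^ n\<close>, while the probability for one point is at most a constant to the power
  \<open>N\<close> times \<open>\<Lambda> powr (- (1 - \<theta>)\<^sup>2 * N)\<close>. Comparing exponents leaves a negative power of \<open>\<Lambda>\<close>. The cut \<open>z\<close> is
  \<open>\<Lambda> powr (- (1 - \<theta>))\<close>, which makes \<open>z * \<Lambda>\<close> a positive power of \<open>\<Lambda>\<close>.
\<close>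

lemma net_beats_small_ball:
  fixes a \<theta> c \<alpha> C :: real
  assumes a: "a > 1" and \<theta>: "0 < \<theta>" "\<theta> < 1" "a * (1 - \<theta>)\<^sup>2 > 1" and pos: "c > 0" "\<alpha> > 0" "C > 0"
  shows "\<exists>\<Lambda>\<ge>1. \<exists>z q. 0 < z \<and> q = 3 * exp 2 * z \<and> q < 1 \<and>
     exp (- c * (z * \<Lambda>) powr \<alpha>) \<le> z \<and>
     (\<forall>n N. a * real n \<le> real N \<longrightarrow> (C * \<Lambda>) ^ n * ((2 * q) ^ N * q powr (- (\<theta> * real N))) \<le> exp (- real n))"
proof -
  define \<gamma> where "\<gamma> = 1 - \<theta>"
  have \<gamma>: "0 < \<gamma>" "\<gamma> < 1" using \<theta> by (auto simp: \<gamma>_def)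
  define b where "b = a * \<gamma>\<^sup>2 - 1"
  have b: "b > 0" using \<theta>(3) by (simp add: b_def \<gamma>_def)
  define y where "y L = 2 * (3 * exp 2 * L powr (- \<gamma>)) powr \<gamma>" for L :: real
  have \<theta>\<alpha>: "\<theta> * \<alpha> > 0" using \<theta> pos by simp
  have "\<forall>\<^sub>F L in at_top. L \<ge> (1::real)" by (rule eventually_ge_at_top)
  moreover have "\<forall>\<^sub>F L in at_top. exp (- c * L powr (\<theta> * \<alpha>)) \<le> L powr (- \<gamma>)"
    using pos \<gamma> \<theta>\<alpha> by real_asymp
  moreover have "\<forall>\<^sub>F L in at_top. 3 * exp 2 * L powr (- \<gamma>) < (1::real)"
    using \<gamma> by real_asymp
  moreover have "\<forall>\<^sub>F L in at_top. y L \<le> 1"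
  proof -
    have "\<gamma> * \<gamma> > 0" using \<gamma> by simp
    then have "\<forall>\<^sub>F L in at_top. 2 * (3 * exp 2) powr \<gamma> * L powr (- (\<gamma> * \<gamma>)) \<le> 1" by real_asymp
    then show ?thesis
      using eventually_gt_at_top[of 0]
      by eventually_elim (simp add: y_def powr_mult powr_powr)
  qed
  moreover have "\<forall>\<^sub>F L in at_top. C * L * y L powr a \<le> exp (- 1)"
  proof -
    define C' where "C' = C * (2 * (3 * exp 2) powr \<gamma>) powr a"
    have "C' > 0" using pos by (simp add: C'_def)
    then have "\<forall>\<^sub>F L in at_top. C' * L powr (- b) \<le> exp (- 1)" using b by real_asymp
    then show ?thesis
      using eventually_gt_at_top[of 0]
    proof eventually_elim
      case (elim L)
      have "y L powr a = (2 * (3 * exp 2) powr \<gamma>) powr a * L powr (- (a * \<gamma>\<^sup>2))"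
        using elim(2) by (simp add: y_def powr_mult powr_powr power2_eq_square mult_ac)
      then have "C * L * y L powr a = C' * (L * L powr (- (a * \<gamma>\<^sup>2)))" by (simp add: C'_def)
      also have "L * L powr (- (a * \<gamma>\<^sup>2)) = L powr (- b)"
        using elim(2) by (simp add: powr_mult_base b_def)
      finally show ?case using elim(1) by simp
    qed
  qed
  ultimately have "\<forall>\<^sub>F L in at_top. L \<ge> 1 \<and> exp (- c * L powr (\<theta> * \<alpha>)) \<le> L powr (- \<gamma>) \<and>
      3 * exp 2 * L powr (- \<gamma>) < 1 \<and> y L \<le> 1 \<and> C * L * y L powr a \<le> exp (- 1)"
    by eventually_elim simp
  then obtain L where L: "L \<ge> 1" "exp (- c * L powr (\<theta> * \<alpha>)) \<le> L powr (- \<gamma>)"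
      "3 * exp 2 * L powr (- \<gamma>) < 1" "y L \<le> 1" "C * L * y L powr a \<le> exp (- 1)"
    unfolding eventually_at_top_linorder by blast
  define z where "z = L powr (- \<gamma>)"
  define q where "q = 3 * exp 2 * z"
  have z: "z > 0" using L(1) by (simp add: z_def)
  have q: "q > 0" using z by (simp add: q_def)
  have zL: "(z * L) powr \<alpha> = L powr (\<theta> * \<alpha>)"
  proof -
    have "z * L = L powr \<theta>" using L(1) by (simp add: z_def \<gamma>_def powr_mult_base mult.commute)
    then show ?thesis by (simp add: powr_powr)
  qed
  have "(C * L) ^ n * ((2 * q) ^ N * q powr (- (\<theta> * real N))) \<le> exp (- real n)"
    if nN: "a * real n \<le> real N" for n N
  proof -
    have y0: "y L > 0" using L(1) by (simp add: y_def)
    have "(2 * q) ^ N * q powr (- (\<theta> * real N)) = 2 ^ N * (q powr real N * q powr (- (\<theta> * real N)))"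
      using q by (simp add: power_mult_distrib powr_realpow)
    also have "q powr real N * q powr (- (\<theta> * real N)) = (q powr \<gamma>) powr real N"
      by (simp add: powr_powr \<gamma>_def algebra_simps flip: powr_add)
    also have "2 ^ N * (q powr \<gamma>) powr real N = y L powr real N"
      using q by (simp add: y_def q_def z_def powr_mult powr_realpow)
    also have "\<dots> \<le> y L powr (a * real n)"
      using nN y0 L(4) by (intro powr_mono') auto
    also have "\<dots> = (y L powr a) ^ n"
      using y0 by (simp add: powr_powr[symmetric] powr_realpow)
    finally have "(C * L) ^ n * ((2 * q) ^ N * q powr (- (\<theta> * real N))) \<le> (C * L) ^ n * (y L powr a) ^ n"
      using pos L(1) by (intro mult_left_mono) auto
    also have "\<dots> = (C * L * y L powr a) ^ n" by (simp add: power_mult_distrib)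
    also have "\<dots> \<le> exp (- 1) ^ n"
      using pos L(1,5) by (intro power_mono) auto
    also have "\<dots> = exp (- real n)" by (simp flip: exp_of_nat_mult)
    finally show ?thesis .
  qed
  then show ?thesis
    using L z zL unfolding q_def
    by (intro exI[of _ L] conjI exI[of _ z] exI[of _ "3 * exp 2 * z"]) (auto simp: z_def)
qed

text \<open>
  The inequalities by which \<open>n\<close> has to be large, for given constants.
\<close>

lemma eventually_parameters:
  fixes \<alpha> b K \<theta> \<tau> \<rho> c t0 G Cu A T0 Ck :: real
  assumes "0 < \<alpha>" "0 < b" "b < 1/2" "0 < K" "0 < \<theta>" "0 < \<tau>" "0 < \<rho>" "0 < c" "0 < t0" "0 < G"
    "0 < Cu" "0 < A" "0 < T0" "0 < Ck"
  shows "\<forall>\<^sub>F n in sequentially.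
     ln (real n) \<ge> 1 \<and>
     T0 \<le> (A * (real n / ln n)) powr (1/\<alpha>) \<and> T0 \<le> real n powr (1/\<alpha>) / \<tau> \<and>
     \<tau> * \<rho> \<le> sqrt c * ln n powr (1 / \<alpha>) \<and>
     G * (2 * sqrt c) \<le> t0 * \<rho> * (real n / ln n) powr (1/\<alpha>) \<and>
     Cu * (ln n / (A * n)) \<le> 1 / 2 \<and>
     2 * (Ck * real n powr (1 - 2 * b)) \<le> real n powr (1 - b) / 4 \<and>
     exp (- (real n powr (1 - b) / 4)) \<le> real n powr (- K) \<and>
     exp (- \<theta> * n / 8) \<le> real n powr (- K) \<and> exp (- real n) \<le> real n powr (- K)"
proof -
  have [simp]: "1 / \<alpha> > 0" "1 - b > 0" "1 - 2 * b > 0" "1 - 2 * b < 1 - b" using assms by auto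
  have "\<forall>\<^sub>F n in sequentially. ln (real n) \<ge> 1" by real_asymp
  moreover have "\<forall>\<^sub>F n in sequentially. T0 \<le> (A * (real n / ln n)) powr (1/\<alpha>)"
    using assms by real_asymp
  moreover have "\<forall>\<^sub>F n in sequentially. T0 \<le> real n powr (1/\<alpha>) / \<tau>"
    using assms by real_asymp
  moreover have "\<forall>\<^sub>F n in sequentially. \<tau> * \<rho> \<le> sqrt c * ln (real n) powr (1 / \<alpha>)"
  proof -
    have "sqrt c > 0" using assms by simp
    then show ?thesis using assms by real_asymp
  qed
  moreover have "\<forall>\<^sub>F n in sequentially. G * (2 * sqrt c) \<le> t0 * \<rho> * (real n / ln n) powr (1/\<alpha>)"
  proof -
    have "G * (2 * sqrt c) > 0" "t0 * \<rho> > 0" using assms by simp_all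
    then show ?thesis using assms by real_asymp
  qed
  moreover have "\<forall>\<^sub>F n in sequentially. Cu * (ln n / (A * real n)) \<le> 1 / 2"
    using assms by real_asymp
  moreover have "\<forall>\<^sub>F n in sequentially. 2 * (Ck * real n powr (1 - 2 * b)) \<le> real n powr (1 - b) / 4"
    using assms by real_asymp
  moreover have "\<forall>\<^sub>F n in sequentially. exp (- (real n powr (1 - b) / 4)) \<le> real n powr (- K)"
    using assms by real_asymp
  moreover have "\<forall>\<^sub>F n in sequentially. exp (- \<theta> * real n / 8) \<le> real n powr (- K)"
    using assms by real_asymp
  moreover have "\<forall>\<^sub>F n in sequentially. exp (- real n) \<le> real n powr (- K)"
    using assms by real_asymp
  ultimately show ?thesis by eventually_elim blast
qed

context iid_matrix
begin

text \<open>
  The constant \<open>A\<close> is chosen such that a column is bounded with probability at least \<open>n powr (-b)\<close>, and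
  \<open>L\<close> such that the tail bound for one column beats the number of columns.
\<close>

lemma small_singular_value_event:
  fixes a \<alpha> b Cu Cm T0 A L K Ck :: real
  assumes N: "real N \<le> (a + 1) * real n" and a: "a > 1"
    and \<alpha>: "0 < \<alpha>" and b: "0 < b" and Cu: "Cu > 0" and Cm: "Cm > 0"
    and moment: "\<And>T. T \<ge> T0 \<Longrightarrow> (\<integral>x. min 1 ((x / T)\<^sup>2) \<partial>D) \<le> Cm * T powr (-\<alpha>)"
    and tail: "\<And>T. T \<ge> T0 \<Longrightarrow> measure D {y. \<bar>y\<bar> > T} \<le> Cu * T powr (-\<alpha>)"
    and A: "A = 2 * Cu * (a + 1) / b" and L: "L = K + 1 + 2 * Cm * (a + 1) / A"
    and k: "1 \<le> k" "k \<le> n" "real k \<le> Ck * real n powr (1 - 2 * b)"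
    and n: "ln (real n) \<ge> 1" "T0 \<le> (A * (real n / ln n)) powr (1/\<alpha>)"
      "Cu * (ln n / (A * n)) \<le> 1 / 2"
      "2 * (Ck * real n powr (1 - 2 * b)) \<le> real n powr (1 - b) / 4"
      "exp (- (real n powr (1 - b) / 4)) \<le> real n powr (- K)"
  shows "\<exists>E\<in>events. (\<forall>\<omega>\<in>E. (kth_smallest_singular_value (sample_matrix \<omega>) k)\<^sup>2
        \<le> 2 * (L * ln n) * (A * (real n / ln n)) powr (2 / \<alpha>)) \<and>
      1 - prob E \<le> 2 * real n powr (- K)"
proof -
  define T where "T = (A * (real n / ln n)) powr (1/\<alpha>)"
  have A0: "A > 0" unfolding A using Cu a b by simp
  have n1: "n \<ge> 1" using k by simp
  have An: "A * (real n / ln n) > 0"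
    by (rule mult_pos_pos[OF A0 divide_pos_pos]) (use n(1) n1 in linarith)+
  have T: "T > 0" unfolding T_def powr_gt_zero by (rule less_imp_neq[OF An, symmetric])
  have "(y powr (1/\<alpha>)) powr (-\<alpha>) = 1 / y" "(y powr (1/\<alpha>))\<^sup>2 = y powr (2/\<alpha>)" if "y > 0" for y
    using that \<alpha> by (simp_all add: powr_powr powr_minus_divide power2_eq_square flip: powr_add)
  from this[OF An] have T\<alpha>: "T powr (-\<alpha>) = ln n / (A * n)"
    and T2: "T\<^sup>2 = (A * (real n / ln n)) powr (2/\<alpha>)"
    by (simp_all add: T_def)
  have TT: "T0 \<le> T" using n(2) by (simp add: T_def)
  define p where "p = Cm * (ln n / (A * n))"
  have "ln n / (A * n) \<ge> 0" using A0 n(1) by (intro divide_nonneg_nonneg) auto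
  then have p0: "p \<ge> 0" using Cm by (simp only: p_def mult_nonneg_nonneg less_imp_le)
  have p: "(\<integral>x. min 1 ((x / T)\<^sup>2) \<partial>D) \<le> p" using moment[OF TT] by (simp add: T\<alpha> p_def)
  obtain E where E: "E \<in> events"
      "\<forall>\<omega>\<in>E. (kth_smallest_singular_value (sample_matrix \<omega>) k)\<^sup>2 \<le> 2 * (L * ln n) * T\<^sup>2"
      "1 - prob E \<le> n * exp (2 * p * N - L * ln n) + exp (2 * real k - (measure D {y. \<bar>y\<bar> \<le> T}) ^ N * n / 2)"
    using kth_smallest_singular_value_bound[OF k(1,2) T p, of "L * ln n"] by (elim bexE conjE)
  have "n * exp (2 * p * N - L * ln n) \<le> n * exp (- (K + 1) * ln n)"
  proof -
    have "2 * p * N \<le> 2 * p * ((a + 1) * real n)"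
      by (intro mult_left_mono N) (use p0 in simp)
    also have "\<dots> = 2 * Cm * (a + 1) / A * ln n" using n1 A0 by (simp add: p_def field_simps)
    finally have "2 * p * N - L * ln n \<le> - (K + 1) * ln n" by (simp add: L algebra_simps)
    then show ?thesis by (intro mult_left_mono) auto
  qed
  also have "n * exp (- (K + 1) * ln n) = real n powr (- K)"
  proof -
    have "real n * exp (- (K + 1) * ln n) = real n * real n powr (- (K + 1))"
      using n1 by (simp add: powr_def)
    also have "\<dots> = real n powr (- K)" using n1 by (simp add: powr_mult_base)
    finally show ?thesis .
  qed
  finally have 1: "n * exp (2 * p * N - L * ln n) \<le> real n powr (- K)" .
  have "exp (2 * real k - (measure D {y. \<bar>y\<bar> \<le> T}) ^ N * n / 2) \<le> exp (- (real n powr (1 - b) / 4))"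
  proof -
    define t where "t = Cu * (ln n / (A * n))"
    have t: "0 \<le> t" "t \<le> 1 / 2"
      using \<open>ln n / (A * n) \<ge> 0\<close> Cu n(3) unfolding t_def by (simp_all only: mult_nonneg_nonneg less_imp_le)
    have "measure D {y. \<bar>y\<bar> \<le> T} = 1 - measure D {y. \<bar>y\<bar> > T}"
      using D.prob_compl[of "{y. \<bar>y\<bar> > T}"]
      by (simp add: Compl_eq_Diff_UNIV[symmetric] Collect_neg_eq[symmetric] not_less)
    also have "\<dots> \<ge> 1 - t" using tail[OF TT] by (simp add: T\<alpha> t_def)
    also have "1 - t \<ge> exp (- 2 * t)"
    proof -
      have "t * t \<le> t * (1/2)" using t by (intro mult_left_mono) auto
      then have "- 2 * t \<le> - t - 2 * t\<^sup>2" by (simp add: power2_eq_square)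
      also have "\<dots> \<le> ln (1 - t)" using t by (intro ln_one_minus_pos_lower_bound) auto
      finally have "exp (- 2 * t) \<le> exp (ln (1 - t))" by simp
      then show ?thesis using t by simp
    qed
    finally have "exp (- 2 * t) ^ N \<le> (measure D {y. \<bar>y\<bar> \<le> T}) ^ N"
      by (intro power_mono) auto
    moreover have "real n powr (- b) \<le> exp (- 2 * t) ^ N"
    proof -
      have "t * N \<le> t * ((a + 1) * real n)" using N t by (intro mult_left_mono) auto
      also have "\<dots> = Cu * (a + 1) / A * ln n" using n1 A0 by (simp add: t_def field_simps)
      also have "Cu * (a + 1) / A = b / 2"
      proof -
        have "Cu * d / (2 * Cu * d / b) = b / 2" if "d > 0" for d
          using that Cu by simp
        from this[of "a + 1"] show ?thesis using a unfolding A by simp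
      qed
      finally have "exp (- b * ln n) \<le> exp (N * (- 2 * t))" by (simp add: algebra_simps)
      then show ?thesis using n1 by (simp add: powr_def flip: exp_of_nat_mult)
    qed
    ultimately have "real n powr (- b) * n / 2 \<le> (measure D {y. \<bar>y\<bar> \<le> T}) ^ N * n / 2"
      by (intro divide_right_mono mult_right_mono) auto
    moreover have "real n powr (- b) * n = real n powr (1 - b)"
      using n1 by (simp add: powr_mult_base mult.commute)
    ultimately show ?thesis using k(3) n(4) by simp
  qed
  from order_trans[OF this n(5)]
  have 2: "exp (2 * real k - (measure D {y. \<bar>y\<bar> \<le> T}) ^ N * n / 2) \<le> real n powr (- K)" .
  show ?thesis using E 1 2 unfolding T2 by (intro bexI[of _ E]) auto
qed

text \<open>
  The truncation for the rounding is \<open>n powr (1 / \<alpha>) / \<tau>\<close>, the size of the largest entries of a row. It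
  is larger than the one used for the singular value by a power of \<open>ln n\<close>, which is why the mesh is
  eventually below \<open>\<kappa>\<close>. The equation for \<open>c\<close> is the point at which \<open>\<Lambda>\<close> and \<open>\<rho>\<close>, hence \<open>\<delta>\<close> and \<open>K\<close>, determine
  the size of the components that are regarded as small.
\<close>

lemma delocalised_vectors_event:
  fixes \<alpha> \<theta> \<tau> \<rho> c t0 G C0 Cm T0 K \<Lambda> z q \<delta> :: real
  assumes N: "real n \<le> real N"
    and decay: "\<And>t. \<bar>t\<bar> \<le> t0 \<Longrightarrow> cmod (char D t) \<le> exp (- C0 * \<bar>t\<bar> powr \<alpha>)"
    and moment: "\<And>T. T \<ge> T0 \<Longrightarrow> (\<integral>x. min 1 ((x / T)\<^sup>2) \<partial>D) \<le> Cm * T powr (-\<alpha>)"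
    and \<alpha>: "0 < \<alpha>" "\<alpha> < 2" and pos: "\<rho> > 0" "c > 0" "C0 > 0"
    and \<theta>: "0 < \<theta>" and \<tau>: "0 < \<tau>" "\<tau> \<le> 1" "2 * Cm * \<tau> powr \<alpha> \<le> \<theta> / 8"
    and \<delta>: "0 < \<delta>" "\<delta> \<le> 1"
    and \<Lambda>: "\<Lambda> \<ge> 1" and z: "0 < z" "q = 3 * exp 2 * z" "q < 1" "exp (- C0 * (z * \<Lambda>) powr \<alpha>) \<le> z"
    and G: "G > 0" "1 / G\<^sup>2 \<le> z"
    and C: "C = 5 * exp (2 / \<alpha>) * (68 / (\<delta> * \<tau> powr \<alpha>)) powr (1 / \<alpha>)"
    and net: "(C * \<Lambda>) ^ n * ((2 * q) ^ N * q powr (- (\<theta> * real N))) \<le> exp (- real n)"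
    and scale: "\<delta> * c powr ((\<alpha> - 2) / 2) = 8 * (\<Lambda> * \<rho>) powr \<alpha>"
    and n: "ln (real n) \<ge> 1" "T0 \<le> real n powr (1/\<alpha>) / \<tau>"
     "\<tau> * \<rho> \<le> sqrt c * ln n powr (1 / \<alpha>)"
     "G * (2 * sqrt c) \<le> t0 * \<rho> * (real n / ln n) powr (1/\<alpha>)"
     "exp (- \<theta> * n / 8) \<le> real n powr (- K)" "exp (- real n) \<le> real n powr (- K)"
  shows "\<exists>E\<in>events. (\<forall>\<omega>\<in>E. \<forall>u. (\<Sum>j<n. (u j)\<^sup>2) = 1 \<longrightarrow>
      (\<Sum>j\<in>{j\<in>{..<n}. \<bar>u j\<bar> \<le> sqrt (c * ln n / n)}. (u j)\<^sup>2) \<ge> \<delta> \<longrightarrow>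
      (\<Sum>i<N. (\<Sum>j<n. X i j \<omega> * u j)\<^sup>2) > \<theta> / 2 * N * \<rho>\<^sup>2 * (real n / ln n) powr (2 / \<alpha> - 1)) \<and>
    1 - prob E \<le> 2 * real n powr (- K)"
proof -
  have n1: "n > 0" using n(1) by (cases n) auto
  define l where "l = real n / ln n"
  have l: "l > 0" unfolding l_def by (rule divide_pos_pos) (use n(1) n1 in linarith)+
  define r where "r = \<rho> * l powr (1/\<alpha> - 1/2)"
  have lp: "l powr (1/\<alpha> - 1/2) = l powr (- (1/2)) * l powr (1/\<alpha>)"
    unfolding powr_add[symmetric] by simp
  define T where "T = real n powr (1/\<alpha>) / \<tau>"
  define \<kappa> where "\<kappa> = sqrt (c / l)"
  have r: "r > 0" using pos l by (simp add: r_def)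
  have T: "T > 0" using \<tau> n1 by (simp add: T_def)
  have \<kappa>: "\<kappa> > 0" using pos l by (simp add: \<kappa>_def)
  have \<kappa>_eq: "\<kappa> = sqrt (c * ln n / n)" by (simp add: \<kappa>_def l_def)
  have T\<alpha>: "T powr \<alpha> = real n / \<tau> powr \<alpha>"
    using \<tau> n1 \<alpha> by (simp add: T_def powr_divide powr_powr)
  have \<kappa>p: "\<kappa> = sqrt c * l powr (- (1/2))"
    using l by (simp add: \<kappa>_def real_sqrt_divide powr_minus powr_half_sqrt field_simps)
  have h\<kappa>: "r / T \<le> \<kappa>"
  proof -
    have "r / T = \<tau> * \<rho> * (l powr (1/\<alpha> - 1/2) / real n powr (1/\<alpha>))" by (simp add: r_def T_def)
    also have "\<dots> = \<tau> * \<rho> * (l powr (- (1/2)) * (l powr (1/\<alpha>) / real n powr (1/\<alpha>)))"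
      unfolding lp by simp
    also have "l powr (1/\<alpha>) / real n powr (1/\<alpha>) = 1 / ln n powr (1/\<alpha>)"
      using n n1 by (simp add: l_def powr_divide)
    also have "\<tau> * \<rho> * (l powr (- (1/2)) * (1 / ln n powr (1/\<alpha>)))
        = l powr (- (1/2)) * (\<tau> * \<rho> / ln n powr (1/\<alpha>))" by simp
    also have "\<dots> \<le> l powr (- (1/2)) * sqrt c"
      using n(1,3) by (intro mult_left_mono) (auto simp: field_simps)
    finally show ?thesis by (simp add: \<kappa>p mult.commute)
  qed
  have G\<kappa>: "G * (2 * \<kappa>) \<le> t0 * r"
  proof -
    have "G * (2 * \<kappa>) = G * (2 * sqrt c) * l powr (- (1/2))" by (simp add: \<kappa>p)
    also have "\<dots> \<le> t0 * \<rho> * l powr (1/\<alpha>) * l powr (- (1/2))"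
      using n(4) by (intro mult_right_mono) (auto simp: l_def)
    also have "\<dots> = t0 * r" by (simp add: r_def lp)
    finally show ?thesis .
  qed
  have scale': "\<delta> * \<kappa> powr (\<alpha> - 2) \<ge> 8 * (\<Lambda> * r) powr \<alpha>"
  proof -
    have "\<kappa> powr (\<alpha> - 2) = (c / l) powr ((\<alpha> - 2) / 2)"
      using l pos by (simp add: \<kappa>_def powr_half_sqrt[symmetric] powr_powr)
    also have "\<dots> = c powr ((\<alpha> - 2) / 2) * l powr (1 - \<alpha>/2)"
    proof -
      have "1 - \<alpha>/2 = - ((\<alpha> - 2) / 2)" by (simp add: field_simps)
      then show ?thesis using l pos by (simp add: powr_divide powr_minus_divide)
    qed
    finally have "\<delta> * \<kappa> powr (\<alpha> - 2) = 8 * ((\<Lambda> * \<rho>) powr \<alpha> * l powr (1 - \<alpha>/2))"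
      using scale by simp
    also have "l powr (1 - \<alpha>/2) = (l powr (1/\<alpha> - 1/2)) powr \<alpha>"
      using \<alpha> by (simp add: powr_powr algebra_simps)
    also have "(\<Lambda> * \<rho>) powr \<alpha> * (l powr (1/\<alpha> - 1/2)) powr \<alpha> = (\<Lambda> * r) powr \<alpha>"
      using pos \<Lambda> l by (simp add: r_def powr_mult[symmetric] mult_ac)
    finally show ?thesis by simp
  qed
  define B where "B = 68 * \<Lambda> powr \<alpha> / (\<delta> * \<tau> powr \<alpha>)"
  have CB: "5 * exp (2 / \<alpha>) * B powr (1 / \<alpha>) = C * \<Lambda>"
  proof -
    have "B powr (1/\<alpha>) = ((68 / (\<delta> * \<tau> powr \<alpha>)) * \<Lambda> powr \<alpha>) powr (1/\<alpha>)" by (simp add: B_def)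
    also have "\<dots> = (68 / (\<delta> * \<tau> powr \<alpha>)) powr (1/\<alpha>) * \<Lambda>"
      using \<delta> \<tau> \<Lambda> \<alpha> by (subst powr_mult) (simp_all add: powr_powr)
    finally show ?thesis by (simp add: C)
  qed
  define p where "p = Cm * T powr (-\<alpha>)"
  have p: "(\<integral>x. min 1 ((x / T)\<^sup>2) \<partial>D) \<le> p" unfolding p_def using n(2) by (intro moment) (simp add: T_def)
  have q': "exp 2 * (z + exp (- C0 * (z * \<Lambda>) powr \<alpha>) + 1 / G\<^sup>2) \<le> q"
  proof -
    have "exp 2 * (z + exp (- C0 * (z * \<Lambda>) powr \<alpha>) + 1 / G\<^sup>2) \<le> exp 2 * (z + z + z)"
      using z(4) G(2) by (intro mult_left_mono add_mono) auto
    then show ?thesis by (simp add: z(2))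
  qed
  define R where "R = \<theta> / 2 * real N"
  define S where "S = \<theta> / 4 * real N"
  obtain E where E: "E \<in> events"
    "\<forall>\<omega>\<in>E. \<forall>u. (\<Sum>j<n. (u j)\<^sup>2) = 1 \<longrightarrow> (\<Sum>j\<in>{j\<in>{..<n}. \<bar>u j\<bar> \<le> \<kappa>}. (u j)\<^sup>2) \<ge> \<delta> \<longrightarrow>
      (\<Sum>i<N. (\<Sum>j<n. X i j \<omega> * u j)\<^sup>2) > R * r\<^sup>2"
    "1 - prob E \<le> exp (2 * p * (N * n) - S)
      + (5 * exp (2 / \<alpha>) * B powr (1 / \<alpha>)) ^ n * ((2 * q) ^ N * q powr (- (R + 2 * S)))"
    using delocalised_vectors_bound[OF decay \<alpha> r T \<kappa> \<Lambda> n1 pos(3) z(1) G(1) \<tau>(1,2) T\<alpha> h\<kappa> \<delta> scale' G\<kappa> q' z(3) B_def p,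
        of R S] by blast
  have "exp (2 * p * (N * n) - S) \<le> exp (- \<theta> * n / 8)"
  proof -
    have "p = Cm * (\<tau> powr \<alpha> / n)" using T\<alpha> T by (simp add: p_def powr_minus divide_inverse mult_ac)
    then have "2 * p * (N * n) = 2 * Cm * \<tau> powr \<alpha> * N" using n1 by simp
    also have "\<dots> \<le> \<theta> / 8 * N" by (intro mult_right_mono \<tau>(3)) auto
    finally have "2 * p * (N * n) - S \<le> - (\<theta> / 8 * N)" by (simp add: S_def)
    also have "\<dots> \<le> - (\<theta> / 8 * n)" using N \<theta> by simp
    finally show ?thesis by simp
  qed
  then have 1: "exp (2 * p * (N * n) - S) \<le> real n powr (- K)" using n(5) by linarith
  have "R + 2 * S = \<theta> * real N" by (simp add: R_def S_def)
  then have 2: "(5 * exp (2 / \<alpha>) * B powr (1 / \<alpha>)) ^ n * ((2 * q) ^ N * q powr (- (R + 2 * S))) \<le> real n powr (- K)"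
    unfolding CB using net n(6) by simp
  have RR: "R * r\<^sup>2 = \<theta> / 2 * N * \<rho>\<^sup>2 * l powr (2 / \<alpha> - 1)"
  proof -
    have "(l powr (1/\<alpha> - 1/2))\<^sup>2 = l powr (2/\<alpha> - 1)"
      by (simp add: power2_eq_square flip: powr_add)
    then show ?thesis by (simp add: R_def r_def power_mult_distrib)
  qed
  show ?thesis
  proof (intro bexI[of _ E] conjI E(1))
    show "\<forall>\<omega>\<in>E. \<forall>u. (\<Sum>j<n. (u j)\<^sup>2) = 1 \<longrightarrow>
      (\<Sum>j\<in>{j\<in>{..<n}. \<bar>u j\<bar> \<le> sqrt (c * ln n / n)}. (u j)\<^sup>2) \<ge> \<delta> \<longrightarrow>
      (\<Sum>i<N. (\<Sum>j<n. X i j \<omega> * u j)\<^sup>2) > \<theta> / 2 * N * \<rho>\<^sup>2 * (real n / ln n) powr (2 / \<alpha> - 1)"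
      using E(2) unfolding RR \<kappa>_eq l_def .
    show "1 - prob E \<le> 2 * real n powr (- K)" using E(3) 1 2 by linarith
  qed
qed

end

section \<open>Localization of the singular vectors\<close>

lemma holds_with_prob_one_minus_bigoI:
  assumes "C \<ge> 0" "\<And>n. r n \<ge> 0" "\<And>n. prob_space (M n)"
    and "\<forall>\<^sub>F n in sequentially. \<exists>E\<in>sets (M n). (\<forall>\<omega>\<in>E. P n \<omega>) \<and> 1 - measure (M n) E \<le> C * r n"
  shows "holds_with_prob_one_minus_bigo M P r"
proof -
  let ?Q = "\<lambda>n E. E \<in> sets (M n) \<and> (\<forall>\<omega>\<in>E. P n \<omega>) \<and> 1 - measure (M n) E \<le> C * r n"
  define E where "E n = (if \<exists>E. ?Q n E then SOME E. ?Q n E else {})" for n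
  have EQ: "?Q n (E n)" if "\<exists>E. ?Q n E" for n
    unfolding E_def using someI_ex[OF that] that by simp
  have "E n \<in> sets (M n) \<and> (\<forall>\<omega>\<in>E n. P n \<omega>)" for n
    using EQ[of n] by (cases "\<exists>E. ?Q n E") (auto simp: E_def)
  moreover have "(\<lambda>n. 1 - measure (M n) (E n)) \<in> O(r)"
  proof (rule bigoI)
    show "\<forall>\<^sub>F n in sequentially. norm (1 - measure (M n) (E n)) \<le> C * norm (r n)"
      using assms(4)
    proof eventually_elim
      case (elim n)
      then have "1 - measure (M n) (E n) \<le> C * r n" using EQ[of n] by blast
      moreover have "measure (M n) (E n) \<le> 1" using assms(3) by (rule prob_space.prob_le_1)
      ultimately show ?case using assms(2) by simp
    qed
  qed
  ultimately show ?thesis unfolding holds_with_prob_one_minus_bigo_def by blast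
qed

lemma num_rows_bounds:
  assumes "a > 1" "n \<ge> 1"
  shows "a * real n \<le> real (num_rows a n)" "real n \<le> real (num_rows a n)"
    "real (num_rows a n) \<le> (a + 1) * real n"
proof -
  have "a * real n \<ge> 1 * real n" using assms by (intro mult_right_mono) auto
  then have p: "a * real n \<ge> real n" by simp
  show 1: "a * real n \<le> real (num_rows a n)"
    unfolding num_rows_def by (rule real_nat_ceiling_ge)
  show "real n \<le> real (num_rows a n)" using 1 p by simp
  have "real (num_rows a n) \<le> a * real n + 1"
    unfolding num_rows_def using p by (simp add: of_nat_nat)
  then show "real (num_rows a n) \<le> (a + 1) * real n" using assms by (simp add: algebra_simps)
qed

text \<open>
  A failure of the localization is turned into mass on the small coordinates, which is the hypothesis
  of the lower bound for \<open>\<parallel>X u\<parallel>\<close>.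
\<close>

lemma restricted_l2_norm_large_components:
  assumes dim: "dim_vec u = n" and nrm: "(\<Sum>j<n. (u $ j)\<^sup>2) = 1"
    and less: "restricted_l2_norm u (large_components c n u) < sqrt (1 - \<delta>)"
  shows "(\<Sum>j\<in>{j\<in>{..<n}. \<bar>u $ j\<bar> \<le> sqrt (c * ln n / n)}. (u $ j)\<^sup>2) \<ge> \<delta>"
proof -
  let ?I = "{j\<in>{..<n}. \<bar>u $ j\<bar> \<le> sqrt (c * ln n / n)}"
  have "{..<n} \<inter> large_components c n u = {..<n} - ?I"
    by (auto simp: large_components_def)
  then have "sqrt (\<Sum>j\<in>{..<n} - ?I. (u $ j)\<^sup>2) < sqrt (1 - \<delta>)"
    using less by (simp add: restricted_l2_norm_def L2_set_def dim)
  then have "(\<Sum>j\<in>{..<n} - ?I. (u $ j)\<^sup>2) < 1 - \<delta>" by simp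
  moreover have "(\<Sum>j<n. (u $ j)\<^sup>2) = (\<Sum>j\<in>{..<n} - ?I. (u $ j)\<^sup>2) + (\<Sum>j\<in>?I. (u $ j)\<^sup>2)"
    by (rule sum.subset_diff) auto
  ultimately show ?thesis using nrm by simp
qed

lemma iid_entries_law:
  assumes "a > 1" "iid_entries a D M x"
  shows "real_distribution D"
proof -
  interpret prob_space "M 1" using assms(2) by (simp add: iid_entries_def)
  have N: "0 < num_rows a 1" using num_rows_bounds[of a 1] assms(1) by simp
  then have "distr (M 1) borel (x 1 0 0) = D" using assms(2) by (simp add: iid_entries_def)
  moreover have "x 1 0 0 \<in> borel_measurable (M 1)"
  proof -
    have "indep_vars (\<lambda>_. borel) (\<lambda>(i, j). x 1 i j) ({..<num_rows a 1} \<times> {..<1})"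
      using assms(2) unfolding iid_entries_def by blast
    then show ?thesis using N unfolding indep_vars_def by (auto dest!: bspec[where x="(0,0)"])
  qed
  ultimately show ?thesis using real_distribution_distr by metis
qed

lemma iid_entries_iid_matrix:
  assumes "a > 1" "iid_entries a D M x"
  shows "iid_matrix (M n) (x n) (num_rows a n) n D"
  using assms iid_entries_law[OF assms]
  by (auto simp: iid_entries_def iid_matrix_def iid_matrix_axioms_def)

theorem theorem1p8:
  fixes a \<alpha> C\<^sub>l C\<^sub>u T\<^sub>0 b :: real
    and D :: "real measure"
    and M :: "nat \<Rightarrow> 'w measure"
    and x :: "nat \<Rightarrow> nat \<Rightarrow> nat \<Rightarrow> 'w \<Rightarrow> real"
    and k :: "nat \<Rightarrow> nat"
  assumes "a > 1"
    and "0 < \<alpha>" and "\<alpha> < 2"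
    and "C\<^sub>l > 0" and "C\<^sub>u > 0" and "T\<^sub>0 > 0"
    and "iid_entries a D M x"
    and "heavy_tailed D \<alpha> C\<^sub>l C\<^sub>u T\<^sub>0"
    and "symmetrically_distributed D"
    and "0 < b" and "b < 1/2"
    and "\<forall>n\<ge>1. 1 \<le> k n \<and> k n \<le> n"
    and "(\<lambda>n. real (k n)) \<in> O(\<lambda>n. real n powr (1 - 2 * b))"
  shows "\<forall>\<delta> K. 0 < \<delta> \<and> \<delta> < 1 \<and> 0 < K \<longrightarrow>
    (\<exists>c>0. holds_with_prob_one_minus_bigo M
       (\<lambda>n \<omega>. \<forall>u. unit_right_singular_vector (random_matrix a x n \<omega>)
                      (kth_smallest_singular_value (random_matrix a x n \<omega>) (k n)) u \<longrightarrow>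
                restricted_l2_norm u (large_components c n u) \<ge> sqrt (1 - \<delta>))
       (\<lambda>n. real n powr (-K)))"
proof (intro allI impI, elim conjE)
  fix \<delta> K :: real
  assume \<delta>: "0 < \<delta>" "\<delta> < 1" and K: "0 < K"
  note a = assms(1) and \<alpha> = assms(2,3) and tails = assms(4-6) and iid = assms(7) and ht = assms(8)
    and b = assms(10,11) and k = assms(12)
  have D: "real_distribution D" by (rule iid_entries_law[OF a iid])
  obtain C\<^sub>m where C\<^sub>m: "C\<^sub>m > 0" "\<forall>T\<ge>T\<^sub>0. (\<integral>x. min 1 ((x / T)\<^sup>2) \<partial>D) \<le> C\<^sub>m * T powr (-\<alpha>)"
    using heavy_tailed_truncated_second_moment[OF D ht \<alpha> tails(2,3)] by blast
  obtain C\<^sub>0 t\<^sub>0 where C\<^sub>0: "C\<^sub>0 > 0" "t\<^sub>0 > 0"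
      "\<forall>t. \<bar>t\<bar> \<le> t\<^sub>0 \<longrightarrow> cmod (char D t) \<le> exp (- C\<^sub>0 * \<bar>t\<bar> powr \<alpha>)"
    using symmetric_heavy_tailed_char_decay[OF D ht assms(9) \<alpha>(1) tails] by blast
  obtain C\<^sub>k where C\<^sub>k: "C\<^sub>k > 0" "\<forall>\<^sub>F n in sequentially. norm (real (k n)) \<le> C\<^sub>k * norm (real n powr (1 - 2 * b))"
    using landau_o.bigE[OF assms(13)] by blast
  define A where "A = 2 * C\<^sub>u * (a + 1) / b"
  have A: "A > 0" using a b tails by (simp add: A_def)
  define L where "L = K + 1 + 2 * C\<^sub>m * (a + 1) / A"
  have L: "L > 0" unfolding L_def using K C\<^sub>m A a by (intro add_pos_nonneg) auto
  \<comment> \<open>Half of the available gain: \<open>a * (1 - \<theta>)\<^sup>2 = sqrt a\<close>.\<close>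
  define \<theta> where "\<theta> = 1 - a powr (- (1/4))"
  have a4: "0 < a powr (- (1/4))" "a powr (- (1/4)) < 1"
    using a powr_less_mono[of "- (1/4)" 0 a] by auto
  have \<theta>: "0 < \<theta>" "\<theta> < 1" using a4 by (auto simp: \<theta>_def)
  have \<theta>a: "a * (1 - \<theta>)\<^sup>2 > 1"
  proof -
    have "a * (1 - \<theta>)\<^sup>2 = a * a powr (- (1/2))"
      by (simp add: \<theta>_def power2_eq_square flip: powr_add)
    also have "\<dots> = a powr (1/2)" using a by (simp add: powr_mult_base)
    also have "\<dots> > 1" using a by (intro gr_one_powr) auto
    finally show ?thesis .
  qed
  define \<tau> where "\<tau> = min 1 ((\<theta> / (16 * C\<^sub>m)) powr (1/\<alpha>))"
  have \<tau>: "0 < \<tau>" "\<tau> \<le> 1" using \<theta> C\<^sub>m by (auto simp: \<tau>_def)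
  have \<tau>2: "2 * C\<^sub>m * \<tau> powr \<alpha> \<le> \<theta> / 8"
  proof -
    have "\<tau> powr \<alpha> \<le> ((\<theta> / (16 * C\<^sub>m)) powr (1/\<alpha>)) powr \<alpha>"
      using \<tau> \<alpha> by (intro powr_mono2) (auto simp: \<tau>_def)
    also have "\<dots> = \<theta> / (16 * C\<^sub>m)" using \<theta> C\<^sub>m \<alpha> by (simp add: powr_powr)
    finally show ?thesis using C\<^sub>m by (simp add: field_simps)
  qed
  define C where "C = 5 * exp (2 / \<alpha>) * (68 / (\<delta> * \<tau> powr \<alpha>)) powr (1 / \<alpha>)"
  have C: "C > 0" using \<delta> \<tau> by (simp add: C_def)
  obtain \<Lambda> z q where \<Lambda>: "\<Lambda> \<ge> 1" and z: "0 < z" "q = 3 * exp 2 * z" "q < 1"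
      "exp (- C\<^sub>0 * (z * \<Lambda>) powr \<alpha>) \<le> z"
    and net: "\<forall>n N. a * real n \<le> real N \<longrightarrow> (C * \<Lambda>) ^ n * ((2 * q) ^ N * q powr (- (\<theta> * real N))) \<le> exp (- real n)"
    using net_beats_small_ball[OF a \<theta> \<theta>a C\<^sub>0(1) \<alpha>(1) C] by (elim exE conjE)
  \<comment> \<open>The Gaussian tail then costs no more than the other two terms.\<close>
  define G where "G = 1 / sqrt z"
  have G: "G > 0" "1 / G\<^sup>2 \<le> z" using z by (simp_all add: G_def power_divide)
  \<comment> \<open>This makes the two thresholds agree: a vector below the upper bound has at most \<open>\<theta> / 2 * N\<close> large rows.\<close>
  define \<rho> where "\<rho> = sqrt (4 * L * A powr (2/\<alpha>) / \<theta>)"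
  have \<rho>: "\<rho> > 0" "\<rho>\<^sup>2 = 4 * L * A powr (2/\<alpha>) / \<theta>" using L A \<theta> by (simp_all add: \<rho>_def)
  define m where "m = 8 * (\<Lambda> * \<rho>) powr \<alpha> / \<delta>"
  define c where "c = m powr (2 / (\<alpha> - 2))"
  have m: "m > 0" using \<Lambda> \<rho> \<delta> by (simp add: m_def)
  have one: "2 / (\<alpha> - 2) * ((\<alpha> - 2) / 2) = 1" using \<alpha> by simp
  have "c powr ((\<alpha> - 2) / 2) = m" unfolding c_def powr_powr one by (rule powr_one) (use m in simp)
  then have c: "c > 0" "\<delta> * c powr ((\<alpha> - 2) / 2) = 8 * (\<Lambda> * \<rho>) powr \<alpha>"
    using \<delta> m by (simp add: c_def, simp add: m_def)
  define good where "good n \<omega> \<longleftrightarrow> (\<forall>u. unit_right_singular_vector (random_matrix a x n \<omega>)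
       (kth_smallest_singular_value (random_matrix a x n \<omega>) (k n)) u \<longrightarrow>
       restricted_l2_norm u (large_components c n u) \<ge> sqrt (1 - \<delta>))" for n \<omega>
  have "\<forall>\<^sub>F n in sequentially. \<exists>E\<in>sets (M n). (\<forall>\<omega>\<in>E. good n \<omega>) \<and>
      1 - measure (M n) E \<le> 4 * real n powr (- K)"
    using C\<^sub>k(2) eventually_ge_at_top[of 1]
      eventually_parameters[OF \<alpha>(1) b K \<theta>(1) \<tau>(1) \<rho>(1) c(1) C\<^sub>0(2) G(1) tails(2) A tails(3) C\<^sub>k(1)]
  proof eventually_elim
    case (elim n)
    define N where "N = num_rows a n"
    note N = num_rows_bounds[OF a elim(2), folded N_def]
    interpret iid_matrix "M n" "x n" N n D
      unfolding N_def by (rule iid_entries_iid_matrix[OF a iid])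
    have kn: "1 \<le> k n" "k n \<le> n" "real (k n) \<le> C\<^sub>k * real n powr (1 - 2 * b)"
      using k elim(1,2) by auto
    have moment: "(\<integral>x. min 1 ((x / T)\<^sup>2) \<partial>D) \<le> C\<^sub>m * T powr (-\<alpha>)" if "T \<ge> T\<^sub>0" for T
      using C\<^sub>m(2) that by blast
    have tail: "measure D {y. \<bar>y\<bar> > T} \<le> C\<^sub>u * T powr (-\<alpha>)" if "T \<ge> T\<^sub>0" for T
      using ht that unfolding heavy_tailed_def by blast
    have decay: "cmod (char D t) \<le> exp (- C\<^sub>0 * \<bar>t\<bar> powr \<alpha>)" if "\<bar>t\<bar> \<le> t\<^sub>0" for t
      using C\<^sub>0(3) that by blast
    have lnn: "ln (real n) \<ge> 1" and p1: "T\<^sub>0 \<le> (A * (real n / ln n)) powr (1/\<alpha>)"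
      and p2: "T\<^sub>0 \<le> real n powr (1/\<alpha>) / \<tau>" and p3: "\<tau> * \<rho> \<le> sqrt c * ln n powr (1 / \<alpha>)"
      and p4: "G * (2 * sqrt c) \<le> t\<^sub>0 * \<rho> * (real n / ln n) powr (1/\<alpha>)"
      and p5: "C\<^sub>u * (ln n / (A * n)) \<le> 1 / 2"
      and p6: "2 * (C\<^sub>k * real n powr (1 - 2 * b)) \<le> real n powr (1 - b) / 4"
      and p7: "exp (- (real n powr (1 - b) / 4)) \<le> real n powr (- K)"
      and p8: "exp (- \<theta> * n / 8) \<le> real n powr (- K)" and p9: "exp (- real n) \<le> real n powr (- K)"
      using elim(3) by blast+
    have "\<exists>E\<in>events. (\<forall>\<omega>\<in>E. (kth_smallest_singular_value (sample_matrix \<omega>) (k n))\<^sup>2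
          \<le> 2 * (L * ln n) * (A * (real n / ln n)) powr (2 / \<alpha>)) \<and>
        1 - prob E \<le> 2 * real n powr (- K)"
      by (rule small_singular_value_event[OF N(3) a \<alpha>(1) b(1) tails(2) C\<^sub>m(1) moment tail A_def L_def kn
          lnn p1 p5 p6 p7])
    then obtain E1 where E1: "E1 \<in> events"
      "\<forall>\<omega>\<in>E1. (kth_smallest_singular_value (sample_matrix \<omega>) (k n))\<^sup>2
        \<le> 2 * (L * ln n) * (A * (real n / ln n)) powr (2 / \<alpha>)"
      "1 - prob E1 \<le> 2 * real n powr (- K)"
      by (elim bexE conjE)
    have net': "(C * \<Lambda>) ^ n * ((2 * q) ^ N * q powr (- (\<theta> * real N))) \<le> exp (- real n)"
      using net N(1) by blast
    have "\<exists>E\<in>events. (\<forall>\<omega>\<in>E. \<forall>u. (\<Sum>j<n. (u j)\<^sup>2) = 1 \<longrightarrow>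
        (\<Sum>j\<in>{j\<in>{..<n}. \<bar>u j\<bar> \<le> sqrt (c * ln n / n)}. (u j)\<^sup>2) \<ge> \<delta> \<longrightarrow>
        (\<Sum>i<N. (\<Sum>j<n. x n i j \<omega> * u j)\<^sup>2) > \<theta> / 2 * N * \<rho>\<^sup>2 * (real n / ln n) powr (2 / \<alpha> - 1)) \<and>
      1 - prob E \<le> 2 * real n powr (- K)"
      by (rule delocalised_vectors_event[OF N(2) decay moment \<alpha> \<rho>(1) c(1) C\<^sub>0(1)
            \<theta>(1) \<tau> \<tau>2 \<delta>(1) less_imp_le[OF \<delta>(2)] \<Lambda> z G C_def net' c(2) lnn p2 p3 p4 p8 p9])
    then obtain E2 where E2: "E2 \<in> events"
      "\<forall>\<omega>\<in>E2. \<forall>u. (\<Sum>j<n. (u j)\<^sup>2) = 1 \<longrightarrow>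
        (\<Sum>j\<in>{j\<in>{..<n}. \<bar>u j\<bar> \<le> sqrt (c * ln n / n)}. (u j)\<^sup>2) \<ge> \<delta> \<longrightarrow>
        (\<Sum>i<N. (\<Sum>j<n. x n i j \<omega> * u j)\<^sup>2) > \<theta> / 2 * N * \<rho>\<^sup>2 * (real n / ln n) powr (2 / \<alpha> - 1)"
      "1 - prob E2 \<le> 2 * real n powr (- K)"
      by (elim bexE conjE)
    have threshold: "2 * (L * ln n) * (A * (real n / ln n)) powr (2 / \<alpha>)
        \<le> \<theta> / 2 * N * \<rho>\<^sup>2 * (real n / ln n) powr (2 / \<alpha> - 1)"
    proof -
      define l where "l = real n / ln n"
      have l: "l > 0" unfolding l_def by (rule divide_pos_pos) (use elim(2) lnn in linarith)+
      have ln: "ln n = real n / l" using elim(2) lnn by (simp add: l_def)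
      have "2 * (L * ln n) * (A * l) powr (2 / \<alpha>) = 2 * L * A powr (2/\<alpha>) * real n * (l powr (2/\<alpha>) / l)"
        unfolding ln using A l by (simp add: powr_mult)
      also have "\<dots> \<le> 2 * L * A powr (2/\<alpha>) * real N * (l powr (2/\<alpha>) / l)"
        using N(2) L l by (intro mult_right_mono mult_left_mono) auto
      also have "l powr (2/\<alpha>) / l = l powr (2 / \<alpha> - 1)" using l by (simp add: powr_diff)
      also have "2 * L * A powr (2/\<alpha>) * real N * l powr (2 / \<alpha> - 1) = \<theta> / 2 * N * \<rho>\<^sup>2 * l powr (2 / \<alpha> - 1)"
        unfolding \<rho>(2) using \<theta> by simp
      finally show ?thesis unfolding l_def .
    qed
    have "good n \<omega>" if \<omega>: "\<omega> \<in> E1 \<inter> E2" for \<omega>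
      unfolding good_def
    proof (intro allI impI)
      fix u
      let ?s = "kth_smallest_singular_value (random_matrix a x n \<omega>) (k n)"
      assume u: "unit_right_singular_vector (random_matrix a x n \<omega>) ?s u"
      have X: "random_matrix a x n \<omega> \<in> carrier_mat N n" by (simp add: random_matrix_def N_def)
      have same: "sample_matrix \<omega> = random_matrix a x n \<omega>" unfolding sample_matrix_def unfolding random_matrix_def N_def ..
      note ud = unit_right_singular_vectorD[OF X u]
      show "restricted_l2_norm u (large_components c n u) \<ge> sqrt (1 - \<delta>)"
      proof (rule ccontr)
        assume "\<not> ?thesis"
        then have "(\<Sum>j\<in>{j\<in>{..<n}. \<bar>u $ j\<bar> \<le> sqrt (c * ln n / n)}. (u $ j)\<^sup>2) \<ge> \<delta>"
          by (intro restricted_l2_norm_large_components[OF ud(1,2)]) simp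
        then have "(\<Sum>i<N. (\<Sum>j<n. x n i j \<omega> * u $ j)\<^sup>2) > \<theta> / 2 * N * \<rho>\<^sup>2 * (real n / ln n) powr (2 / \<alpha> - 1)"
          using E2(2) \<omega> ud(2) by blast
        moreover have "(\<Sum>i<N. (\<Sum>j<n. x n i j \<omega> * u $ j)\<^sup>2) = ?s\<^sup>2"
          unfolding ud(3)[symmetric] by (simp add: random_matrix_def N_def)
        moreover have "?s\<^sup>2 \<le> 2 * (L * ln n) * (A * (real n / ln n)) powr (2 / \<alpha>)"
          using bspec[OF E1(2), of \<omega>] \<omega> unfolding same by blast
        ultimately show False using threshold by linarith
      qed
    qed
    moreover have "E1 \<inter> E2 \<in> events" using E1 E2 by auto
    moreover have "1 - prob (E1 \<inter> E2) \<le> 4 * real n powr (- K)"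
    proof -
      have "prob E1 + prob E2 - prob (E1 \<inter> E2) = prob (E1 \<union> E2)"
        using finite_measure_Union'[of E1 E2] finite_measure_Diff'[of E2 E1] E1 E2 by (simp add: Int_commute)
      also have "\<dots> \<le> 1" by (rule prob_le_1)
      finally show ?thesis using E1(3) E2(3) by linarith
    qed
    ultimately show ?case by (intro bexI[of _ "E1 \<inter> E2"]) auto
  qed
  then have "holds_with_prob_one_minus_bigo M good (\<lambda>n. real n powr (- K))"
    using iid by (intro holds_with_prob_one_minus_bigoI[where C = 4]) (auto simp: iid_entries_def)
  then show "\<exists>c>0. holds_with_prob_one_minus_bigo M
       (\<lambda>n \<omega>. \<forall>u. unit_right_singular_vector (random_matrix a x n \<omega>)
                      (kth_smallest_singular_value (random_matrix a x n \<omega>) (k n)) u \<longrightarrow>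
                restricted_l2_norm u (large_components c n u) \<ge> sqrt (1 - \<delta>))
       (\<lambda>n. real n powr (-K))"
    using c(1) unfolding good_def[abs_def] by blast
qed

end
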